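(* Let $f\in\mathbb{S}_d$ and define $X_f:=\overline{\{\mathcal{T}_vf\colon v\in\mathbb{R}^d\}}\subseteq\mathbb{S}_d$. Then \[d^*(f)=\sup\left\{\int_{\mathbb{S}_d}\int_{[0,1]^d}h(x)\,dx\,d\mu(h)\colon \mu\in\mathcal{M}_{\mathcal{T}}\text{ and }\mu(X_f)=1\right\},\] and this supremum is attained by some ergodic measure $\mu\in\mathcal{M}_{\mathcal{T}}$ with $\mu(X_f)=1$.
   Context: $\mathbb{S}_d$ denotes the set of all $f\in L^\infty(\mathbb{R}^d)$ with $0\le f\le1$ almost everywhere, with the weak-* topology inherited from $L^\infty(\mathbb{R}^d)\simeq L^1(\mathbb{R}^d)^*$ (compact metrisable); closures are taken in this topology. For $v\in\mathbb{R}^d$, $\mathcal{T}_v\colon\mathbb{S}_d\to\mathbb{S}_d$ is $(\mathcal{T}_vf)(x)=f(x+v)$. $\mathcal{M}_{\mathcal{T}}$ denotes the set of Borel probability measures $\mu$ on $\mathbb{S}_d$ which are invariant under every $\mathcal{T}_v$, $v\in\mathbb{R}^d$; such $\mu$ is ergodic if every Borel set $A$ with $\mathcal{T}_vA=A$ up to $\mu$-null sets for all $v$ has $\mu(A)\in\{0,1\}$. With $m$ Lebesgue measure and $Q(v,t)$ the closed axis-parallel cube of centre $v$ and side $t$, $d^*(f):=\limsup_{t\to\infty}\sup_{v\in\mathbb{R}^d}\frac{1}{m(Q(v,t))}\int_{Q(v,t)}f(x)\,dx$. *)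

theory Defs
  imports "HOL-Probability.Probability"
begin

text \<open>The dimension d is encoded by a Euclidean space type 'a (playing the role of R^d).
  Elements of S_d are represented by Lebesgue measurable functions with values in [0,1];
  a.e.-equal functions are not identified, but the weak-* topology below is the initial
  topology of the functionals f \<mapsto> \<integral> f g (g \<in> L^1), which cannot separate a.e.-equal
  functions, so all open/closed/Borel sets are unions of a.e.-classes.\<close>

definition Sd :: "('a::euclidean_space \<Rightarrow> real) set" where
  "Sd = {f. f \<in> borel_measurable lebesgue \<and> (\<forall>x. 0 \<le> f x \<and> f x \<le> 1)}"

definition Sd_top :: "('a::euclidean_space \<Rightarrow> real) topology" where
  "Sd_top = subtopology
     (topology_generated_by
        {{f. (\<integral>x. f x * g x \<partial>lebesgue) \<in> U} | g U. integrable lebesgue g \<and> open (U::real set)})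
     Sd"

definition Sd_borel :: "('a::euclidean_space \<Rightarrow> real) measure" where
  "Sd_borel = sigma Sd {U. openin Sd_top U}"

definition transl :: "'a::euclidean_space \<Rightarrow> ('a \<Rightarrow> real) \<Rightarrow> ('a \<Rightarrow> real)" where
  "transl v f = (\<lambda>x. f (x + v))"

definition M_T :: "('a::euclidean_space \<Rightarrow> real) measure set" where
  "M_T = {\<mu>. prob_space \<mu> \<and> sets \<mu> = sets Sd_borel \<and>
      (\<forall>v. \<forall>A\<in>sets \<mu>. emeasure \<mu> (transl v -` A \<inter> space \<mu>) = emeasure \<mu> A)}"

definition ergodic :: "('a::euclidean_space \<Rightarrow> real) measure \<Rightarrow> bool" where
  "ergodic \<mu> \<longleftrightarrow> (\<forall>A\<in>sets \<mu>.
      (\<forall>v. transl v ` A \<in> sets \<mu> \<and>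
           emeasure \<mu> ((transl v ` A - A) \<union> (A - transl v ` A)) = 0)
      \<longrightarrow> emeasure \<mu> A = 0 \<or> emeasure \<mu> A = 1)"

definition cube :: "'a::euclidean_space \<Rightarrow> real \<Rightarrow> 'a set" where
  "cube v t = cbox (v - (t/2) *\<^sub>R One) (v + (t/2) *\<^sub>R One)"

definition dstar :: "('a::euclidean_space \<Rightarrow> real) \<Rightarrow> ereal" where
  "dstar f = Limsup at_top (\<lambda>t::real. SUP v. ereal
      ((\<integral>x\<in>cube v t. f x \<partial>lebesgue) / measure lebesgue (cube v t)))"

definition orbit_closure :: "('a::euclidean_space \<Rightarrow> real) \<Rightarrow> ('a \<Rightarrow> real) set" where
  "orbit_closure f = Sd_top closure_of (range (\<lambda>v. transl v f))"

definition unit_mass :: "('a::euclidean_space \<Rightarrow> real) \<Rightarrow> real" where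
  "unit_mass h = (\<integral>x\<in>cbox 0 One. h x \<partial>lebesgue)"

end

theory Submission
  imports Defs
begin

text \<open>Averaging along finite lists of translations, \<open>p F = INF vs. SUP w. avg vs F (transl w f)\<close>
  is a sublinear functional on the continuous functions on \<open>S_d\<close>. The linear functionals dominated
  by \<open>p\<close> are exactly the integrals against the invariant probability measures carried by the orbit
  closure of f, and \<open>p\<close> of the unit mass is the upper density of f. A minimality argument in the style
  of Hahn and Banach produces a dominated functional that attains \<open>p\<close> at the unit mass and is moreover
  extreme among the dominated functionals; the Daniell-Stone theorem turns it into a measure, and
  extremality makes that measure ergodic: conditioning on an invariant set and on its complement would
  otherwise decompose it.\<close>

section \<open>Extreme functionals dominated by a sublinear functional\<close>

text \<open>Functions equal a.e. are not identified, so \<open>Sd_top\<close> is compact but not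
  Hausdorff. Topological arguments therefore run through countably many pairings with a sequence in
  L1 that controls all other pairings: these map \<open>Sd\<close> onto a compact set of real
  sequences, and distance functions pulled back from there show that the continuous functions
  generate the Borel sets. Lists of translations stand in for integrals over cubes: a finite average
  of a continuous function is plainly continuous, two such averages can be interchanged, and
  telescoping along the multiples of one vector makes every dominated functional invariant. The
  price is the comparison with \<open>dstar\<close>: lattice points realise integer cubes as lists,
  and a large cube is hardly changed by the bounded shifts of one fixed list. A minimal sublinear
  functional is linear but need not be extreme. The property \<open>facial\<close>, which passes to
  infima of chains and survives \<open>press\<close>, is therefore built into the family to which
  Zorn's lemma is applied.\<close>

definition sublinear_on :: "('b \<Rightarrow> real) set \<Rightarrow> (('b \<Rightarrow> real) \<Rightarrow> real) \<Rightarrow> bool" where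
  "sublinear_on L q \<longleftrightarrow> (\<forall>F\<in>L. \<forall>G\<in>L. q (\<lambda>x. F x + G x) \<le> q F + q G)
     \<and> (\<forall>F\<in>L. \<forall>c>0. q (\<lambda>x. c * F x) \<le> c * q F)"

definition linear_on_space :: "('b \<Rightarrow> real) set \<Rightarrow> (('b \<Rightarrow> real) \<Rightarrow> real) \<Rightarrow> bool" where
  "linear_on_space L \<Lambda> \<longleftrightarrow> (\<forall>F\<in>L. \<forall>G\<in>L. \<Lambda> (\<lambda>x. F x + G x) = \<Lambda> F + \<Lambda> G)
     \<and> (\<forall>F\<in>L. \<forall>c. \<Lambda> (\<lambda>x. c * F x) = c * \<Lambda> F)"

text \<open>The functionals below \<open>q\<close> form a face of the convex set of functionals below \<open>p\<close>; for linear \<open>q\<close>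
  this says that \<open>q\<close> is an extreme point.\<close>

definition facial :: "('b \<Rightarrow> real) set \<Rightarrow> (('b \<Rightarrow> real) \<Rightarrow> real) \<Rightarrow> (('b \<Rightarrow> real) \<Rightarrow> real) \<Rightarrow> bool" where
  "facial L p q \<longleftrightarrow> (\<forall>\<Lambda>1 \<Lambda>2 a. linear_on_space L \<Lambda>1 \<longrightarrow> linear_on_space L \<Lambda>2
      \<longrightarrow> (\<forall>F\<in>L. \<Lambda>1 F \<le> p F) \<longrightarrow> (\<forall>F\<in>L. \<Lambda>2 F \<le> p F) \<longrightarrow> 0 < a \<longrightarrow> a < 1
      \<longrightarrow> (\<forall>F\<in>L. a * \<Lambda>1 F + (1 - a) * \<Lambda>2 F \<le> q F)
      \<longrightarrow> (\<forall>F\<in>L. \<Lambda>1 F \<le> q F \<and> \<Lambda>2 F \<le> q F))"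

locale function_space =
  fixes L :: "('b \<Rightarrow> real) set"
  assumes zero_mem: "(\<lambda>_. 0) \<in> L"
    and add_mem: "F \<in> L \<Longrightarrow> G \<in> L \<Longrightarrow> (\<lambda>x. F x + G x) \<in> L"
    and scale_mem: "F \<in> L \<Longrightarrow> (\<lambda>x. c * F x) \<in> L"
begin

lemma uminus_mem: "F \<in> L \<Longrightarrow> (\<lambda>x. - F x) \<in> L"
  using scale_mem[of F "-1"] by simp

lemma add_scale_mem: "F \<in> L \<Longrightarrow> G \<in> L \<Longrightarrow> (\<lambda>x. F x + c * G x) \<in> L"
  by (intro add_mem scale_mem)

lemma diff_mem: "F \<in> L \<Longrightarrow> G \<in> L \<Longrightarrow> (\<lambda>x. F x - G x) \<in> L"
  using add_scale_mem[of F G "-1"] by simp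

end

locale sublinear_functional = function_space L for L :: "('b \<Rightarrow> real) set" +
  fixes q :: "('b \<Rightarrow> real) \<Rightarrow> real"
  assumes sublin: "sublinear_on L q"
begin

lemma subadd: "F \<in> L \<Longrightarrow> G \<in> L \<Longrightarrow> q (\<lambda>x. F x + G x) \<le> q F + q G"
  and subhom: "F \<in> L \<Longrightarrow> 0 < c \<Longrightarrow> q (\<lambda>x. c * F x) \<le> c * q F"
  using sublin by (auto simp: sublinear_on_def)

text \<open>The factor 1/c applied to c F gives the reverse inequality. \<open>sublinear_on\<close>
  can thus be stated with inequalities alone, the form that passes to infima.\<close>

lemma pos_hom: assumes "F \<in> L" "0 < c" shows "q (\<lambda>x. c * F x) = c * q F"
proof (rule antisym[OF subhom[OF assms]])
  have "q (\<lambda>x. (1/c) * (c * F x)) \<le> (1/c) * q (\<lambda>x. c * F x)"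
    using assms by (intro subhom scale_mem) auto
  then show "c * q F \<le> q (\<lambda>x. c * F x)"
    using assms by (simp add: field_simps)
qed

lemma at_zero: "q (\<lambda>_. 0) = 0"
  using pos_hom[OF zero_mem, of 2] by simp

lemma nonneg_hom: "F \<in> L \<Longrightarrow> 0 \<le> c \<Longrightarrow> q (\<lambda>x. c * F x) = c * q F"
  using pos_hom[of F c] at_zero by (cases "c = 0") auto

lemma lower: "F \<in> L \<Longrightarrow> - q (\<lambda>x. - F x) \<le> q F"
  using subadd[of F "\<lambda>x. - F x"] uminus_mem[of F] at_zero by simp

text \<open>The largest sublinear functional below \<open>q\<close> that is at most \<open>- q G\<close> at \<open>- G\<close>; the linear
  functionals below it are those below \<open>q\<close> that agree with \<open>q\<close> at \<open>G\<close>.\<close>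

definition press :: "('b \<Rightarrow> real) \<Rightarrow> ('b \<Rightarrow> real) \<Rightarrow> real" where
  "press G F = (INF s\<in>{0..}. q (\<lambda>x. F x + s * G x) - s * q G)"

text \<open>Keeps the infimum in \<open>press\<close> finite, uniformly in s: write s G as (F + s G)
  - F and use subadditivity.\<close>

lemma press_bound:
  assumes "F \<in> L" "G \<in> L" "0 \<le> s"
  shows "- q (\<lambda>x. - F x) \<le> q (\<lambda>x. F x + s * G x) - s * q G"
proof -
  have "q (\<lambda>x. (F x + s * G x) + - F x) \<le> q (\<lambda>x. F x + s * G x) + q (\<lambda>x. - F x)"
    by (intro subadd add_scale_mem uminus_mem assms)
  then show ?thesis using nonneg_hom[OF assms(2,3)] by simp
qed

lemma press_le:
  assumes "F \<in> L" "G \<in> L" "0 \<le> s"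
  shows "press G F \<le> q (\<lambda>x. F x + s * G x) - s * q G"
  unfolding press_def using assms
  by (intro cINF_lower bdd_belowI2[where m="- q (\<lambda>x. - F x)"] press_bound) auto

lemma press_greatest:
  assumes "\<And>s. 0 \<le> s \<Longrightarrow> z \<le> q (\<lambda>x. F x + s * G x) - s * q G"
  shows "z \<le> press G F"
  unfolding press_def using assms by (intro cINF_greatest) auto

lemma press_le_self: "F \<in> L \<Longrightarrow> G \<in> L \<Longrightarrow> press G F \<le> q F"
  using press_le[of F G 0] by simp

lemma press_uminus: "G \<in> L \<Longrightarrow> press G (\<lambda>x. - G x) \<le> - q G"
  using press_le[of "\<lambda>x. - G x" G 1] at_zero uminus_mem by simp

text \<open>Parameters s and s' of two summands combine to s + s', and scaling by c turns s into c
  s, so the infimum over all s \<ge> 0 inherits both inequalities from q.\<close>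

lemma sublinear_press:
  assumes G: "G \<in> L" shows "sublinear_on L (press G)"
  unfolding sublinear_on_def
proof (intro conjI ballI allI impI)
  fix F F' assume F: "F \<in> L" "F' \<in> L"
  have *: "press G (\<lambda>x. F x + F' x) \<le> (q (\<lambda>x. F x + s * G x) - s * q G)
      + (q (\<lambda>x. F' x + s' * G x) - s' * q G)" if "0 \<le> s" "0 \<le> s'" for s s'
  proof -
    have "press G (\<lambda>x. F x + F' x) \<le> q (\<lambda>x. (F x + F' x) + (s + s') * G x) - (s + s') * q G"
      using that F G by (intro press_le add_mem) auto
    moreover have "q (\<lambda>x. (F x + F' x) + (s + s') * G x)
        = q (\<lambda>x. (F x + s * G x) + (F' x + s' * G x))"
      by (simp add: algebra_simps)
    moreover have "\<dots> \<le> q (\<lambda>x. F x + s * G x) + q (\<lambda>x. F' x + s' * G x)"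
      by (intro subadd add_scale_mem F G)
    ultimately show ?thesis by (simp add: algebra_simps)
  qed
  have "press G (\<lambda>x. F x + F' x) - (q (\<lambda>x. F x + s * G x) - s * q G) \<le> press G F'"
    if "0 \<le> s" for s
    using *[OF that] by (intro press_greatest) (simp add: algebra_simps)
  then have "press G (\<lambda>x. F x + F' x) - press G F' \<le> press G F"
    by (intro press_greatest) (simp add: algebra_simps)
  then show "press G (\<lambda>x. F x + F' x) \<le> press G F + press G F'" by simp
next
  fix F and c :: real assume F: "F \<in> L" and c: "0 < c"
  have "press G (\<lambda>x. c * F x) / c \<le> press G F"
  proof (rule press_greatest)
    fix s :: real assume s: "0 \<le> s"
    have "press G (\<lambda>x. c * F x) \<le> q (\<lambda>x. c * F x + (c * s) * G x) - (c * s) * q G"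
      using s c F G by (intro press_le scale_mem) auto
    also have "q (\<lambda>x. c * F x + (c * s) * G x) = q (\<lambda>x. c * (F x + s * G x))"
      by (simp add: algebra_simps)
    also have "\<dots> = c * q (\<lambda>x. F x + s * G x)"
      by (intro pos_hom add_scale_mem F G c)
    finally show "press G (\<lambda>x. c * F x) / c \<le> q (\<lambda>x. F x + s * G x) - s * q G"
      using c by (simp add: field_simps)
  qed
  then show "press G (\<lambda>x. c * F x) \<le> c * press G F"
    using c by (simp add: field_simps)
qed

text \<open>The maximisers of evaluation at G form a face. A combination below
  \<open>press G\<close> has value at least q G at G, while both functionals are at most q G there;
  as the weights are positive, both attain q G, and their bound by q at F + s G is then the bound by
  \<open>press G\<close> at F.\<close>

lemma facial_press:
  assumes G: "G \<in> L" and q: "facial L p q"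
  shows "facial L p (press G)"
  unfolding facial_def
proof (intro allI impI)
  fix \<Lambda>1 \<Lambda>2 and a :: real
  assume lin: "linear_on_space L \<Lambda>1" "linear_on_space L \<Lambda>2"
    and le: "\<forall>F\<in>L. \<Lambda>1 F \<le> p F" "\<forall>F\<in>L. \<Lambda>2 F \<le> p F" and a: "0 < a" "a < 1"
    and comb: "\<forall>F\<in>L. a * \<Lambda>1 F + (1 - a) * \<Lambda>2 F \<le> press G F"
  have "\<forall>F\<in>L. a * \<Lambda>1 F + (1 - a) * \<Lambda>2 F \<le> q F"
    using comb press_le_self[OF _ G] by force
  then have q12: "\<Lambda>1 F \<le> q F" "\<Lambda>2 F \<le> q F" if "F \<in> L" for F
    using q lin le a that unfolding facial_def by blast+
  have neg: "\<Lambda> (\<lambda>x. - G x) = - \<Lambda> G" if "linear_on_space L \<Lambda>" for \<Lambda>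
  proof -
    have "\<Lambda> (\<lambda>x. (-1) * G x) = (-1) * \<Lambda> G"
      using that G unfolding linear_on_space_def by blast
    then show ?thesis by simp
  qed
  have "a * \<Lambda>1 (\<lambda>x. - G x) + (1 - a) * \<Lambda>2 (\<lambda>x. - G x) \<le> - q G"
    using comb uminus_mem[OF G] press_uminus[OF G] by force
  then have sum: "q G \<le> a * \<Lambda>1 G + (1 - a) * \<Lambda>2 G"
    using neg[OF lin(1)] neg[OF lin(2)] by (simp add: algebra_simps)
  have "a * (q G - \<Lambda>1 G) \<ge> 0" "(1 - a) * (q G - \<Lambda>2 G) \<ge> 0"
    using a q12 G by simp_all
  moreover have "a * (q G - \<Lambda>1 G) + (1 - a) * (q G - \<Lambda>2 G) \<le> 0"
    using sum by (simp add: algebra_simps)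
  ultimately have "a * (q G - \<Lambda>1 G) = 0" "(1 - a) * (q G - \<Lambda>2 G) = 0"
    by linarith+
  then have eq: "\<Lambda>1 G = q G" "\<Lambda>2 G = q G" using a by auto
  have "\<Lambda> F \<le> press G F" if l: "linear_on_space L \<Lambda>" and "\<Lambda> G = q G"
    and b: "\<forall>F\<in>L. \<Lambda> F \<le> q F" and F: "F \<in> L" for \<Lambda> F
  proof (rule press_greatest)
    fix s :: real
    have "\<Lambda> (\<lambda>x. F x + s * G x) = \<Lambda> F + s * \<Lambda> G"
      using l F G scale_mem[OF G] unfolding linear_on_space_def by simp
    then show "\<Lambda> F \<le> q (\<lambda>x. F x + s * G x) - s * q G"
      using bspec[OF b add_scale_mem[OF F G, of s]] that(2) by simp
  qed
  then show "\<forall>F\<in>L. \<Lambda>1 F \<le> press G F \<and> \<Lambda>2 F \<le> press G F"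
    using lin eq q12 by blast
qed

text \<open>A minimal element m of the family A cannot be lowered by pressing it along any H, which
  forces m (- H) = - m H and hence linearity. Staying below \<open>press G\<close> fixes the value
  at G.\<close>

theorem ex_extreme_dominated_functional:
  assumes G: "G \<in> L"
  obtains \<Lambda> where "linear_on_space L \<Lambda>" "\<And>F. F \<in> L \<Longrightarrow> \<Lambda> F \<le> q F" "\<Lambda> G = q G" "facial L q \<Lambda>"
proof -
  \<comment> \<open>Values off L are pinned to 0 because the order \<open>le\<close> compares
    functionals at all functions, while only the values on L are under control.\<close>
  define A where "A = {r. (\<forall>F. F \<notin> L \<longrightarrow> r F = 0) \<and> sublinear_on L r \<and>
    (\<forall>F\<in>L. r F \<le> press G F) \<and> facial L q r}"
  \<comment> \<open>The order is reversed: maximal elements in Zorn's lemma are pointwise minimal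
    functionals.\<close>
  define le where "le r r' \<longleftrightarrow> (\<forall>F. r' F \<le> r F)" for r r' :: "('b \<Rightarrow> real) \<Rightarrow> real"
  define ext where "ext r F = (if F \<in> L then r F else 0)" for r :: "('b \<Rightarrow> real) \<Rightarrow> real" and F
  have ext_sub: "sublinear_on L (ext r)" if "sublinear_on L r" for r
    using that unfolding sublinear_on_def ext_def by (auto simp: add_mem scale_mem)
  have ext_fac: "facial L q (ext r)" if "facial L q r" for r
    using that unfolding facial_def ext_def by simp
  have "facial L q q" unfolding facial_def by blast
  then have start: "ext (press G) \<in> A"
    unfolding A_def using ext_sub[OF sublinear_press[OF G]] ext_fac[OF facial_press[OF G]]
    by (auto simp: ext_def)
  have po: "partial_order_on A (relation_of le A)"
    by (rule partial_order_on_relation_ofI) (auto simp: le_def fun_eq_iff intro: order_trans antisym)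
  have bound: "- press G (\<lambda>x. - F x) \<le> r F" if "r \<in> A" "F \<in> L" for r F
  proof -
    interpret r: sublinear_functional L r using that by unfold_locales (auto simp: A_def)
    have "r (\<lambda>x. - F x) \<le> press G (\<lambda>x. - F x)"
      using that uminus_mem unfolding A_def by auto
    with r.lower[OF that(2)] show ?thesis by linarith
  qed
  have ch: "\<exists>u\<in>A. \<forall>r\<in>C. le r u" if C: "C \<in> Chains (relation_of le A)" for C
  proof (cases "C = {}")
    case True then show ?thesis using start by auto
  next
    case False
    have CA: "C \<subseteq> A" and tot: "\<And>r r'. r \<in> C \<Longrightarrow> r' \<in> C \<Longrightarrow> le r r' \<or> le r' r"
      using C by (auto simp: Chains_def relation_of_def)
    define u where "u F = (INF r\<in>C. r F)" for F
    have u_le: "u F \<le> r F" if "r \<in> C" "F \<in> L" for r F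
      unfolding u_def using that CA
      by (intro cINF_lower bdd_belowI2[where m="- press G (\<lambda>x. - F x)"] bound) auto
    have u_ge: "z \<le> u F" if "\<And>r. r \<in> C \<Longrightarrow> z \<le> r F" for z F
      unfolding u_def using that False by (intro cINF_greatest) auto
    have sub: "sublinear_on L u"
      unfolding sublinear_on_def
    proof (intro conjI ballI allI impI)
      fix F F' assume F: "F \<in> L" "F' \<in> L"
      \<comment> \<open>Totality of the chain enters here: the smaller of r and r' bounds both
        terms, and its own subadditivity applies.\<close>
      have *: "u (\<lambda>x. F x + F' x) \<le> r F + r' F'" if rr: "r \<in> C" "r' \<in> C" for r r'
      proof -
        obtain t where t: "t \<in> C" "t F \<le> r F" "t F' \<le> r' F'"
          using tot[OF rr] rr unfolding le_def by blast
        have "u (\<lambda>x. F x + F' x) \<le> t (\<lambda>x. F x + F' x)" by (intro u_le t add_mem F)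
        also have "\<dots> \<le> t F + t F'"
          using t(1) CA F unfolding A_def sublinear_on_def by auto
        finally show ?thesis using t by simp
      qed
      have "u (\<lambda>x. F x + F' x) - r F \<le> u F'" if "r \<in> C" for r
        using *[OF that] by (intro u_ge) (simp add: algebra_simps)
      then have "u (\<lambda>x. F x + F' x) - u F' \<le> u F"
        by (intro u_ge) (simp add: algebra_simps)
      then show "u (\<lambda>x. F x + F' x) \<le> u F + u F'" by simp
    next
      fix F and c :: real assume F: "F \<in> L" and c: "0 < c"
      have "u (\<lambda>x. c * F x) / c \<le> u F"
      proof (rule u_ge)
        fix r assume r: "r \<in> C"
        have "u (\<lambda>x. c * F x) \<le> r (\<lambda>x. c * F x)" by (intro u_le r scale_mem F)
        also have "\<dots> \<le> c * r F" using r CA F c unfolding A_def sublinear_on_def by auto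
        finally show "u (\<lambda>x. c * F x) / c \<le> r F" using c by (simp add: field_simps)
      qed
      then show "u (\<lambda>x. c * F x) \<le> c * u F" using c by (simp add: field_simps)
    qed
    have fac: "facial L q u"
      unfolding facial_def
    proof (intro allI impI)
      fix \<Lambda>1 \<Lambda>2 and a :: real
      assume h: "linear_on_space L \<Lambda>1" "linear_on_space L \<Lambda>2"
        "\<forall>F\<in>L. \<Lambda>1 F \<le> q F" "\<forall>F\<in>L. \<Lambda>2 F \<le> q F" "0 < a" "a < 1"
        "\<forall>F\<in>L. a * \<Lambda>1 F + (1 - a) * \<Lambda>2 F \<le> u F"
      have "\<Lambda>1 F \<le> r F \<and> \<Lambda>2 F \<le> r F" if r: "r \<in> C" and F: "F \<in> L" for r F
      proof -
        have "facial L q r" using r CA by (auto simp: A_def)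
        moreover have "\<forall>F\<in>L. a * \<Lambda>1 F + (1 - a) * \<Lambda>2 F \<le> r F"
          using h(7) u_le[OF r] by force
        ultimately show ?thesis using h F unfolding facial_def by blast
      qed
      then show "\<forall>F\<in>L. \<Lambda>1 F \<le> u F \<and> \<Lambda>2 F \<le> u F" using u_ge by blast
    qed
    obtain r0 where r0: "r0 \<in> C" using False by auto
    have "u F \<le> press G F" if "F \<in> L" for F
      using u_le[OF r0 that] r0 CA that unfolding A_def by force
    then have "ext u \<in> A" unfolding A_def using ext_sub[OF sub] ext_fac[OF fac] by (auto simp: ext_def)
    moreover have "le r (ext u)" if "r \<in> C" for r
      using u_le[OF that] that CA unfolding le_def ext_def A_def by auto
    ultimately show ?thesis by blast
  qed
  obtain m where mA: "m \<in> A" and min: "\<And>r. r \<in> A \<Longrightarrow> le m r \<Longrightarrow> r = m"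
    using predicate_Zorn[OF po ch] by blast
  interpret m: sublinear_functional L m using mA by unfold_locales (auto simp: A_def)
  have m_le: "m F \<le> press G F" if "F \<in> L" for F using mA that by (auto simp: A_def)
  have neg: "m (\<lambda>x. - H x) = - m H" if H: "H \<in> L" for H
  proof (rule antisym)
    have "ext (m.press H) \<in> A"
      using ext_sub[OF m.sublinear_press[OF H]] ext_fac[OF m.facial_press[OF H]] mA
        m.press_le_self[OF _ H] m_le unfolding A_def by (force simp: ext_def)
    moreover have "le m (ext (m.press H))"
      using m.press_le_self[OF _ H] mA unfolding le_def ext_def A_def by auto
    ultimately have "ext (m.press H) = m" by (rule min)
    then have "m (\<lambda>x. - H x) = m.press H (\<lambda>x. - H x)"
      using uminus_mem[OF H] unfolding ext_def by (auto simp: fun_eq_iff split: if_splits)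
    then show "m (\<lambda>x. - H x) \<le> - m H" using m.press_uminus[OF H] by simp
    show "- m H \<le> m (\<lambda>x. - H x)" using m.lower[OF H] by simp
  qed
  have lin: "linear_on_space L m"
    unfolding linear_on_space_def
  proof (intro conjI ballI allI)
    fix F H assume FH: "F \<in> L" "H \<in> L"
    have "m (\<lambda>x. (F x + H x) + - H x) \<le> m (\<lambda>x. F x + H x) + m (\<lambda>x. - H x)"
      by (intro m.subadd add_mem uminus_mem FH)
    then show "m (\<lambda>x. F x + H x) = m F + m H"
      using m.subadd[OF FH] neg[OF FH(2)] by simp
  next
    fix F and c :: real assume F: "F \<in> L"
    show "m (\<lambda>x. c * F x) = c * m F"
    proof (cases "0 \<le> c")
      case True then show ?thesis using m.nonneg_hom[OF F] by simp
    next
      case False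
      then show ?thesis
        using neg[OF scale_mem[OF F, of "-c"]] m.nonneg_hom[OF F, of "-c"] by simp
    qed
  qed
  have mq: "m F \<le> q F" if "F \<in> L" for F
    using m_le[OF that] press_le_self[OF that G] by simp
  have "m (\<lambda>x. - G x) \<le> - q G" using m_le[OF uminus_mem[OF G]] press_uminus[OF G] by simp
  then have "m G = q G" using mq[OF G] neg[OF G] by simp
  then show ?thesis using that lin mq mA by (auto simp: A_def)
qed

end

section \<open>Daniell-Stone representation\<close>

locale daniell_functional = function_space L for L :: "('b \<Rightarrow> real) set" +
  fixes S :: "'b set" and \<Lambda> :: "('b \<Rightarrow> real) \<Rightarrow> real"
  assumes one_mem: "(\<lambda>_. 1) \<in> L"
    and max_mem: "F \<in> L \<Longrightarrow> G \<in> L \<Longrightarrow> (\<lambda>x. max (F x) (G x)) \<in> L"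
    and bounded_mem: "F \<in> L \<Longrightarrow> \<exists>B. \<forall>x\<in>S. \<bar>F x\<bar> \<le> B"
    and linear: "linear_on_space L \<Lambda>"
    and nonneg: "F \<in> L \<Longrightarrow> (\<And>x. x \<in> S \<Longrightarrow> 0 \<le> F x) \<Longrightarrow> 0 \<le> \<Lambda> F"
    and normalized: "\<Lambda> (\<lambda>_. 1) = 1"
    and downward_continuous: "(\<And>n. Fs n \<in> L) \<Longrightarrow> (\<And>n x. x \<in> S \<Longrightarrow> Fs (Suc n) x \<le> Fs n x)
      \<Longrightarrow> (\<And>x. x \<in> S \<Longrightarrow> (\<lambda>n. Fs n x) \<longlonglongrightarrow> 0) \<Longrightarrow> (\<lambda>n. \<Lambda> (Fs n)) \<longlonglongrightarrow> 0"
begin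

lemma min_mem: "F \<in> L \<Longrightarrow> G \<in> L \<Longrightarrow> (\<lambda>x. min (F x) (G x)) \<in> L"
  using uminus_mem[OF max_mem[OF uminus_mem uminus_mem, of F G]]
  by (simp add: minus_max_eq_min)

lemma const_mem: "(\<lambda>_. c) \<in> L"
  using scale_mem[OF one_mem, of c] by simp

lemma sum_mem: "(\<And>i. i \<in> I \<Longrightarrow> Fs i \<in> L) \<Longrightarrow> (\<lambda>x. \<Sum>i\<in>I. Fs i x) \<in> L"
  by (induction I rule: infinite_finite_induct) (auto simp: zero_mem add_mem)

lemma \<Lambda>_add: "F \<in> L \<Longrightarrow> G \<in> L \<Longrightarrow> \<Lambda> (\<lambda>x. F x + G x) = \<Lambda> F + \<Lambda> G"
  and \<Lambda>_scale: "F \<in> L \<Longrightarrow> \<Lambda> (\<lambda>x. c * F x) = c * \<Lambda> F"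
  using linear by (auto simp: linear_on_space_def)

lemma \<Lambda>_diff: "F \<in> L \<Longrightarrow> G \<in> L \<Longrightarrow> \<Lambda> (\<lambda>x. F x - G x) = \<Lambda> F - \<Lambda> G"
  using \<Lambda>_add[of F "\<lambda>x. (-1) * G x"] \<Lambda>_scale[of G "-1"] scale_mem[of G "-1"] by simp

lemma \<Lambda>_const: "\<Lambda> (\<lambda>_. c) = c"
  using \<Lambda>_scale[OF one_mem, of c] normalized by simp

lemma \<Lambda>_sum: "(\<And>i. i \<in> I \<Longrightarrow> Fs i \<in> L) \<Longrightarrow> \<Lambda> (\<lambda>x. \<Sum>i\<in>I. Fs i x) = (\<Sum>i\<in>I. \<Lambda> (Fs i))"
  by (induction I rule: infinite_finite_induct) (auto simp: \<Lambda>_const \<Lambda>_add sum_mem)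

lemma \<Lambda>_mono: "F \<in> L \<Longrightarrow> G \<in> L \<Longrightarrow> (\<And>x. x \<in> S \<Longrightarrow> F x \<le> G x) \<Longrightarrow> \<Lambda> F \<le> \<Lambda> G"
  using nonneg[of "\<lambda>x. G x - F x"] \<Lambda>_diff[of G F] diff_mem[of G F] by simp

lemma \<Lambda>_cong: "F \<in> L \<Longrightarrow> G \<in> L \<Longrightarrow> (\<And>x. x \<in> S \<Longrightarrow> F x = G x) \<Longrightarrow> \<Lambda> F = \<Lambda> G"
  by (intro antisym \<Lambda>_mono) auto

text \<open>Following Kindler, the functional is extended to a measure on the product with the real line in which
  the region between the graphs of \<open>F \<le> G\<close> has measure \<open>\<Lambda> (G - F)\<close>. Such regions form a semiring,
  so the Caratheodory extension applies.\<close>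

definition strip :: "('b \<Rightarrow> real) \<Rightarrow> ('b \<Rightarrow> real) \<Rightarrow> ('b \<times> real) set" where
  "strip F G = {(x, t). x \<in> S \<and> F x \<le> t \<and> t < G x}"

definition ordered_pair :: "('b \<Rightarrow> real) \<Rightarrow> ('b \<Rightarrow> real) \<Rightarrow> bool" where
  "ordered_pair F G \<longleftrightarrow> F \<in> L \<and> G \<in> L \<and> (\<forall>x\<in>S. F x \<le> G x)"

definition graph_measure :: "('b \<times> real) measure" where
  "graph_measure = extend_measure (S \<times> UNIV) {(F, G). ordered_pair F G} (\<lambda>(F, G). strip F G)
     (\<lambda>(F, G). ennreal (\<Lambda> (\<lambda>x. G x - F x)))"

lemma semiring_strips: "semiring_of_sets (S \<times> UNIV) {strip F G | F G. ordered_pair F G}"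
proof
  show "{strip F G |F G. ordered_pair F G} \<subseteq> Pow (S \<times> UNIV)" by (auto simp: strip_def)
  have "strip (\<lambda>_. 0) (\<lambda>_. 0) = {}" by (auto simp: strip_def)
  moreover have "ordered_pair (\<lambda>_. 0) (\<lambda>_. 0)" by (simp add: ordered_pair_def zero_mem)
  ultimately show "{} \<in> {strip F G |F G. ordered_pair F G}" by force
next
  fix a b assume "a \<in> {strip F G |F G. ordered_pair F G}" "b \<in> {strip F G |F G. ordered_pair F G}"
  then obtain F G F' G' where a: "a = strip F G" "ordered_pair F G"
    and b: "b = strip F' G'" "ordered_pair F' G'" by blast
  note L = a(2)[unfolded ordered_pair_def] b(2)[unfolded ordered_pair_def]
  \<comment> \<open>The upper function is raised to at least \<open>?l\<close>, so that the pair
    remains ordered where the two strips do not meet.\<close>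
  let ?l = "\<lambda>x. max (F x) (F' x)" and ?u = "\<lambda>x. max (max (F x) (F' x)) (min (G x) (G' x))"
  have "a \<inter> b = strip ?l ?u" unfolding a b strip_def by auto
  moreover have "ordered_pair ?l ?u"
    using L by (auto simp: ordered_pair_def intro!: max_mem min_mem)
  ultimately show "a \<inter> b \<in> {strip F G |F G. ordered_pair F G}" by blast
  \<comment> \<open>The parts of a below and above b; clipping at F and G keeps both pairs ordered
    even where b lies outside a.\<close>
  let ?m = "\<lambda>x. max (F x) (min (G x) (F' x))" and ?n = "\<lambda>x. min (G x) (max (F x) (G' x))"
  have "ordered_pair F ?m" "ordered_pair ?n G"
    using L by (auto simp: ordered_pair_def intro!: max_mem min_mem)
  then have "{strip F ?m, strip ?n G} \<subseteq> {strip F G |F G. ordered_pair F G}" by blast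
  moreover have "strip F ?m \<inter> strip ?n G = {}" using L by (fastforce simp: strip_def)
  then have "disjoint {strip F ?m, strip ?n G}" by (auto simp: disjoint_def)
  moreover have "a - b = \<Union>{strip F ?m, strip ?n G}"
    unfolding a b strip_def using L by fastforce
  ultimately show "\<exists>C\<subseteq>{strip F G |F G. ordered_pair F G}. finite C \<and> disjoint C \<and> a - b = \<Union> C"
    by (intro exI[of _ "{strip F ?m, strip ?n G}"]) simp
qed

text \<open>An empty section forgets its end points, so a strip does not determine F and G. The
  height survives, and it is what makes the premeasure well defined.\<close>

lemma strip_eqD:
  assumes "strip F G = strip F' G'" "ordered_pair F G" "ordered_pair F' G'" "x \<in> S"
  shows "G x - F x = G' x - F' x"
proof -
  have "{F x..<G x} = {F' x..<G' x}"
    using arg_cong[OF assms(1), of "\<lambda>A. {t. (x, t) \<in> A}"] assms(4) by (auto simp: strip_def set_eq_iff)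
  then show ?thesis using assms(2-4) by (auto simp: ordered_pair_def atLeastLessThan_eq_iff)
      (metis atLeastLessThan_empty_iff2 atLeastLessThan_eq_iff diff_self leD le_less order_less_irrefl)
qed

text \<open>Over a fixed x the strips are half-open intervals, so countable additivity of
  \<open>lborel\<close> adds up their lengths.\<close>

lemma strip_sums:
  assumes ord: "\<And>n. ordered_pair (Fs n) (Gs n)" "ordered_pair F G"
    and disj: "disjoint_family (\<lambda>n. strip (Fs n) (Gs n))"
    and un: "(\<Union>n. strip (Fs n) (Gs n)) = strip F G" and x: "x \<in> S"
  shows "(\<lambda>n. Gs n x - Fs n x) sums (G x - F x)"
proof -
  have sec: "{t. (x, t) \<in> strip F G} = {F x..<G x}" for F G using x by (auto simp: strip_def)
  have le: "Fs n x \<le> Gs n x" "F x \<le> G x" for n using ord x by (auto simp: ordered_pair_def)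
  have "disjoint_family (\<lambda>n. {Fs n x..<Gs n x})"
    using disj unfolding disjoint_family_on_def sec[symmetric] by blast
  moreover have "(\<Union>n. {Fs n x..<Gs n x}) = {F x..<G x}"
    using un unfolding sec[symmetric] by blast
  ultimately have "(\<Sum>n. emeasure lborel {Fs n x..<Gs n x}) = emeasure lborel {F x..<G x}"
    using suminf_emeasure[of "\<lambda>n. {Fs n x..<Gs n x}" lborel] by (simp add: image_subset_iff)
  then have "(\<Sum>n. ennreal (Gs n x - Fs n x)) = ennreal (G x - F x)"
    using le by simp
  then have "(\<lambda>n. ennreal (Gs n x - Fs n x)) sums ennreal (G x - F x)"
    by (metis summableI summable_sums)
  then show ?thesis using le by (subst (asm) sums_ennreal) auto
qed

text \<open>For countable additivity, subtract the first n heights from G - F: by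
  \<open>strip_sums\<close> the remainders decrease to 0 on S, and
  \<open>downward_continuous\<close> carries this over to \<Lambda>.\<close>

lemma emeasure_strip:
  assumes FG: "ordered_pair F G"
  shows "emeasure graph_measure (strip F G) = ennreal (\<Lambda> (\<lambda>x. G x - F x))"
proof (rule extend_measure_caratheodory_pair[OF graph_measure_def FG semiring_strips])
  fix F G assume "ordered_pair F G" "strip F G = {}"
  then have "\<Lambda> (\<lambda>x. G x - F x) \<le> \<Lambda> (\<lambda>_. 0)"
    by (intro \<Lambda>_mono diff_mem zero_mem) (force simp: ordered_pair_def strip_def)+
  then show "ennreal (\<Lambda> (\<lambda>x. G x - F x)) = 0" by (simp add: \<Lambda>_const ennreal_neg)
next
  fix F G F' G' assume h: "ordered_pair F G" "ordered_pair F' G'" "strip F G = strip F' G'"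
  then have "\<Lambda> (\<lambda>x. G x - F x) = \<Lambda> (\<lambda>x. G' x - F' x)"
    by (intro \<Lambda>_cong diff_mem strip_eqD) (auto simp: ordered_pair_def)
  then show "ennreal (\<Lambda> (\<lambda>x. G x - F x)) = ennreal (\<Lambda> (\<lambda>x. G' x - F' x))" by simp
next
  fix Fs Gs :: "nat \<Rightarrow> 'b \<Rightarrow> real" and F G
  assume ord: "\<And>n. ordered_pair (Fs n) (Gs n)" "ordered_pair F G"
    and disj: "disjoint_family (\<lambda>n. strip (Fs n) (Gs n))"
    and un: "(\<Union>n. strip (Fs n) (Gs n)) = strip F G"
  note sums = strip_sums[OF ord disj un]
  define D where "D n x = Gs n x - Fs n x" for n x
  have DL: "D n \<in> L" for n unfolding D_def using ord by (auto simp: ordered_pair_def intro: diff_mem)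
  have GF: "(\<lambda>x. G x - F x) \<in> L" using ord by (auto simp: ordered_pair_def intro: diff_mem)
  have D0: "0 \<le> D n x" if "x \<in> S" for n x using ord that by (auto simp: ordered_pair_def D_def)
  have "(\<lambda>n. \<Lambda> (\<lambda>x. (G x - F x) - (\<Sum>i<n. D i x))) \<longlonglongrightarrow> 0"
  proof (rule downward_continuous)
    show "(\<lambda>x. (G x - F x) - (\<Sum>i<n. D i x)) \<in> L" for n
      by (intro diff_mem[OF GF] sum_mem DL)
    show "(G x - F x) - (\<Sum>i<Suc n. D i x) \<le> (G x - F x) - (\<Sum>i<n. D i x)" if "x \<in> S" for n x
      using D0[OF that] by simp
    fix x assume "x \<in> S"
    then have "(\<lambda>n. \<Sum>i<n. D i x) \<longlonglongrightarrow> G x - F x" using sums by (simp add: sums_def D_def)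
    from tendsto_diff[OF tendsto_const[of "G x - F x"] this]
    show "(\<lambda>n. (G x - F x) - (\<Sum>i<n. D i x)) \<longlonglongrightarrow> 0" by simp
  qed
  moreover have "\<Lambda> (\<lambda>x. (G x - F x) - (\<Sum>i<n. D i x)) = \<Lambda> (\<lambda>x. G x - F x) - (\<Sum>i<n. \<Lambda> (D i))" for n
    using \<Lambda>_diff[OF GF sum_mem[of "{..<n}" D, OF DL]] \<Lambda>_sum[of "{..<n}" D, OF DL] by simp
  ultimately have "(\<lambda>n. \<Lambda> (\<lambda>x. G x - F x) - (\<Sum>i<n. \<Lambda> (D i))) \<longlonglongrightarrow> 0" by simp
  from tendsto_diff[OF tendsto_const[of "\<Lambda> (\<lambda>x. G x - F x)"] this]
  have "(\<lambda>i. \<Lambda> (D i)) sums \<Lambda> (\<lambda>x. G x - F x)" by (simp add: sums_def)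
  then show "(\<Sum>n. ennreal (\<Lambda> (\<lambda>x. Gs n x - Fs n x))) = ennreal (\<Lambda> (\<lambda>x. G x - F x))"
    using nonneg[OF DL D0] unfolding D_def by (intro suminf_ennreal_eq) auto
qed auto

section \<open>From the measure on strips to a probability measure on S\<close>

lemma space_graph_measure: "space graph_measure = S \<times> UNIV"
  unfolding graph_measure_def by (rule space_extend_measure) (auto simp: strip_def)

lemma strip_in_sets: "ordered_pair F G \<Longrightarrow> strip F G \<in> sets graph_measure"
  unfolding graph_measure_def
  by (subst sets_extend_measure) (fastforce simp: strip_def intro!: sigma_sets.Basic)+

lemma unit_strip: "S \<times> {0..<1} = strip (\<lambda>_. 0) (\<lambda>_. 1)" "ordered_pair (\<lambda>_. 0) (\<lambda>_. 1)"
  by (auto simp: strip_def ordered_pair_def const_mem)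

lemma unit_sets: "S \<times> {0..<1} \<in> sets graph_measure" "S \<times> {0..<1} \<inter> space graph_measure \<in> sets graph_measure"
  using strip_in_sets[OF unit_strip(2)] by (simp_all add: unit_strip(1))

text \<open>The mass of A is that of A x [0,1). For continuous functions on \<open>Sd\<close> the
  generating positivity sets are exactly the open sets, see
  \<open>positive_sets_eq_open_sets\<close>.\<close>

definition base_measure :: "'b measure" where
  "base_measure = distr (restrict_space graph_measure (S \<times> {0..<1}))
     (sigma S {{x\<in>S. 0 < F x} | F. F \<in> L}) fst"

lemma space_base_measure: "space base_measure = S"
  unfolding base_measure_def by (simp add: space_measure_of_conv)

lemma sets_base_measure: "sets base_measure = sigma_sets S {{x\<in>S. 0 < F x} | F. F \<in> L}"
  unfolding base_measure_def by (simp add: sets_measure_of_conv) blast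

text \<open>The truncations min 1 (n max 0 F) increase to the indicator of {F > 0}, so the strips
  below them exhaust the product.\<close>

lemma positive_set_times_unit:
  assumes F: "F \<in> L"
  shows "{x\<in>S. 0 < F x} \<times> {0..<1} \<in> sets graph_measure"
proof -
  let ?G = "\<lambda>n x. min 1 (real n * max 0 (F x))"
  have "{x\<in>S. 0 < F x} \<times> {0..<1} = (\<Union>n. strip (\<lambda>_. 0) (?G n))"
  proof -
    have "\<exists>n. t < real n * max 0 (F x)" if "0 < F x" for x t
    proof -
      obtain n where "t / F x < real n" using reals_Archimedean2 by blast
      then have "t < real n * max 0 (F x)" using that by (simp add: field_simps)
      then show ?thesis by blast
    qed
    moreover have "0 < F x" if "0 \<le> t" "t < real n * max 0 (F x)" for x t n
      using that by (cases "0 < F x") auto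
    ultimately show ?thesis by (fastforce simp: strip_def)
  qed
  moreover have "ordered_pair (\<lambda>_. 0) (?G n)" for n
    using F by (auto simp: ordered_pair_def intro!: min_mem scale_mem max_mem const_mem)
  ultimately show ?thesis using strip_in_sets by auto
qed

lemma fst_measurable:
  "fst \<in> measurable (restrict_space graph_measure (S \<times> {0..<1})) (sigma S {{x\<in>S. 0 < F x} | F. F \<in> L})"
proof (rule measurable_measure_of)
  have [simp]: "space (restrict_space graph_measure (S \<times> {0..<1})) = S \<times> {0..<1}"
    by (auto simp: space_restrict_space space_graph_measure)
  show "fst \<in> space (restrict_space graph_measure (S \<times> {0..<1})) \<rightarrow> S" by auto
  fix A assume "A \<in> {{x\<in>S. 0 < F x} | F. F \<in> L}"
  then obtain F where F: "F \<in> L" "A = {x\<in>S. 0 < F x}" by blast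
  have "fst -` A \<inter> S \<times> {0..<1::real} = {x\<in>S. 0 < F x} \<times> {0..<1}" using F by auto
  then show "fst -` A \<inter> space (restrict_space graph_measure (S \<times> {0..<1}))
      \<in> sets (restrict_space graph_measure (S \<times> {0..<1}))"
    using positive_set_times_unit[OF F(1)] unit_sets(2)
    by (subst sets_restrict_space_iff) auto
qed auto

lemma
  assumes A: "A \<in> sets base_measure"
  shows times_unit_sets: "A \<times> {0..<1} \<in> sets graph_measure"
    and emeasure_base_measure: "emeasure base_measure A = emeasure graph_measure (A \<times> {0..<1})"
proof -
  let ?R = "restrict_space graph_measure (S \<times> {0..<1})"
  have A': "A \<in> sets (sigma S {{x\<in>S. 0 < F x} | F. F \<in> L})"
    using A by (simp add: base_measure_def)
  have "A \<subseteq> S" using sets.sets_into_space[OF A] by (simp add: space_base_measure)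
  then have eq: "fst -` A \<inter> space ?R = A \<times> {0..<1}"
    by (auto simp: space_restrict_space space_graph_measure)
  note U = unit_sets(2)
  have "A \<times> {0..<1} \<in> sets ?R" using measurable_sets[OF fst_measurable A'] eq by simp
  then show 1: "A \<times> {0..<1} \<in> sets graph_measure"
    using U by (simp add: sets_restrict_space_iff)
  show "emeasure base_measure A = emeasure graph_measure (A \<times> {0..<1})"
    unfolding base_measure_def emeasure_distr[OF fst_measurable A'] eq
    using U \<open>A \<subseteq> S\<close> by (subst emeasure_restrict_space) auto
qed

lemma prob_space_base_measure: "prob_space base_measure"
proof (rule prob_spaceI)
  show "emeasure base_measure (space base_measure) = 1"
    using emeasure_base_measure[OF sets.top] emeasure_strip[OF unit_strip(2)]
    by (simp add: space_base_measure unit_strip(1) \<Lambda>_const)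
qed

sublocale base: prob_space base_measure by (rule prob_space_base_measure)

lemma mem_measurable: assumes F: "F \<in> L" shows "F \<in> borel_measurable base_measure"
proof (rule borel_measurable_iff_greater[THEN iffD2], rule allI)
  fix a
  have "(\<lambda>x. F x - a) \<in> L" by (intro diff_mem F const_mem)
  then have "{x\<in>S. 0 < F x - a} \<in> sets base_measure"
    unfolding sets_base_measure
    by (intro sigma_sets.Basic CollectI exI[of _ "\<lambda>x. F x - a"] conjI refl)
  then show "{w \<in> space base_measure. a < F w} \<in> sets base_measure"
    by (simp add: space_base_measure)
qed

lemma mem_integrable: assumes F: "F \<in> L" shows "integrable base_measure F"
proof -
  obtain B where "\<forall>x\<in>S. \<bar>F x\<bar> \<le> B" using bounded_mem[OF F] by blast
  then show ?thesis
    using mem_measurable[OF F] by (intro base.integrable_const_bound[of _ B] AE_I2) (auto simp: space_base_measure)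
qed

text \<open>Where F \<ge> 1, the half-open interval [0,1) lies in the section of the strip below F.
  Together with \<open>\<Lambda>_le_measure\<close> this compares \<Lambda> with the measure before
  any integral is known.\<close>

lemma measure_le_\<Lambda>:
  assumes F: "F \<in> L" "\<And>x. x \<in> S \<Longrightarrow> 0 \<le> F x" and A: "A \<in> sets base_measure"
    and AF: "\<And>x. x \<in> A \<Longrightarrow> 1 \<le> F x"
  shows "measure base_measure A \<le> \<Lambda> F"
proof -
  have ord: "ordered_pair (\<lambda>_. 0) F" using F by (simp add: ordered_pair_def zero_mem)
  have "A \<subseteq> S" using sets.sets_into_space[OF A] by (simp add: space_base_measure)
  then have "A \<times> {0..<1} \<subseteq> strip (\<lambda>_. 0) F"
    using AF by (force simp: strip_def)
  then have "emeasure base_measure A \<le> ennreal (\<Lambda> F)"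
    using emeasure_mono[OF _ strip_in_sets[OF ord]] emeasure_strip[OF ord] emeasure_base_measure[OF A]
    by simp
  then show ?thesis
    using nonneg[OF F] by (simp add: base.emeasure_eq_measure)
qed

lemma \<Lambda>_le_measure:
  assumes F: "F \<in> L" "\<And>x. x \<in> S \<Longrightarrow> 0 \<le> F x" and A: "A \<in> sets base_measure"
    and FA: "\<And>x. x \<in> S \<Longrightarrow> F x \<le> indicator A x"
  shows "\<Lambda> F \<le> measure base_measure A"
proof -
  have ord: "ordered_pair (\<lambda>_. 0) F" using F by (simp add: ordered_pair_def zero_mem)
  have "strip (\<lambda>_. 0) F \<subseteq> A \<times> {0..<1}"
    unfolding strip_def
  proof (clarsimp)
    fix x t assume "x \<in> S" "0 \<le> t" "t < F x"
    with FA[of x] show "x \<in> A \<and> t < 1" by (cases "x \<in> A") auto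
  qed
  then have "ennreal (\<Lambda> F) \<le> emeasure base_measure A"
    using emeasure_mono[OF \<open>strip (\<lambda>_. 0) F \<subseteq> _\<close> times_unit_sets[OF A]]
      emeasure_strip[OF ord] emeasure_base_measure[OF A]
    by simp
  then show ?thesis
    by (simp add: base.emeasure_eq_measure)
qed

text \<open>Cuts y into unit layers; the layer with index i lies between the indicators of y \<ge> i
  + 1 and y \<ge> i.\<close>

lemma sum_clipped: "0 \<le> (y::real) \<Longrightarrow> (\<Sum>i<n. min 1 (max 0 (y - real i))) = min y (real n)"
  by (induction n) auto

text \<open>Cut n F into n unit layers. The integral and \<Lambda> of each layer lie between the
  measures of two consecutive level sets, and these bounds telescope, so n times the discrepancy is
  at most 1 for every n.\<close>

lemma integral_eq_\<Lambda>_unit: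
  assumes F: "F \<in> L" "\<And>x. x \<in> S \<Longrightarrow> 0 \<le> F x \<and> F x \<le> 1"
  shows "(\<integral>x. F x \<partial>base_measure) = \<Lambda> F"
proof -
  have bound: "real n * \<bar>(\<integral>x. F x \<partial>base_measure) - \<Lambda> F\<bar> \<le> 1" for n
  proof -
    define \<phi> where "\<phi> i x = min 1 (max 0 (real n * F x - real i))" for i x
    define A where "A i = {x\<in>S. real i \<le> real n * F x}" for i
    have \<phi>L: "\<phi> i \<in> L" for i
      unfolding \<phi>_def by (intro min_mem max_mem diff_mem scale_mem const_mem F)
    have A: "A i \<in> sets base_measure" for i
    proof -
      have "{x \<in> space base_measure. real i \<le> real n * F x} \<in> sets base_measure"
        using mem_measurable[OF F(1)] by measurable
      then show ?thesis by (simp add: A_def space_base_measure)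
    qed
    have sum: "(\<Sum>i<n. \<phi> i x) = real n * F x" if "x \<in> S" for x
      using sum_clipped[of "real n * F x" n] F(2)[OF that] unfolding \<phi>_def
      by (simp add: mult_left_le)
    have ge: "measure base_measure (A (Suc i)) \<le> \<Lambda> (\<phi> i)" "\<Lambda> (\<phi> i) \<le> measure base_measure (A i)" for i
      by (rule measure_le_\<Lambda>[OF \<phi>L _ A] \<Lambda>_le_measure[OF \<phi>L _ A]; force simp: \<phi>_def A_def indicator_def)+
    have indI: "integrable base_measure (indicator (A i) :: 'b \<Rightarrow> real)" for i
      using A by (intro integrable_real_indicator) (auto simp: base.emeasure_eq_measure)
    have gi: "measure base_measure (A (Suc i)) \<le> (\<integral>x. \<phi> i x \<partial>base_measure)"
      "(\<integral>x. \<phi> i x \<partial>base_measure) \<le> measure base_measure (A i)" for i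
    proof -
      have "(\<integral>x. indicator (A (Suc i)) x \<partial>base_measure) \<le> (\<integral>x. \<phi> i x \<partial>base_measure)"
        by (intro integral_mono mem_integrable[OF \<phi>L] indI)
           (auto simp: \<phi>_def A_def split: split_indicator)
      then show "measure base_measure (A (Suc i)) \<le> (\<integral>x. \<phi> i x \<partial>base_measure)" using A by simp
      have "(\<integral>x. \<phi> i x \<partial>base_measure) \<le> (\<integral>x. indicator (A i) x \<partial>base_measure)"
        by (intro integral_mono mem_integrable[OF \<phi>L] indI)
           (auto simp: \<phi>_def A_def space_base_measure split: split_indicator)
      then show "(\<integral>x. \<phi> i x \<partial>base_measure) \<le> measure base_measure (A i)" using A by simp
    qed
    have "\<Lambda> (\<lambda>x. \<Sum>i<n. \<phi> i x) = \<Lambda> (\<lambda>x. real n * F x)"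
      by (intro \<Lambda>_cong sum_mem scale_mem \<phi>L F(1) sum)
    then have S\<Lambda>: "(\<Sum>i<n. \<Lambda> (\<phi> i)) = real n * \<Lambda> F"
      using \<Lambda>_sum[of "{..<n}" \<phi>, OF \<phi>L] \<Lambda>_scale[OF F(1)] by simp
    have "(\<integral>x. (\<Sum>i<n. \<phi> i x) \<partial>base_measure) = (\<integral>x. real n * F x \<partial>base_measure)"
      by (intro Bochner_Integration.integral_cong) (auto simp: space_base_measure sum)
    then have SI: "(\<Sum>i<n. \<integral>x. \<phi> i x \<partial>base_measure) = real n * (\<integral>x. F x \<partial>base_measure)"
      using mem_integrable[OF \<phi>L] by simp
    \<comment> \<open>Both functionals lie between the same two sums, which differ by at most 1.\<close>
    have tel: "(\<Sum>i<n. measure base_measure (A i)) - (\<Sum>i<n. measure base_measure (A (Suc i))) \<le> 1"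
    proof -
      have "(\<Sum>i<n. measure base_measure (A i) - measure base_measure (A (Suc i)))
          = measure base_measure (A 0) - measure base_measure (A n)"
        by (rule sum_lessThan_telescope')
      then show ?thesis by (simp add: sum_subtractf) (smt (verit) measure_nonneg base.prob_le_1)
    qed
    have "(\<Sum>i<n. measure base_measure (A (Suc i))) \<le> real n * \<Lambda> F"
      "real n * \<Lambda> F \<le> (\<Sum>i<n. measure base_measure (A i))"
      unfolding S\<Lambda>[symmetric] by (intro sum_mono ge)+
    moreover have "(\<Sum>i<n. measure base_measure (A (Suc i))) \<le> real n * (\<integral>x. F x \<partial>base_measure)"
      "real n * (\<integral>x. F x \<partial>base_measure) \<le> (\<Sum>i<n. measure base_measure (A i))"
      unfolding SI[symmetric] by (intro sum_mono gi)+
    ultimately have "\<bar>real n * (\<integral>x. F x \<partial>base_measure) - real n * \<Lambda> F\<bar> \<le> 1"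
      using tel by linarith
    moreover have "real n * \<bar>(\<integral>x. F x \<partial>base_measure) - \<Lambda> F\<bar>
        = \<bar>real n * (\<integral>x. F x \<partial>base_measure) - real n * \<Lambda> F\<bar>"
      by (metis abs_mult abs_of_nat right_diff_distrib)
    ultimately show ?thesis by simp
  qed
  show ?thesis
  proof (rule ccontr)
    assume "\<not> ?thesis"
    then have "0 < \<bar>(\<integral>x. F x \<partial>base_measure) - \<Lambda> F\<bar>" by simp
    then obtain n where "1 < real n * \<bar>(\<integral>x. F x \<partial>base_measure) - \<Lambda> F\<bar>"
      using ex_less_of_nat_mult by blast
    then show False using bound[of n] by simp
  qed
qed

theorem integral_base_measure:
  assumes F: "F \<in> L"
  shows "(\<integral>x. F x \<partial>base_measure) = \<Lambda> F"
proof -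
  obtain B0 where B0: "\<forall>x\<in>S. \<bar>F x\<bar> \<le> B0" using bounded_mem[OF F] by blast
  define B where "B = \<bar>B0\<bar> + 1"
  have B: "0 < B" "\<And>x. x \<in> S \<Longrightarrow> \<bar>F x\<bar> \<le> B" using B0 unfolding B_def by force+
  let ?G = "\<lambda>x. (1 / (2 * B)) * F x + 1/2"
  have GL: "?G \<in> L" by (intro add_mem scale_mem const_mem F)
  have "(\<integral>x. ?G x \<partial>base_measure) = \<Lambda> ?G"
  proof (rule integral_eq_\<Lambda>_unit[OF GL])
    fix x assume "x \<in> S" then have "\<bar>F x\<bar> \<le> B" by (rule B)
    then show "0 \<le> ?G x \<and> ?G x \<le> 1" using B(1) by (auto simp: field_simps abs_le_iff)
  qed
  moreover have "\<Lambda> ?G = (1 / (2 * B)) * \<Lambda> F + 1/2"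
    using \<Lambda>_add[OF scale_mem[OF F] const_mem, of "1/(2*B)" "1/2"] \<Lambda>_scale[OF F, of "1/(2*B)"] \<Lambda>_const by simp
  moreover have "(\<integral>x. ?G x \<partial>base_measure) = (1 / (2 * B)) * (\<integral>x. F x \<partial>base_measure) + 1/2"
    using mem_integrable[OF F] by (simp add: base.prob_space)
  ultimately show ?thesis using B(1) by simp
qed

end

section \<open>Separability of L1\<close>

abbreviation pairing :: "('a::euclidean_space \<Rightarrow> real) \<Rightarrow> ('a \<Rightarrow> real) \<Rightarrow> real" where
  "pairing h g \<equiv> \<integral>x. h x * g x \<partial>lebesgue"

lemma borel_imp_lebesgue: "A \<in> sets borel \<Longrightarrow> A \<in> sets lebesgue"
  using sets_completionI_sets[of A lborel] by simp

lemma Sd_measurable: "h \<in> Sd \<Longrightarrow> h \<in> borel_measurable lebesgue"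
  and Sd_nonneg: "h \<in> Sd \<Longrightarrow> 0 \<le> h x"
  and Sd_le_1: "h \<in> Sd \<Longrightarrow> h x \<le> 1"
  by (auto simp: Sd_def)

lemma Sd_mult_integrable:
  assumes h: "h \<in> Sd" and g: "integrable lebesgue g"
  shows "integrable lebesgue (\<lambda>x. h x * g x)"
proof (rule Bochner_Integration.integrable_bound[OF g])
  show "(\<lambda>x. h x * g x) \<in> borel_measurable lebesgue"
    using Sd_measurable[OF h] g by measurable
  show "AE x in lebesgue. norm (h x * g x) \<le> norm (g x)"
    using Sd_nonneg[OF h] Sd_le_1[OF h] by (auto simp: abs_mult mult_left_le_one_le)
qed

lemma pairing_abs_le:
  assumes h: "h \<in> Sd" and g: "integrable lebesgue g"
  shows "\<bar>pairing h g\<bar> \<le> (\<integral>x. \<bar>g x\<bar> \<partial>lebesgue)"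
proof -
  have "\<bar>pairing h g\<bar> \<le> (\<integral>x. \<bar>h x * g x\<bar> \<partial>lebesgue)" by (rule integral_abs_bound)
  also have "\<dots> \<le> (\<integral>x. \<bar>g x\<bar> \<partial>lebesgue)"
    using Sd_mult_integrable[OF h g] g Sd_nonneg[OF h] Sd_le_1[OF h]
    by (intro integral_mono integrable_abs) (auto simp: abs_mult mult_left_le_one_le)
  finally show ?thesis .
qed

lemma pairing_diff_le:
  assumes h: "h \<in> Sd" and g: "integrable lebesgue g" "integrable lebesgue g'"
  shows "\<bar>pairing h g - pairing h g'\<bar> \<le> (\<integral>x. \<bar>g x - g' x\<bar> \<partial>lebesgue)"
proof -
  have "pairing h g - pairing h g' = pairing h (\<lambda>x. g x - g' x)"
    using Sd_mult_integrable[OF h] g by (simp add: right_diff_distrib)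
  then show ?thesis using pairing_abs_le[OF h, of "\<lambda>x. g x - g' x"] g by simp
qed

text \<open>With such a weight every indicator becomes integrable and
  \<open>density lebesgue w\<close> is finite. This allows complements in the Dynkin system of
  \<open>ex_controlling_sequence\<close> and cancellation of masses in
  \<open>ex_weak_limit\<close>.\<close>

lemma ex_integrable_weight:
  obtains w :: "'a::euclidean_space \<Rightarrow> real"
  where "w \<in> borel_measurable borel" "\<And>x. 0 < w x" "integrable lebesgue w"
proof -
  obtain h :: "'a \<Rightarrow> ennreal" where h: "h \<in> borel_measurable lborel" "integral\<^sup>N lborel h \<noteq> \<infinity>"
    "\<And>x. 0 < h x \<and> h x < \<infinity>"
    using sigma_finite_measure.Ex_finite_integrable_function[OF sigma_finite_lborel] by auto
  define w where "w x = enn2real (h x)" for x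
  have wb: "w \<in> borel_measurable borel" using h(1) unfolding w_def by measurable
  have w0: "0 < w x" for x using h(3)[of x] unfolding w_def by (simp add: enn2real_positive_iff)
  have "ennreal (w x) = h x" for x using h(3)[of x] unfolding w_def by (intro ennreal_enn2real) simp
  then have "integrable lborel w"
    using wb w0 h(2) by (intro integrableI_nonneg) (auto simp: less_imp_le top.not_eq_extremum)
  then have "integrable lebesgue w" using wb by (simp add: integrable_completion)
  with wb w0 that show ?thesis by blast
qed

locale weight =
  fixes w :: "'a::euclidean_space \<Rightarrow> real"
  assumes weight_borel[measurable]: "w \<in> borel_measurable borel"
    and weight_pos: "\<And>x. 0 < w x"
    and weight_integrable: "integrable lebesgue w"
begin

lemma weight_lebesgue[measurable]: "w \<in> borel_measurable lebesgue"
  using weight_borel by (simp add: measurable_completion)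

lemma weight_indicator_integrable:
  "A \<in> sets lebesgue \<Longrightarrow> integrable lebesgue (\<lambda>x. w x * indicator A x)"
  using weight_pos
  by (intro Bochner_Integration.integrable_bound[OF weight_integrable])
     (auto simp: indicator_def)

text \<open>Countable unions become L1 limits, the one kind of limit that both control and weak
  limits of pairings respect.\<close>

lemma partial_union_tendsto:
  assumes A: "disjoint_family A" "\<And>i::nat. A i \<in> sets lebesgue"
  shows "(\<lambda>n. \<integral>x. \<bar>(\<Sum>i<n. w x * indicator (A i) x) - w x * indicator (\<Union>i. A i) x\<bar> \<partial>lebesgue) \<longlonglongrightarrow> 0"
proof -
  have sums: "(\<lambda>i. w x * indicator (A i) x) sums (w x * indicator (\<Union>i. A i) x)" for x
    using indicator_sums[of A x] A(1) by (intro sums_mult) (auto simp: disjoint_family_on_def)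
  have le: "0 \<le> (\<Sum>i<n. w x * indicator (A i) x)" "(\<Sum>i<n. w x * indicator (A i) x) \<le> w x * indicator (\<Union>i. A i) x" for n x
  proof -
    show "0 \<le> (\<Sum>i<n. w x * indicator (A i) x)"
      using less_imp_le[OF weight_pos] by (intro sum_nonneg) auto
    have "(\<Sum>i<n. w x * indicator (A i) x) \<le> (\<Sum>i. w x * indicator (A i) x)"
      using less_imp_le[OF weight_pos] by (intro sum_le_suminf sums_summable[OF sums]) auto
    then show "(\<Sum>i<n. w x * indicator (A i) x) \<le> w x * indicator (\<Union>i. A i) x"
      using sums_unique[OF sums] by simp
  qed
  have Un: "(\<Union>i. A i) \<in> sets lebesgue" using A(2) by auto
  have "(\<lambda>n. \<integral>x. \<bar>(\<Sum>i<n. w x * indicator (A i) x) - w x * indicator (\<Union>i. A i) x\<bar> \<partial>lebesgue)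
     \<longlonglongrightarrow> (\<integral>x. 0 \<partial>(lebesgue :: 'a measure))"
  proof (rule integral_dominated_convergence[OF _ _ weight_integrable])
    show "(\<lambda>x. \<bar>(\<Sum>i<n. w x * indicator (A i) x) - w x * indicator (\<Union>i. A i) x\<bar>)
        \<in> borel_measurable lebesgue" for n
      using A(2) Un by measurable
    show "AE x in lebesgue. (\<lambda>n. \<bar>(\<Sum>i<n. w x * indicator (A i) x) - w x * indicator (\<Union>i. A i) x\<bar>) \<longlonglongrightarrow> 0"
      using sums unfolding sums_def by (intro AE_I2 tendsto_rabs_zero) (simp add: LIM_zero)
    show "AE x in lebesgue. norm \<bar>(\<Sum>i<n. w x * indicator (A i) x) - w x * indicator (\<Union>i. A i) x\<bar> \<le> w x" for n
    proof (rule AE_I2)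
      fix x
      have "w x * indicator (\<Union>i. A i) x \<le> w x" using weight_pos[of x] by (simp add: indicator_def)
      then show "norm \<bar>(\<Sum>i<n. w x * indicator (A i) x) - w x * indicator (\<Union>i. A i) x\<bar> \<le> w x"
        using le[where n=n and x=x] by simp
    qed
  qed simp
  then show ?thesis by simp
qed

text \<open>Every g is w times g / w, and g / w is integrable for the measure with density w.
  Induction over that measure starts from weighted indicators, and its dominated pointwise limits
  turn into L1 limits after multiplication by w.\<close>

lemma integrable_weighted_induct:
  assumes g: "integrable lebesgue g"
    and base: "\<And>A. A \<in> sets lebesgue \<Longrightarrow> P (\<lambda>x. w x * indicator A x)"
    and scale: "\<And>g c. integrable lebesgue g \<Longrightarrow> P g \<Longrightarrow> P (\<lambda>x. c * g x)"
    and add: "\<And>g g'. integrable lebesgue g \<Longrightarrow> integrable lebesgue g' \<Longrightarrow> P g \<Longrightarrow> P g' \<Longrightarrow> P (\<lambda>x. g x + g' x)"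
    and lim: "\<And>g s. integrable lebesgue g \<Longrightarrow> (\<And>n::nat. integrable lebesgue (s n)) \<Longrightarrow> (\<And>n. P (s n))
      \<Longrightarrow> (\<lambda>n. \<integral>x. \<bar>s n x - g x\<bar> \<partial>lebesgue) \<longlonglongrightarrow> 0 \<Longrightarrow> P g"
  shows "P (g :: 'a \<Rightarrow> real)"
proof -
  have weight_ne: "w x \<noteq> 0" for x using weight_pos[of x] by simp
  let ?R = "density lebesgue w"
  have int_iff: "integrable ?R u \<longleftrightarrow> integrable lebesgue (\<lambda>x. w x * u x)"
    if "u \<in> borel_measurable lebesgue" for u :: "'a \<Rightarrow> real"
    using integrable_density[OF that weight_lebesgue] less_imp_le[OF weight_pos] by simp
  have int_R: "integrable lebesgue (\<lambda>x. w x * u x)" if "integrable ?R u" for u :: "'a \<Rightarrow> real"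
    using that int_iff[of u] borel_measurable_integrable[OF that] by simp
  have "P (\<lambda>x. w x * u x)" if "integrable ?R u" for u
    using that
  proof (induction u rule: integrable_induct)
    case (base A c)
    have "P (\<lambda>x. c * (w x * indicator A x))"
      using base by (intro scale weight_indicator_integrable assms(2)) auto
    then show ?case by (simp add: mult.commute mult.left_commute)
  next
    case (add f g)
    then show ?case using assms(4)[of "\<lambda>x. w x * f x" "\<lambda>x. w x * g x"] int_R by (simp add: algebra_simps)
  next
    case (lim f s)
    have [measurable]: "f \<in> borel_measurable lebesgue" "s n \<in> borel_measurable lebesgue" for n
      using borel_measurable_integrable[OF lim.hyps(4)] borel_measurable_integrable[OF lim.hyps(1)] by auto
    have "(\<lambda>n. \<integral>x. \<bar>w x * s n x - w x * f x\<bar> \<partial>lebesgue) \<longlonglongrightarrow> (\<integral>x. 0 \<partial>(lebesgue :: 'a measure))"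
    proof (rule integral_dominated_convergence)
      \<comment> \<open>The approximants of \<open>integrable_induct\<close> satisfy |s n| \<le> 2
        |f|, hence |s n - f| \<le> 3 |f|.\<close>
      show "integrable lebesgue (\<lambda>x. 3 * \<bar>w x * f x\<bar>)"
        using int_R[OF lim.hyps(4)] by auto
      show "AE x in lebesgue. (\<lambda>n. \<bar>w x * s n x - w x * f x\<bar>) \<longlonglongrightarrow> 0"
        using lim.hyps(2) by (intro AE_I2 tendsto_rabs_zero LIM_zero tendsto_mult tendsto_const) simp
      show "AE x in lebesgue. norm \<bar>w x * s n x - w x * f x\<bar> \<le> 3 * \<bar>w x * f x\<bar>" for n
      proof (rule AE_I2)
        fix x
        have "\<bar>s n x - f x\<bar> \<le> 3 * \<bar>f x\<bar>" using lim.hyps(3)[of x n] abs_triangle_ineq4[of "s n x" "f x"] by simp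
        then have "\<bar>w x\<bar> * \<bar>s n x - f x\<bar> \<le> \<bar>w x\<bar> * (3 * \<bar>f x\<bar>)" by (intro mult_left_mono) auto
        then show "norm \<bar>w x * s n x - w x * f x\<bar> \<le> 3 * \<bar>w x * f x\<bar>"
          by (simp add: abs_mult flip: right_diff_distrib)
      qed
    qed auto
    then show ?case
      using assms(5)[OF int_R[OF lim.hyps(4)] int_R[OF lim.hyps(1)] lim.IH] by simp
  qed
  moreover have "integrable ?R (\<lambda>x. g x / w x)"
    using g weight_ne by (subst int_iff) auto
  ultimately have "P (\<lambda>x. w x * (g x / w x))" by blast
  then show ?thesis using weight_ne by simp
qed

end

section \<open>Pairings controlled by a countable family\<close>

text \<open>Uniform continuity of the functional \<open>h \<mapsto> \<integral> h g\<close> with respect to the sequence of functionals \<open>h \<mapsto> \<integral> h (e i)\<close>;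
  in this form the property passes to L1-limits of \<open>g\<close>.\<close>

definition controlled_by :: "(nat \<Rightarrow> 'a::euclidean_space \<Rightarrow> real) \<Rightarrow> ('a \<Rightarrow> real) \<Rightarrow> bool" where
  "controlled_by e g \<longleftrightarrow> (\<forall>\<epsilon>>0. \<exists>n. \<exists>\<delta>>0. \<forall>h\<in>Sd. \<forall>h'\<in>Sd.
     (\<forall>i<n. \<bar>pairing h (e i) - pairing h' (e i)\<bar> < \<delta>) \<longrightarrow> \<bar>pairing h g - pairing h' g\<bar> < \<epsilon>)"

lemma controlled_byE:
  assumes "controlled_by e g" "0 < \<epsilon>"
  obtains n \<delta> where "0 < \<delta>"
    "\<And>h h'. h \<in> Sd \<Longrightarrow> h' \<in> Sd \<Longrightarrow> (\<forall>i<n. \<bar>pairing h (e i) - pairing h' (e i)\<bar> < \<delta>)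
      \<Longrightarrow> \<bar>pairing h g - pairing h' g\<bar> < \<epsilon>"
proof -
  obtain n \<delta> where "0 < \<delta> \<and> (\<forall>h\<in>Sd. \<forall>h'\<in>Sd.
      (\<forall>i<n. \<bar>pairing h (e i) - pairing h' (e i)\<bar> < \<delta>) \<longrightarrow> \<bar>pairing h g - pairing h' g\<bar> < \<epsilon>)"
    using assms unfolding controlled_by_def by blast
  then show ?thesis by (intro that[of \<delta> n]) blast+
qed

lemma controlled_by_self: "controlled_by e (e i)"
  unfolding controlled_by_def
proof (intro allI impI)
  fix \<epsilon> :: real assume "0 < \<epsilon>"
  then show "\<exists>n. \<exists>\<delta>>0. \<forall>h\<in>Sd. \<forall>h'\<in>Sd. (\<forall>i<n. \<bar>pairing h (e i) - pairing h' (e i)\<bar> < \<delta>)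
     \<longrightarrow> \<bar>pairing h (e i) - pairing h' (e i)\<bar> < \<epsilon>"
    by (intro exI[of _ "Suc i"] exI[of _ \<epsilon>]) auto
qed

lemma controlled_by_add:
  assumes int: "integrable lebesgue g" "integrable lebesgue g'"
    and c: "controlled_by e g" "controlled_by e g'"
  shows "controlled_by e (\<lambda>x. g x + g' x)"
  unfolding controlled_by_def
proof (intro allI impI)
  fix \<epsilon> :: real assume "0 < \<epsilon>"
  then have "0 < \<epsilon> / 2" by simp
  obtain n \<delta> where 1: "0 < \<delta>" "\<And>h h'. h \<in> Sd \<Longrightarrow> h' \<in> Sd \<Longrightarrow> (\<forall>i<n. \<bar>pairing h (e i) - pairing h' (e i)\<bar> < \<delta>)
     \<Longrightarrow> \<bar>pairing h g - pairing h' g\<bar> < \<epsilon> / 2"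
    by (rule controlled_byE[OF c(1) \<open>0 < \<epsilon> / 2\<close>]) (rule that)
  obtain n' \<delta>' where 2: "0 < \<delta>'" "\<And>h h'. h \<in> Sd \<Longrightarrow> h' \<in> Sd \<Longrightarrow> (\<forall>i<n'. \<bar>pairing h (e i) - pairing h' (e i)\<bar> < \<delta>')
     \<Longrightarrow> \<bar>pairing h g' - pairing h' g'\<bar> < \<epsilon> / 2"
    by (rule controlled_byE[OF c(2) \<open>0 < \<epsilon> / 2\<close>]) (rule that)
  have "\<bar>pairing h (\<lambda>x. g x + g' x) - pairing h' (\<lambda>x. g x + g' x)\<bar> < \<epsilon>"
    if hs: "h \<in> Sd" "h' \<in> Sd" "\<forall>i<max n n'. \<bar>pairing h (e i) - pairing h' (e i)\<bar> < min \<delta> \<delta>'" for h h'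
  proof -
    have "\<bar>pairing h g - pairing h' g\<bar> < \<epsilon> / 2" "\<bar>pairing h g' - pairing h' g'\<bar> < \<epsilon> / 2"
      by (rule 1(2) 2(2); use hs in auto)+
    moreover have "pairing k (\<lambda>x. g x + g' x) = pairing k g + pairing k g'" if "k \<in> Sd" for k
      using Sd_mult_integrable[OF that] int by (simp add: distrib_left)
    note this[OF hs(1)] this[OF hs(2)]
    ultimately show ?thesis by linarith
  qed
  then show "\<exists>n. \<exists>\<delta>>0. \<forall>h\<in>Sd. \<forall>h'\<in>Sd. (\<forall>i<n. \<bar>pairing h (e i) - pairing h' (e i)\<bar> < \<delta>)
     \<longrightarrow> \<bar>pairing h (\<lambda>x. g x + g' x) - pairing h' (\<lambda>x. g x + g' x)\<bar> < \<epsilon>"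
    using 1(1) 2(1) by (intro exI[of _ "max n n'"] exI[of _ "min \<delta> \<delta>'"]) auto
qed

lemma controlled_by_scale:
  assumes c: "controlled_by e g"
  shows "controlled_by e (\<lambda>x. c * g x)"
  unfolding controlled_by_def
proof (intro allI impI)
  fix \<epsilon> :: real assume \<epsilon>: "0 < \<epsilon>"
  define \<eta> where "\<eta> = \<epsilon> / (\<bar>c\<bar> + 1)"
  have \<eta>: "0 < \<eta>" "\<bar>c\<bar> * \<eta> < \<epsilon>" using \<epsilon> by (auto simp: \<eta>_def field_simps)
  obtain n \<delta> where 1: "0 < \<delta>" "\<And>h h'. h \<in> Sd \<Longrightarrow> h' \<in> Sd \<Longrightarrow> (\<forall>i<n. \<bar>pairing h (e i) - pairing h' (e i)\<bar> < \<delta>)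
     \<Longrightarrow> \<bar>pairing h g - pairing h' g\<bar> < \<eta>"
    by (rule controlled_byE[OF c \<eta>(1)]) (rule that)
  have "\<bar>pairing h (\<lambda>x. c * g x) - pairing h' (\<lambda>x. c * g x)\<bar> < \<epsilon>"
    if hs: "h \<in> Sd" "h' \<in> Sd" "\<forall>i<n. \<bar>pairing h (e i) - pairing h' (e i)\<bar> < \<delta>" for h h'
  proof -
    have "pairing k (\<lambda>x. c * g x) = c * pairing k g" for k
      by (simp add: mult.left_commute)
    then have "\<bar>pairing h (\<lambda>x. c * g x) - pairing h' (\<lambda>x. c * g x)\<bar> = \<bar>c\<bar> * \<bar>pairing h g - pairing h' g\<bar>"
      by (simp add: abs_mult flip: right_diff_distrib)
    also have "\<dots> \<le> \<bar>c\<bar> * \<eta>" using 1(2)[OF hs] by (intro mult_left_mono) auto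
    finally show ?thesis using \<eta>(2) by simp
  qed
  then show "\<exists>n. \<exists>\<delta>>0. \<forall>h\<in>Sd. \<forall>h'\<in>Sd. (\<forall>i<n. \<bar>pairing h (e i) - pairing h' (e i)\<bar> < \<delta>)
     \<longrightarrow> \<bar>pairing h (\<lambda>x. c * g x) - pairing h' (\<lambda>x. c * g x)\<bar> < \<epsilon>"
    using 1(1) by blast
qed

lemma controlled_by_lim:
  assumes g: "integrable lebesgue g" and s: "\<And>n::nat. integrable lebesgue (s n)" "\<And>n. controlled_by e (s n)"
    and lim: "(\<lambda>n. \<integral>x. \<bar>s n x - g x\<bar> \<partial>lebesgue) \<longlonglongrightarrow> 0"
  shows "controlled_by e g"
  unfolding controlled_by_def
proof (intro allI impI)
  fix \<epsilon> :: real assume \<epsilon>: "0 < \<epsilon>"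
  then have \<epsilon>3: "0 < \<epsilon> / 3" by simp
  then obtain N where "\<bar>(\<integral>x. \<bar>s N x - g x\<bar> \<partial>lebesgue)\<bar> < \<epsilon> / 3"
    using LIMSEQ_D[OF lim, of "\<epsilon> / 3"] by auto
  then have N: "(\<integral>x. \<bar>s N x - g x\<bar> \<partial>lebesgue) < \<epsilon> / 3" by simp
  obtain n \<delta> where 1: "0 < \<delta>" "\<And>h h'. h \<in> Sd \<Longrightarrow> h' \<in> Sd \<Longrightarrow> (\<forall>i<n. \<bar>pairing h (e i) - pairing h' (e i)\<bar> < \<delta>)
     \<Longrightarrow> \<bar>pairing h (s N) - pairing h' (s N)\<bar> < \<epsilon> / 3"
    by (rule controlled_byE[OF s(2)[of N] \<epsilon>3]) (rule that)
  have "\<bar>pairing h g - pairing h' g\<bar> < \<epsilon>"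
    if hs: "h \<in> Sd" "h' \<in> Sd" "\<forall>i<n. \<bar>pairing h (e i) - pairing h' (e i)\<bar> < \<delta>" for h h'
    using 1(2)[OF hs] pairing_diff_le[OF hs(1) s(1)[of N] g] pairing_diff_le[OF hs(2) s(1)[of N] g] N
    by linarith
  then show "\<exists>n. \<exists>\<delta>>0. \<forall>h\<in>Sd. \<forall>h'\<in>Sd. (\<forall>i<n. \<bar>pairing h (e i) - pairing h' (e i)\<bar> < \<delta>)
     \<longrightarrow> \<bar>pairing h g - pairing h' g\<bar> < \<epsilon>"
    using 1(1) by blast
qed

lemma controlled_by_cong_AE:
  assumes "AE x in lebesgue. g x = g' x" "g \<in> borel_measurable lebesgue" "g' \<in> borel_measurable lebesgue"
    and "controlled_by e g"
  shows "controlled_by e g'"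
proof -
  have "pairing h g = pairing h g'" if "h \<in> Sd" for h
    using assms(1-3) Sd_measurable[OF that] by (intro integral_cong_AE) auto
  then show ?thesis using assms(4) unfolding controlled_by_def by (simp cong: ball_cong)
qed

text \<open>The e n are w times the indicators of a countable intersection-stable generator of the
  Borel sets. Control spreads from there to all Borel sets by the Dynkin argument, to Lebesgue sets
  by discarding null sets, and to L1 by \<open>integrable_weighted_induct\<close>.\<close>

lemma (in weight) ex_controlling_sequence:
  obtains e where "\<And>n. integrable lebesgue (e n)" "\<And>g :: 'a \<Rightarrow> real. integrable lebesgue g \<Longrightarrow> controlled_by e g"
proof -
  obtain B :: "'a set set" where B: "countable B" "topological_basis B"
    using ex_countable_basis by blast
  \<comment> \<open>The empty family contributes UNIV, so w itself is among the e n; complements are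
    handled by subtracting from w.\<close>
  define G where "G = Inter ` {F. finite F \<and> F \<subseteq> B}"
  have G: "countable G" "UNIV \<in> G"
    unfolding G_def using countable_Collect_finite_subset[OF B(1)] by (auto simp: image_iff intro!: exI[of _ "{}"])
  have stable: "Int_stable G"
    unfolding Int_stable_def G_def
  proof safe
    fix F F' assume "finite F" "F \<subseteq> B" "finite F'" "F' \<subseteq> B"
    then show "\<Inter>F \<inter> \<Inter>F' \<in> Inter ` {F. finite F \<and> F \<subseteq> B}"
      by (intro image_eqI[of _ _ "F \<union> F'"]) auto
  qed
  have borel: "sets (borel :: 'a measure) = sigma_sets UNIV B"
    unfolding borel_eq_countable_basis[OF B] by (rule sets_measure_of) simp
  have "B \<subseteq> G" unfolding G_def by (auto intro!: image_eqI[of _ _ "{b}" for b])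
  then have sub: "sets (borel :: 'a measure) \<subseteq> sigma_sets UNIV G"
    unfolding borel by (intro sigma_sets_mono') 
  have Gb: "G \<subseteq> sets borel"
  proof
    fix A assume "A \<in> G"
    then obtain F where "A = \<Inter>F" "finite F" "F \<subseteq> B" unfolding G_def by blast
    then show "A \<in> sets borel"
      using topological_basis_open[OF B(2)] by (auto intro!: borel_open open_Inter)
  qed
  have sG: "sigma_sets UNIV G \<subseteq> sets lebesgue"
    using sets.sigma_sets_subset[OF Gb] borel_imp_lebesgue by auto
  define e where "e n = (\<lambda>x. w x * indicator (from_nat_into G n) x)" for n
  have e_eq: "e n = (\<lambda>x. w x * indicator (from_nat_into G n) x)" for n by (simp add: e_def)
  have eG: "from_nat_into G n \<in> G" for n using G(2) by (intro from_nat_into) auto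
  have eint: "integrable lebesgue (e n)" for n
    unfolding e_def using eG Gb by (intro weight_indicator_integrable borel_imp_lebesgue) blast
  have ctrl_sigma: "controlled_by e (\<lambda>x. w x * indicator A x)" if "A \<in> sigma_sets UNIV G" for A
    using stable subset_UNIV[of G, folded Pow_UNIV] that
  proof (induction A rule: sigma_sets_induct_disjoint)
    case (basic A)
    obtain n where "from_nat_into G n = A"
      using from_nat_into_surj[OF G(1) basic] by blast
    then show ?case using controlled_by_self[of e n] by (simp only: e_eq[of n])
  next
    case empty
    then show ?case by (simp add: controlled_by_def)
  next
    case (compl A)
    obtain n where "from_nat_into G n = UNIV" using from_nat_into_surj[OF G] by blast
    then have "controlled_by e w" using controlled_by_self[of e n] by (simp only: e_eq[of n]) simp
    then have "controlled_by e (\<lambda>x. w x + (-1) * (w x * indicator A x))"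
      using compl.hyps compl.IH sG
      by (intro controlled_by_add controlled_by_scale weight_integrable integrable_mult_right
          weight_indicator_integrable) blast+
    also have "(\<lambda>x. w x + (-1) * (w x * indicator A x)) = (\<lambda>x. w x * indicator (UNIV - A) x)"
      by (auto simp: indicator_def)
    finally show ?case .
  next
    case (union A)
    have A: "A i \<in> sets lebesgue" for i using union.hyps(2) sG by auto
    show ?case
    proof (rule controlled_by_lim[OF _ _ _ partial_union_tendsto[OF union.hyps(1) A]])
      show "controlled_by e (\<lambda>x. \<Sum>i<n. w x * indicator (A i) x)" for n
      proof (induction n)
        case 0 then show ?case by (simp add: controlled_by_def)
      next
        case (Suc n)
        then show ?case
          unfolding sum.lessThan_Suc
          by (intro controlled_by_add union.IH Bochner_Integration.integrable_sum weight_indicator_integrable A)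
      qed
    next
      show "integrable lebesgue (\<lambda>x. w x * indicator (\<Union>i. A i) x)"
        using A by (intro weight_indicator_integrable sets.countable_nat_UN) auto
      show "integrable lebesgue (\<lambda>x. \<Sum>i<n. w x * indicator (A i) x)" for n
        by (intro Bochner_Integration.integrable_sum weight_indicator_integrable A)
    qed
  qed
  have ctrl_set: "controlled_by e (\<lambda>x. w x * indicator A x)" if A: "A \<in> sets lebesgue" for A
  proof -
    obtain S N N' where S: "A = S \<union> N" "N \<subseteq> N'" "N' \<in> null_sets lborel" "S \<in> sets lborel"
      using sets_completionE[OF A] by metis
    have "AE x in lebesgue. x \<notin> N'"
      using S(3) by (intro AE_completion AE_not_in)
    then have ae: "AE x in lebesgue. w x * indicator S x = w x * indicator A x"
      by eventually_elim (use S(1,2) in \<open>auto simp: indicator_def\<close>)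
    have ctrl: "controlled_by e (\<lambda>x. w x * indicator S x)"
      using S(4) sub by (intro ctrl_sigma) auto
    have SL: "S \<in> sets lebesgue" using S(4) by (intro borel_imp_lebesgue) simp
    show ?thesis
      using borel_measurable_integrable[OF weight_indicator_integrable[OF SL]]
        borel_measurable_integrable[OF weight_indicator_integrable[OF A]]
      by (rule controlled_by_cong_AE[OF ae _ _ ctrl])
  qed
  have "controlled_by e g" if "integrable lebesgue g" for g
  proof (rule integrable_weighted_induct[where P="controlled_by e", OF that])
    show "controlled_by e g"
      if "integrable lebesgue g" "\<And>n::nat. integrable lebesgue (s n)" "\<And>n. controlled_by e (s n)"
        "(\<lambda>n. \<integral>x. \<bar>s n x - g x\<bar> \<partial>lebesgue) \<longlonglongrightarrow> 0" for g s
      using that by (rule controlled_by_lim)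
  qed (auto intro: ctrl_set controlled_by_scale controlled_by_add)
  with that eint show ?thesis by blast
qed

text \<open>The limits \<phi> of the pairings give a set function \<phi> (w 1_A), countably additive
  because \<phi> is Lipschitz for the L1 norm and dominated by w times Lebesgue measure because all
  h k are at most 1. Its Radon-Nikodym density is the weak limit.\<close>

lemma (in weight) ex_weak_limit:
  fixes h :: "nat \<Rightarrow> 'a \<Rightarrow> real"
  assumes h: "\<And>k. h k \<in> Sd"
    and conv: "\<And>g. integrable lebesgue g \<Longrightarrow> convergent (\<lambda>k. pairing (h k) g)"
  obtains h' where "h' \<in> Sd" "\<And>g. integrable lebesgue g \<Longrightarrow> (\<lambda>k. pairing (h k) g) \<longlonglongrightarrow> pairing h' g"
proof -
  define \<phi> where "\<phi> g = lim (\<lambda>k. pairing (h k) g)" for g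
  have \<phi>: "(\<lambda>k. pairing (h k) g) \<longlonglongrightarrow> \<phi> g" if "integrable lebesgue g" for g
    using conv[OF that] unfolding \<phi>_def by (simp add: convergent_LIMSEQ_iff)
  have \<phi>_add: "\<phi> (\<lambda>x. g x + g' x) = \<phi> g + \<phi> g'" if "integrable lebesgue g" "integrable lebesgue g'" for g g'
  proof (rule LIMSEQ_unique[OF \<phi>])
    have "pairing (h k) (\<lambda>x. g x + g' x) = pairing (h k) g + pairing (h k) g'" for k
      using Sd_mult_integrable[OF h] that by (simp add: distrib_left)
    then show "(\<lambda>k. pairing (h k) (\<lambda>x. g x + g' x)) \<longlonglongrightarrow> \<phi> g + \<phi> g'"
      using tendsto_add[OF \<phi>[OF that(1)] \<phi>[OF that(2)]] by simp
  qed (use that in auto)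
  have \<phi>_scale: "\<phi> (\<lambda>x. c * g x) = c * \<phi> g" if "integrable lebesgue g" for c g
  proof (rule LIMSEQ_unique[OF \<phi>])
    have "pairing (h k) (\<lambda>x. c * g x) = c * pairing (h k) g" for k
      by (simp add: mult.left_commute)
    then show "(\<lambda>k. pairing (h k) (\<lambda>x. c * g x)) \<longlonglongrightarrow> c * \<phi> g"
      using tendsto_mult[OF tendsto_const \<phi>[OF that]] by simp
  qed (use that in auto)
  have \<phi>_bound: "\<bar>\<phi> g - \<phi> g'\<bar> \<le> (\<integral>x. \<bar>g x - g' x\<bar> \<partial>lebesgue)"
    if "integrable lebesgue g" "integrable lebesgue g'" for g g'
    using pairing_diff_le[OF h that] \<phi>[OF that(1)] \<phi>[OF that(2)]
    by (intro LIMSEQ_le_const2[of "\<lambda>k. \<bar>pairing (h k) g - pairing (h k) g'\<bar>"] tendsto_rabs tendsto_diff) auto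
  have \<phi>_nonneg: "0 \<le> \<phi> g" if "integrable lebesgue g" "\<And>x. 0 \<le> g x" for g
    using that Sd_nonneg[OF h]
    by (intro LIMSEQ_le_const[OF \<phi>] exI[of _ 0]) (auto intro!: integral_nonneg_AE)
  let ?wi = "\<lambda>A x. w x * indicator A x :: real"
  have wi0: "0 \<le> ?wi A x" for A x using weight_pos[of x] by (simp add: indicator_def)
  define \<nu> where "\<nu> = measure_of UNIV (sets (lebesgue :: 'a measure)) (\<lambda>A. ennreal (\<phi> (?wi A)))"
  have sets_\<nu>: "sets \<nu> = sets lebesgue"
    unfolding \<nu>_def using sets.sigma_sets_eq[of "lebesgue :: 'a measure"] by simp
  have sum_\<phi>: "\<phi> (\<lambda>x. \<Sum>i<n. ?wi (A i) x) = (\<Sum>i<n. \<phi> (?wi (A i)))"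
    if "\<And>i. A i \<in> sets lebesgue" for A :: "nat \<Rightarrow> 'a set" and n
  proof (induction n)
    case 0
    show ?case using \<phi>_scale[of "\<lambda>_. 0" 0] by simp
  next
    case (Suc n)
    have "\<phi> (\<lambda>x. (\<Sum>i<n. ?wi (A i) x) + ?wi (A n) x) = \<phi> (\<lambda>x. \<Sum>i<n. ?wi (A i) x) + \<phi> (?wi (A n))"
      by (intro \<phi>_add Bochner_Integration.integrable_sum weight_indicator_integrable that)
    then show ?case using Suc by simp
  qed
  have em_\<nu>: "emeasure \<nu> A = ennreal (\<phi> (?wi A))" if "A \<in> sets lebesgue" for A
  proof (rule emeasure_measure_of[OF \<nu>_def])
    show "positive (sets \<nu>) (\<lambda>A. ennreal (\<phi> (?wi A)))"
      using \<phi>_scale[of "\<lambda>_. 0" 0] by (simp add: positive_def)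
    show "countably_additive (sets \<nu>) (\<lambda>A. ennreal (\<phi> (?wi A)))"
      unfolding countably_additive_def sets_\<nu>
    proof (intro allI impI)
      fix A :: "nat \<Rightarrow> 'a set"
      assume A: "range A \<subseteq> sets lebesgue" and disj: "disjoint_family A" and Un: "(\<Union>i. A i) \<in> sets lebesgue"
      have Ai: "A i \<in> sets lebesgue" for i using A by auto
      have "(\<lambda>n. \<phi> (\<lambda>x. \<Sum>i<n. ?wi (A i) x) - \<phi> (?wi (\<Union>i. A i))) \<longlonglongrightarrow> 0"
      proof (rule Lim_null_comparison[OF _ partial_union_tendsto[OF disj Ai]], rule always_eventually, rule allI)
        show "norm (\<phi> (\<lambda>x. \<Sum>i<n. ?wi (A i) x) - \<phi> (?wi (\<Union>i. A i)))
            \<le> (\<integral>x. \<bar>(\<Sum>i<n. ?wi (A i) x) - ?wi (\<Union>i. A i) x\<bar> \<partial>lebesgue)" for n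
          unfolding real_norm_def
          by (intro \<phi>_bound Bochner_Integration.integrable_sum weight_indicator_integrable Ai Un)
      qed
      then have "(\<lambda>i. \<phi> (?wi (A i))) sums \<phi> (?wi (\<Union>i. A i))"
        unfolding sums_def sum_\<phi>[OF Ai] by (rule LIM_zero_cancel)
      then show "(\<Sum>i. ennreal (\<phi> (?wi (A i)))) = ennreal (\<phi> (?wi (\<Union>i. A i)))"
        by (intro suminf_ennreal_eq \<phi>_nonneg weight_indicator_integrable Ai wi0)
    qed
  qed (use that sets_\<nu> in auto)
  define R where "R = density lebesgue w"
  have sets_R: "sets R = sets lebesgue" "space R = UNIV" by (auto simp: R_def)
  have em_R: "emeasure R A = ennreal (\<integral>x. ?wi A x \<partial>lebesgue)" if A: "A \<in> sets lebesgue" for A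
  proof -
    have "emeasure R A = (\<integral>\<^sup>+x. ennreal (?wi A x) \<partial>lebesgue)"
      unfolding R_def using A weight_lebesgue
      by (subst emeasure_density) (auto intro!: nn_integral_cong simp: indicator_def)
    also have "\<dots> = ennreal (\<integral>x. ?wi A x \<partial>lebesgue)"
      using wi0 by (intro nn_integral_eq_integral weight_indicator_integrable A) auto
    finally show ?thesis .
  qed
  interpret R: finite_measure R
    by (rule finite_measureI) (use em_R[of UNIV] sets_R in simp)
  have \<nu>_le: "emeasure \<nu> A \<le> emeasure R A" if A: "A \<in> sets lebesgue" for A
  proof -
    have "\<bar>\<phi> (?wi A) - \<phi> (\<lambda>_. 0)\<bar> \<le> (\<integral>x. \<bar>?wi A x - 0\<bar> \<partial>lebesgue)"
      by (intro \<phi>_bound weight_indicator_integrable A) auto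
    then have "\<phi> (?wi A) \<le> (\<integral>x. ?wi A x \<partial>lebesgue)"
      using \<phi>_scale[of "\<lambda>_. 0" 0] wi0[of _ A] by simp
    then show ?thesis unfolding em_\<nu>[OF A] em_R[OF A] by (rule ennreal_leI)
  qed
  have "absolutely_continuous R \<nu>"
    unfolding absolutely_continuous_def
  proof
    fix A assume "A \<in> null_sets R"
    then show "A \<in> null_sets \<nu>"
      using \<nu>_le[of A] sets_\<nu> sets_R by (auto simp: null_sets_def)
  qed
  then obtain f where f[measurable]: "f \<in> borel_measurable R" and f\<nu>: "density R f = \<nu>"
    using R.Radon_Nikodym[of \<nu>] sets_\<nu> sets_R by auto
  \<comment> \<open>On this set the density exceeds 1. As \<nu> A is at most the finite mass of A
    under R, the integral of f - 1 over A vanishes, so f \<le> 1 almost everywhere.\<close>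
  define A where "A = {x. 1 < f x}"
  have AR[measurable]: "A \<in> sets R"
  proof -
    have "{x \<in> space R. 1 < f x} \<in> sets R" by measurable
    then show ?thesis by (simp add: A_def sets_R)
  qed
  have "(\<integral>\<^sup>+x. (f x - 1) * indicator A x \<partial>R) + emeasure R A
      = (\<integral>\<^sup>+x. (f x - 1) * indicator A x + indicator A x \<partial>R)"
    by (subst nn_integral_add) auto
  also have "\<dots> = (\<integral>\<^sup>+x. f x * indicator A x \<partial>R)"
    by (intro nn_integral_cong) (auto simp: A_def indicator_def intro!: diff_add_cancel_ennreal)
  also have "\<dots> = emeasure \<nu> A" using AR f by (simp add: emeasure_density flip: f\<nu>)
  also have "\<dots> \<le> emeasure R A" using AR sets_R by (intro \<nu>_le) auto
  finally have "(\<integral>\<^sup>+x. (f x - 1) * indicator A x \<partial>R) + emeasure R A \<le> 0 + emeasure R A" by simp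
  then have "(\<integral>\<^sup>+x. (f x - 1) * indicator A x \<partial>R) = 0"
    using R.emeasure_finite[of A] ennreal_add_left_cancel_le[of "emeasure R A" _ 0]
    by (simp add: add.commute)
  then have "AE x in R. (f x - 1) * indicator A x = 0"
    by (subst (asm) nn_integral_0_iff_AE) auto
  then have f_le: "AE x in R. f x \<le> 1"
  proof eventually_elim
    case (elim x)
    show ?case
    proof (rule ccontr)
      assume "\<not> f x \<le> 1"
      then have "1 < f x" by simp
      then show False using elim by (auto simp: A_def diff_eq_0_iff_ennreal)
    qed
  qed
  \<comment> \<open>\<open>Sd\<close> asks for values in [0,1] at every point, so the density is cut
    at 1; by \<open>f_le\<close> this alters it only on a null set of R.\<close>
  define h' where "h' x = enn2real (min 1 (f x))" for x
  have h'01: "0 \<le> h' x" "h' x \<le> 1" for x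
    unfolding h'_def by (auto intro: enn2real_leI)
  have h'R: "h' \<in> borel_measurable R" unfolding h'_def by measurable
  then have h'L: "h' \<in> borel_measurable lebesgue" using measurable_cong_sets[OF sets_R(1) refl] by auto
  have h': "h' \<in> Sd" using h'L h'01 by (auto simp: Sd_def)
  have "\<phi> (?wi A) = pairing h' (?wi A)" if A: "A \<in> sets lebesgue" for A
  proof -
    have [measurable]: "A \<in> sets R" using A sets_R by simp
    have "ennreal (\<phi> (?wi A)) = (\<integral>\<^sup>+x. f x * indicator A x \<partial>R)"
      using f by (simp add: emeasure_density em_\<nu>[OF A, symmetric] flip: f\<nu>)
    also have "\<dots> = (\<integral>\<^sup>+x. ennreal (h' x * indicator A x) \<partial>R)"
    proof (rule nn_integral_cong_AE, use f_le in eventually_elim)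
      fix x assume "f x \<le> 1"
      then have "ennreal (h' x) = f x" unfolding h'_def by (simp add: min_absorb2 le_less_trans)
      then show "f x * indicator A x = ennreal (h' x * indicator A x)" by (simp add: indicator_def)
    qed
    also have "\<dots> = (\<integral>\<^sup>+x. ennreal (w x) * ennreal (h' x * indicator A x) \<partial>lebesgue)"
      unfolding R_def using weight_lebesgue h'L A by (subst nn_integral_density) auto
    also have "\<dots> = (\<integral>\<^sup>+x. ennreal (h' x * ?wi A x) \<partial>lebesgue)"
      using h'01 less_imp_le[OF weight_pos]
      by (intro nn_integral_cong) (auto simp: ennreal_mult mult_ac indicator_def)
    also have "\<dots> = ennreal (pairing h' (?wi A))"
      using h'01 wi0 by (intro nn_integral_eq_integral Sd_mult_integrable h' weight_indicator_integrable A) auto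
    finally show ?thesis
      using \<phi>_nonneg[OF weight_indicator_integrable[OF A] wi0] h'01 wi0
      by (subst (asm) ennreal_inj) (auto intro!: integral_nonneg_AE)
  qed
  note base = this
  have "\<phi> g = pairing h' g" if "integrable lebesgue g" for g
    using that
  proof (rule integrable_weighted_induct[where P="\<lambda>g. \<phi> g = pairing h' g"])
    show "\<phi> (\<lambda>x. c * g x) = pairing h' (\<lambda>x. c * g x)" if "integrable lebesgue g" "\<phi> g = pairing h' g" for g c
      using \<phi>_scale[OF that(1)] that(2) by (simp add: mult.left_commute)
    show "\<phi> (\<lambda>x. g x + g' x) = pairing h' (\<lambda>x. g x + g' x)"
      if "integrable lebesgue g" "integrable lebesgue g'" "\<phi> g = pairing h' g" "\<phi> g' = pairing h' g'" for g g'
      using \<phi>_add[OF that(1,2)] that Sd_mult_integrable[OF h'] by (simp add: distrib_left)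
    fix g s assume g: "integrable lebesgue g" and s: "\<And>n::nat. integrable lebesgue (s n)"
      and eq: "\<And>n. \<phi> (s n) = pairing h' (s n)" and lim: "(\<lambda>n. \<integral>x. \<bar>s n x - g x\<bar> \<partial>lebesgue) \<longlonglongrightarrow> 0"
    have l: "(\<lambda>n. \<phi> (s n) - \<phi> g) \<longlonglongrightarrow> 0" "(\<lambda>n. \<phi> (s n) - pairing h' g) \<longlonglongrightarrow> 0"
      using \<phi>_bound[OF s g] pairing_diff_le[OF h' s g]
      by (auto intro!: Lim_null_comparison[OF _ lim] always_eventually simp: eq)
    show "\<phi> g = pairing h' g"
      by (rule LIMSEQ_unique[OF LIM_zero_cancel[OF l(1)] LIM_zero_cancel[OF l(2)]])
  qed (use base in auto)
  then show ?thesis using that[OF h'] \<phi> by simp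
qed

section \<open>The weak-* topology\<close>

lemma
  fixes v :: "'a::euclidean_space"
  shows measurable_translation_lebesgue: "(\<lambda>x. x + v) \<in> lebesgue \<rightarrow>\<^sub>M lebesgue"
    and distr_translation_lebesgue: "distr lebesgue lebesgue (\<lambda>x. x + v) = lebesgue"
proof -
  have T: "(\<lambda>x. v + (\<Sum>j\<in>Basis. (1 * (x \<bullet> j)) *\<^sub>R j)) = (\<lambda>x. x + v)"
    by (simp add: euclidean_representation add.commute)
  show "(\<lambda>x. x + v) \<in> lebesgue \<rightarrow>\<^sub>M lebesgue"
    using lebesgue_affine_measurable[of "\<lambda>_. 1" v] unfolding T by simp
  have "lebesgue = density (distr lebesgue lebesgue (\<lambda>x. x + v)) (\<lambda>_. 1)"
    using lebesgue_affine_euclidean[of "\<lambda>_. 1" v] unfolding T by simp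
  then show "distr lebesgue lebesgue (\<lambda>x. x + v) = lebesgue"
    by (simp add: density_1)
qed

lemma integral_translation_lebesgue:
  fixes f :: "'a::euclidean_space \<Rightarrow> real"
  assumes "f \<in> borel_measurable lebesgue"
  shows "(\<integral>x. f (x + v) \<partial>lebesgue) = (\<integral>x. f x \<partial>lebesgue)"
  using integral_distr[OF measurable_translation_lebesgue[of v] assms, symmetric]
  by (simp only: distr_translation_lebesgue)

lemma integrable_translation_lebesgue:
  fixes f :: "'a::euclidean_space \<Rightarrow> real"
  assumes "integrable lebesgue f"
  shows "integrable lebesgue (\<lambda>x. f (x + v))"
  by (rule integrable_distr[OF measurable_translation_lebesgue[of v], of f])
    (simp only: distr_translation_lebesgue assms)

lemma transl_transl: "transl v (transl w h) = transl (v + w) h"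
  by (simp add: transl_def add_ac)

lemma transl_0: "transl 0 h = h"
  by (simp add: transl_def)

lemma transl_mem_Sd: "h \<in> Sd \<Longrightarrow> transl v h \<in> Sd"
  using measurable_compose[OF measurable_translation_lebesgue[of v], of h borel]
  by (auto simp: Sd_def transl_def)

lemma pairing_transl:
  assumes "h \<in> Sd" "integrable lebesgue g"
  shows "pairing (transl v h) g = pairing h (\<lambda>x. g (x + (- v)))"
proof -
  have "(\<lambda>x. h (x + v) * g x) \<in> borel_measurable lebesgue"
    using Sd_mult_integrable[OF transl_mem_Sd[OF assms(1), of v] assms(2)]
    by (auto simp: transl_def)
  then show ?thesis
    using integral_translation_lebesgue[of "\<lambda>x. h (x + v) * g x" "- v"] by (simp add: transl_def add.assoc)
qed

lemma topspace_Sd_top: "topspace Sd_top = Sd"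
proof -
  have "UNIV \<in> {{f. (\<integral>x. f x * g x \<partial>lebesgue) \<in> U} | g U. integrable lebesgue g \<and> open (U::real set)}"
    by (intro CollectI exI[of _ "\<lambda>_. 0"] exI[of _ UNIV]) auto
  then show ?thesis unfolding Sd_top_def by auto
qed

lemma openin_Sd_top_pairing:
  assumes "integrable lebesgue g" "open U"
  shows "openin Sd_top {h \<in> Sd. pairing h g \<in> U}"
proof -
  have "openin (topology_generated_by
        {{f. (\<integral>x. f x * g x \<partial>lebesgue) \<in> U} | g U. integrable lebesgue g \<and> open (U::real set)})
      {h. pairing h g \<in> U}"
    using assms by (intro topology_generated_by_Basis) blast
  then show ?thesis unfolding Sd_top_def openin_subtopology by blast
qed

lemma continuous_map_pairing:
  assumes "integrable lebesgue g"
  shows "continuous_map Sd_top euclideanreal (\<lambda>h. pairing h g)"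
  unfolding continuous_map_def topspace_Sd_top
  by (simp add: openin_Sd_top_pairing[OF assms])

text \<open>In the pairing, translating h by v amounts to translating g by - v, so preimages of
  subbasic sets are again subbasic.\<close>

lemma continuous_map_transl:
  fixes v :: "'a::euclidean_space"
  shows "continuous_map Sd_top Sd_top (transl v)"
proof -
  let ?S = "{{f. (\<integral>x. f x * g x \<partial>lebesgue) \<in> U} | g U. integrable lebesgue g \<and> open (U::real set)}
    :: ('a \<Rightarrow> real) set set"
  have "continuous_map Sd_top (topology_generated_by ?S) (transl v)"
  proof (rule continuous_on_generated_topo)
    fix W assume "W \<in> ?S"
    then obtain g U where W: "W = {f. pairing f g \<in> U}" "integrable lebesgue g" "open U" by blast
    have "transl v -` W \<inter> topspace Sd_top = {h \<in> Sd. pairing h (\<lambda>x. g (x + (- v))) \<in> U}"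
      using pairing_transl[OF _ W(2)] unfolding topspace_Sd_top W(1) by auto
    then show "openin Sd_top (transl v -` W \<inter> topspace Sd_top)"
      using openin_Sd_top_pairing[OF integrable_translation_lebesgue[OF W(2), of "- v"] W(3)] by simp
  next
    have "UNIV \<in> ?S"
      by (intro CollectI exI[of _ "\<lambda>_. 0"] exI[of _ UNIV]) auto
    then show "transl v ` topspace Sd_top \<subseteq> \<Union>?S" by blast
  qed
  moreover have "transl v \<in> topspace Sd_top \<rightarrow> Sd" by (auto simp: topspace_Sd_top transl_mem_Sd)
  ultimately have "continuous_map Sd_top (subtopology (topology_generated_by ?S) Sd) (transl v)"
    unfolding continuous_map_in_subtopology by blast
  then show ?thesis by (simp only: Sd_top_def)
qed

lemma ex_weak_limit_Sd:
  fixes h :: "nat \<Rightarrow> 'a::euclidean_space \<Rightarrow> real"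
  assumes h: "\<And>k. h k \<in> Sd"
    and conv: "\<And>g. integrable lebesgue g \<Longrightarrow> convergent (\<lambda>k. pairing (h k) g)"
  obtains h' where "h' \<in> Sd" "\<And>g. integrable lebesgue g \<Longrightarrow> (\<lambda>k. pairing (h k) g) \<longlonglongrightarrow> pairing h' g"
proof -
  obtain w :: "'a \<Rightarrow> real" where "w \<in> borel_measurable borel" "\<And>x. 0 < w x" "integrable lebesgue w"
    using ex_integrable_weight by blast
  then interpret weight w by unfold_locales
  show ?thesis using ex_weak_limit[OF h conv] that by blast
qed

section \<open>Coordinates in the space of real sequences\<close>

locale weak_star_coordinates =
  fixes e :: "nat \<Rightarrow> 'a::euclidean_space \<Rightarrow> real"
  assumes e_integrable: "\<And>n. integrable lebesgue (e n)"
    and e_controls: "\<And>g. integrable lebesgue g \<Longrightarrow> controlled_by e g"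
begin

definition coords :: "('a \<Rightarrow> real) \<Rightarrow> nat \<Rightarrow> real" where
  "coords h = (\<lambda>n. pairing h (e n))"

lemma continuous_map_coords: "continuous_map Sd_top euclidean coords"
  unfolding euclidean_product_topology[symmetric] continuous_map_componentwise_UNIV coords_def
  by (intro allI continuous_map_pairing e_integrable)

text \<open>Although \<open>coords\<close> merges functions equal a.e., it loses no open set: around
  each point of a subbasic set, control by the e n yields a cylinder over finitely many coordinates
  that stays inside the set.\<close>

lemma openin_pullback:
  assumes "openin Sd_top W"
  obtains Q where "open Q" "W = {h \<in> Sd. coords h \<in> Q}"
proof -
  let ?S = "{{f. (\<integral>x. f x * g x \<partial>lebesgue) \<in> U} | g U. integrable lebesgue g \<and> open (U::real set)}
    :: ('a \<Rightarrow> real) set set"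
  obtain T where T: "openin (topology_generated_by ?S) T" "W = T \<inter> Sd"
    using assms unfolding Sd_top_def openin_subtopology by blast
  from T(1) have "generate_topology_on ?S T" by (rule openin_topology_generated_by)
  then have "\<exists>Q. open Q \<and> T \<inter> Sd = {h \<in> Sd. coords h \<in> Q}"
  proof induction
    case Empty
    then show ?case by (intro exI[of _ "{}"]) auto
  next
    case (Int a b)
    then obtain Q Q' where "open Q" "a \<inter> Sd = {h \<in> Sd. coords h \<in> Q}"
      "open Q'" "b \<inter> Sd = {h \<in> Sd. coords h \<in> Q'}" by blast
    then show ?case by (intro exI[of _ "Q \<inter> Q'"]) auto
  next
    case (UN K)
    then obtain Q where Q: "\<And>k. k \<in> K \<Longrightarrow> open (Q k) \<and> k \<inter> Sd = {h \<in> Sd. coords h \<in> Q k}" by metis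
    then have "\<Union>K \<inter> Sd = {h \<in> Sd. coords h \<in> (\<Union>k\<in>K. Q k)}" by blast
    then show ?case using Q by (intro exI[of _ "\<Union>k\<in>K. Q k"]) auto
  next
    case (Basis s)
    then obtain g U where s: "s = {f. pairing f g \<in> U}" "integrable lebesgue g" "open U" by blast
    define Q where "Q = \<Union>{Q'. open Q' \<and> (\<forall>h'\<in>Sd. coords h' \<in> Q' \<longrightarrow> pairing h' g \<in> U)}"
    have "coords h \<in> Q" if h: "h \<in> Sd" "pairing h g \<in> U" for h
    proof -
      obtain \<epsilon> where \<epsilon>: "0 < \<epsilon>" "\<And>y. \<bar>y - pairing h g\<bar> < \<epsilon> \<Longrightarrow> y \<in> U"
        using s(3) h(2) unfolding open_real by blast
      obtain n \<delta> where n: "0 < \<delta>" "\<And>h h'. h \<in> Sd \<Longrightarrow> h' \<in> Sd \<Longrightarrow>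
          (\<forall>i<n. \<bar>pairing h (e i) - pairing h' (e i)\<bar> < \<delta>) \<Longrightarrow> \<bar>pairing h g - pairing h' g\<bar> < \<epsilon>"
        by (rule controlled_byE[OF e_controls[OF s(2)] \<epsilon>(1)]) (rule that)
      define Q' where "Q' = (\<Inter>i<n. {y :: nat \<Rightarrow> real. \<bar>y i - pairing h (e i)\<bar> < \<delta>})"
      have "open Q'"
        unfolding Q'_def
        by (intro open_INT ballI open_Collect_less continuous_intros continuous_on_product_coordinates) auto
      moreover have "pairing h' g \<in> U" if "h' \<in> Sd" "coords h' \<in> Q'" for h'
        using that h n(2)[of h' h] by (intro \<epsilon>(2)) (auto simp: Q'_def coords_def)
      moreover have "coords h \<in> Q'" using n(1) by (auto simp: Q'_def coords_def)
      ultimately show ?thesis unfolding Q_def by blast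
    qed
    moreover have "open Q" unfolding Q_def by blast
    moreover have "pairing h g \<in> U" if "h \<in> Sd" "coords h \<in> Q" for h
      using that unfolding Q_def by blast
    ultimately show ?case unfolding s(1) by (intro exI[of _ Q]) blast
  qed
  then show ?thesis using T that by blast
qed

text \<open>Convergence of all coordinates makes every pairing Cauchy by control, and
  \<open>ex_weak_limit_Sd\<close> then provides a preimage of the limit.\<close>

lemma closed_coords_image: "closed (coords ` Sd)"
  unfolding closed_sequential_limits
proof (intro allI impI, elim conjE)
  fix y :: "nat \<Rightarrow> nat \<Rightarrow> real" and l
  assume y: "\<forall>k. y k \<in> coords ` Sd" and l: "y \<longlonglongrightarrow> l"
  then obtain h where h: "\<And>k. h k \<in> Sd" "\<And>k. y k = coords (h k)"
    unfolding image_iff by metis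
  have coord: "(\<lambda>k. pairing (h k) (e i)) \<longlonglongrightarrow> l i" for i
    using continuous_on_tendsto_compose[OF continuous_on_product_coordinates l]
    by (auto simp: h(2) coords_def)
  have "convergent (\<lambda>k. pairing (h k) g)" if g: "integrable lebesgue g" for g
  proof (rule Cauchy_convergent, rule CauchyI)
    fix \<epsilon> :: real assume \<epsilon>: "0 < \<epsilon>"
    obtain n \<delta> where n: "0 < \<delta>" "\<And>h h'. h \<in> Sd \<Longrightarrow> h' \<in> Sd \<Longrightarrow>
        (\<forall>i<n. \<bar>pairing h (e i) - pairing h' (e i)\<bar> < \<delta>) \<Longrightarrow> \<bar>pairing h g - pairing h' g\<bar> < \<epsilon>"
      by (rule controlled_byE[OF e_controls[OF g] \<epsilon>]) (rule that)
    have "eventually (\<lambda>k. \<forall>i<n. \<bar>pairing (h k) (e i) - l i\<bar> < \<delta> / 2) sequentially"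
    proof -
      have "eventually (\<lambda>k. \<bar>pairing (h k) (e i) - l i\<bar> < \<delta> / 2) sequentially" for i
        using tendstoD[OF coord[of i], of "\<delta> / 2"] n(1) by (simp add: dist_real_def)
      then have "eventually (\<lambda>k. \<forall>i\<in>{..<n}. \<bar>pairing (h k) (e i) - l i\<bar> < \<delta> / 2) sequentially"
        by (intro eventually_ball_finite) auto
      then show ?thesis by (simp only: lessThan_iff Ball_def)
    qed
    then obtain K where K: "\<And>k i. K \<le> k \<Longrightarrow> i < n \<Longrightarrow> \<bar>pairing (h k) (e i) - l i\<bar> < \<delta> / 2"
      unfolding eventually_sequentially by blast
    have "\<bar>pairing (h k) g - pairing (h k') g\<bar> < \<epsilon>" if k: "K \<le> k" "K \<le> k'" for k k'
    proof (rule n(2)[OF h(1) h(1)], intro allI impI)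
      fix i assume "i < n"
      then show "\<bar>pairing (h k) (e i) - pairing (h k') (e i)\<bar> < \<delta>"
        using K[OF k(1), of i] K[OF k(2), of i] unfolding abs_less_iff by linarith
    qed
    then show "\<exists>M. \<forall>m\<ge>M. \<forall>n\<ge>M. norm (pairing (h m) g - pairing (h n) g) < \<epsilon>"
      by (intro exI[of _ K]) simp
  qed
  then obtain h' where h': "h' \<in> Sd" "\<And>g. integrable lebesgue g \<Longrightarrow> (\<lambda>k. pairing (h k) g) \<longlonglongrightarrow> pairing h' g"
    using ex_weak_limit_Sd[of h] h(1) by blast
  have "l = coords h'"
    unfolding coords_def using LIMSEQ_unique[OF coord h'(2)[OF e_integrable]] by auto
  then show "l \<in> coords ` Sd" using h'(1) by blast
qed

text \<open>Banach-Alaoglu in coordinates: the image is a closed subset of a product of intervals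
  whose half-lengths are the L1 norms of the e i.\<close>

lemma compact_coords_image: "compact (coords ` Sd)"
proof -
  let ?b = "\<lambda>i. \<integral>x. \<bar>e i x\<bar> \<partial>lebesgue"
  let ?P = "PiE UNIV (\<lambda>i. {- ?b i..?b i})"
  have "compactin (product_topology (\<lambda>i::nat. euclideanreal) UNIV) ?P"
    by (subst compactin_PiE) auto
  then have "compact ?P" by (simp add: euclidean_product_topology)
  moreover have "coords ` Sd \<subseteq> ?P"
  proof
    fix y assume "y \<in> coords ` Sd"
    then obtain h where h: "h \<in> Sd" "y = coords h" by blast
    have "\<bar>y i\<bar> \<le> ?b i" for i unfolding h(2) coords_def by (rule pairing_abs_le[OF h(1) e_integrable])
    then show "y \<in> ?P" by (auto simp: abs_le_iff minus_le_iff)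
  qed
  ultimately show ?thesis
    using compact_Int_closed[OF _ closed_coords_image, of ?P] by (simp add: inf.absorb2)
qed

lemma compact_space_Sd_top_coords: "compact_space (Sd_top :: ('a \<Rightarrow> real) topology)"
  unfolding compact_space_def compactin_def topspace_Sd_top
proof (intro conjI allI impI subset_refl, elim conjE)
  fix \<U> :: "('a \<Rightarrow> real) set set" assume op: "\<forall>U\<in>\<U>. openin Sd_top U" and cov: "Sd \<subseteq> \<Union>\<U>"
  obtain Q where Q: "\<And>U. U \<in> \<U> \<Longrightarrow> open (Q U) \<and> U = {h \<in> Sd. coords h \<in> Q U}"
  proof -
    have "\<exists>Q. open Q \<and> U = {h \<in> Sd. coords h \<in> Q}" if "U \<in> \<U>" for U
      using openin_pullback[of U] op that by blast
    then show ?thesis using that by metis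
  qed
  have "coords ` Sd \<subseteq> (\<Union>U\<in>\<U>. Q U)"
    using cov Q by blast
  then obtain \<F> where "\<F> \<subseteq> \<U>" "finite \<F>" "coords ` Sd \<subseteq> (\<Union>U\<in>\<F>. Q U)"
    using compactE_image[OF compact_coords_image, of \<U> Q] Q by blast
  then show "\<exists>\<F>. finite \<F> \<and> \<F> \<subseteq> \<U> \<and> Sd \<subseteq> \<Union>\<F>"
    using Q by (intro exI[of _ \<F>]) blast
qed

text \<open>The distance to the complement, taken in the metrisable sequence space and pulled back
  along \<open>coords\<close>.\<close>

lemma open_as_positive_set_coords:
  fixes W :: "('a \<Rightarrow> real) set"
  assumes "openin Sd_top W"
  obtains F where "continuous_map Sd_top euclideanreal F" "\<And>h. 0 \<le> F h"
    "\<And>h. h \<in> Sd \<Longrightarrow> 0 < F h \<longleftrightarrow> h \<in> W"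
proof -
  obtain Q where Q: "open Q" "W = {h \<in> Sd. coords h \<in> Q}" using openin_pullback[OF assms] .
  show ?thesis
  \<comment> \<open>\<open>infdist\<close> to the empty set is 0 by convention, so the full space is
    treated separately.\<close>
  proof (cases "- Q = {}")
    case True
    then show ?thesis using Q by (intro that[of "\<lambda>_. 1"]) auto
  next
    case False
    have "continuous_map euclidean euclideanreal (\<lambda>y. infdist y (- Q))"
      by (simp add: continuous_on_infdist continuous_on_id)
    from continuous_map_compose[OF continuous_map_coords this]
    have "continuous_map Sd_top euclideanreal (\<lambda>h. infdist (coords h) (- Q))" by (simp add: o_def)
    moreover have "0 < infdist y (- Q) \<longleftrightarrow> y \<in> Q" for y
      using in_closed_iff_infdist_zero[of "- Q" y] False Q(1) infdist_nonneg[of y "- Q"]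
      by (auto simp: less_le)
    ultimately show ?thesis using Q(2) by (intro that) (auto simp: infdist_nonneg)
  qed
qed

end

lemma ex_weak_star_coordinates: "\<exists>e. weak_star_coordinates (e :: nat \<Rightarrow> 'a::euclidean_space \<Rightarrow> real)"
proof -
  obtain w :: "'a \<Rightarrow> real" where "w \<in> borel_measurable borel" "\<And>x. 0 < w x" "integrable lebesgue w"
    using ex_integrable_weight by blast
  then interpret weight w by unfold_locales
  obtain e :: "nat \<Rightarrow> 'a \<Rightarrow> real" where "\<And>n. integrable lebesgue (e n)" "\<And>g. integrable lebesgue g \<Longrightarrow> controlled_by e g"
    by (rule ex_controlling_sequence) (rule that)
  then show ?thesis unfolding weak_star_coordinates_def by blast
qed

lemma compact_space_Sd_top: "compact_space (Sd_top :: ('a::euclidean_space \<Rightarrow> real) topology)"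
  using ex_weak_star_coordinates weak_star_coordinates.compact_space_Sd_top_coords by blast

lemma open_as_positive_set:
  fixes W :: "('a::euclidean_space \<Rightarrow> real) set"
  assumes "openin Sd_top W"
  obtains F where "continuous_map Sd_top euclideanreal F" "\<And>h. 0 \<le> F h"
    "\<And>h. h \<in> Sd \<Longrightarrow> 0 < F h \<longleftrightarrow> h \<in> W"
  using ex_weak_star_coordinates weak_star_coordinates.open_as_positive_set_coords[OF _ assms] by blast

section \<open>Continuous functions and translation averages\<close>

definition Sd_continuous :: "(('a::euclidean_space \<Rightarrow> real) \<Rightarrow> real) set" where
  "Sd_continuous = {F. continuous_map Sd_top euclideanreal F}"

interpretation Sd_continuous: function_space "Sd_continuous :: (('a::euclidean_space \<Rightarrow> real) \<Rightarrow> real) set"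
  by unfold_locales (auto simp: Sd_continuous_def intro: continuous_map_add continuous_map_real_mult_left)

lemma Sd_continuous_const: "(\<lambda>_. c) \<in> Sd_continuous"
  by (simp add: Sd_continuous_def)

lemma Sd_continuous_max: "F \<in> Sd_continuous \<Longrightarrow> G \<in> Sd_continuous \<Longrightarrow> (\<lambda>h. max (F h) (G h)) \<in> Sd_continuous"
  and Sd_continuous_min: "F \<in> Sd_continuous \<Longrightarrow> G \<in> Sd_continuous \<Longrightarrow> (\<lambda>h. min (F h) (G h)) \<in> Sd_continuous"
  by (auto simp: Sd_continuous_def intro: continuous_map_real_max continuous_map_real_min)

lemma Sd_continuous_transl: "F \<in> Sd_continuous \<Longrightarrow> (\<lambda>h. F (transl v h)) \<in> Sd_continuous"
  using continuous_map_compose[OF continuous_map_transl[of v], of euclideanreal F]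
  by (simp add: Sd_continuous_def o_def)

lemma Sd_continuous_bounded:
  fixes F :: "('a::euclidean_space \<Rightarrow> real) \<Rightarrow> real"
  assumes "F \<in> Sd_continuous"
  shows "\<exists>B. \<forall>h\<in>Sd. \<bar>F h\<bar> \<le> B"
proof -
  have "compactin euclideanreal (F ` topspace Sd_top)"
    using compact_space_Sd_top assms unfolding compact_space_def Sd_continuous_def
    by (intro image_compactin) auto
  then have "bounded (F ` Sd)" by (simp add: topspace_Sd_top compact_imp_bounded)
  then show ?thesis by (auto simp: bounded_iff)
qed

text \<open>The open sets on which Fs n is below \<epsilon> increase with n and cover the compact
  \<open>Sd\<close>, so one of them is everything.\<close>

lemma Sd_continuous_Dini:
  fixes Fs :: "nat \<Rightarrow> ('a::euclidean_space \<Rightarrow> real) \<Rightarrow> real"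
  assumes F: "\<And>n. Fs n \<in> Sd_continuous" and dec: "\<And>n h. h \<in> Sd \<Longrightarrow> Fs (Suc n) h \<le> Fs n h"
    and lim: "\<And>h. h \<in> Sd \<Longrightarrow> (\<lambda>n. Fs n h) \<longlonglongrightarrow> 0" and \<epsilon>: "0 < \<epsilon>"
  shows "\<exists>N. \<forall>n\<ge>N. \<forall>h\<in>Sd. Fs n h < \<epsilon>"
proof -
  define U where "U n = {h \<in> Sd. Fs n h < \<epsilon>}" for n
  have op: "openin Sd_top (U n)" for n
    using openin_continuous_map_preimage[of Sd_top euclideanreal "Fs n" "{..<\<epsilon>}"] F[of n]
    by (simp add: Sd_continuous_def topspace_Sd_top U_def)
  have decN: "Fs m h \<le> Fs n h" if "n \<le> m" "h \<in> Sd" for m n h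
    using that(1) by (rule lift_Suc_antimono_le[rotated]) (rule dec[OF that(2)])
  have "Sd \<subseteq> \<Union>(range U)"
  proof
    fix h :: "'a \<Rightarrow> real" assume h: "h \<in> Sd"
    then obtain n where "\<bar>Fs n h\<bar> < \<epsilon>" using LIMSEQ_D[OF lim[OF h] \<epsilon>] by auto
    then have "h \<in> U n" using h by (simp add: U_def)
    then show "h \<in> \<Union>(range U)" by blast
  qed
  then have "(\<forall>x\<in>range U. openin Sd_top x) \<and> Sd \<subseteq> \<Union>(range U)" using op by simp
  moreover have "\<forall>\<U>. (\<forall>x\<in>\<U>. openin (Sd_top :: ('a \<Rightarrow> real) topology) x) \<and> Sd \<subseteq> \<Union>\<U>
      \<longrightarrow> (\<exists>\<F>. finite \<F> \<and> \<F> \<subseteq> \<U> \<and> Sd \<subseteq> \<Union>\<F>)"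
    using compact_space_Sd_top unfolding compact_space_def compactin_def topspace_Sd_top by (rule conjunct2)
  ultimately have "\<exists>\<F>. finite \<F> \<and> \<F> \<subseteq> range U \<and> Sd \<subseteq> \<Union>\<F>" by (elim allE[of _ "range U"] impE)
  then obtain \<F> where \<F>: "finite \<F>" "\<F> \<subseteq> range U" "Sd \<subseteq> \<Union>\<F>" by blast
  obtain I where I: "finite I" "\<F> = U ` I" using finite_subset_image[OF \<F>(1,2)] by auto
  have "Fs n h < \<epsilon>" if n: "Max (insert 0 I) \<le> n" and h: "h \<in> Sd" for n h
  proof -
    obtain i where i: "i \<in> I" "h \<in> U i" using \<F>(3) h I(2) by blast
    have "i \<le> n" using n I(1) i(1) by auto
    then have "Fs n h \<le> Fs i h" using decN h by blast
    then show ?thesis using i(2) by (auto simp: U_def)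
  qed
  then show ?thesis by blast
qed

section \<open>Borel sets of \<open>Sd\<close>\<close>

lemma positive_sets_eq_open_sets:
  "{{h \<in> Sd. 0 < F h} | F. F \<in> Sd_continuous} = {U :: ('a::euclidean_space \<Rightarrow> real) set. openin Sd_top U}"
proof (intro subset_antisym subsetI)
  fix U :: "('a \<Rightarrow> real) set" assume "U \<in> {{h \<in> Sd. 0 < F h} | F. F \<in> Sd_continuous}"
  then obtain F where "F \<in> Sd_continuous" "U = {h \<in> Sd. 0 < F h}" by blast
  then show "U \<in> {U. openin Sd_top U}"
    using openin_continuous_map_preimage[of Sd_top euclideanreal F "{0<..}"]
    by (simp add: Sd_continuous_def topspace_Sd_top)
next
  fix U :: "('a \<Rightarrow> real) set" assume "U \<in> {U. openin Sd_top U}"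
  then have U: "openin Sd_top U" by simp
  obtain F where F: "continuous_map Sd_top euclideanreal F" "\<And>h. h \<in> Sd \<Longrightarrow> 0 < F h \<longleftrightarrow> h \<in> U"
    using open_as_positive_set[OF U] by metis
  have "U \<subseteq> Sd" using openin_subset[OF U] by (simp add: topspace_Sd_top)
  then have "U = {h \<in> Sd. 0 < F h}" using F(2) by auto
  then show "U \<in> {{h \<in> Sd. 0 < F h} | F. F \<in> Sd_continuous}"
    using F(1) unfolding Sd_continuous_def by blast
qed

lemma open_subset_Pow_Sd: "{U. openin Sd_top U} \<subseteq> Pow Sd"
  using openin_subset[of Sd_top] by (auto simp: topspace_Sd_top)

lemma space_Sd_borel: "space Sd_borel = Sd"
  unfolding Sd_borel_def by (rule space_measure_of[OF open_subset_Pow_Sd])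

lemma sets_Sd_borel: "sets Sd_borel = sigma_sets Sd {U. openin Sd_top U}"
  unfolding Sd_borel_def by (rule sets_measure_of[OF open_subset_Pow_Sd])

lemma open_in_Sd_borel: "openin Sd_top U \<Longrightarrow> U \<in> sets Sd_borel"
  unfolding sets_Sd_borel by (rule sigma_sets.Basic) simp

lemma closed_in_Sd_borel: assumes "closedin Sd_top C" shows "C \<in> sets Sd_borel"
proof -
  have "Sd - C \<in> sets Sd_borel"
    using assms by (intro open_in_Sd_borel) (simp add: closedin_def topspace_Sd_top)
  then have "Sd - (Sd - C) \<in> sets Sd_borel" using sets.compl_sets[of "Sd - C" Sd_borel] by (simp add: space_Sd_borel)
  moreover have "Sd - (Sd - C) = C" using closedin_subset[OF assms] by (auto simp: topspace_Sd_top)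
  ultimately show ?thesis by simp
qed

lemma Sd_continuous_measurable: "F \<in> Sd_continuous \<Longrightarrow> F \<in> borel_measurable Sd_borel"
proof (rule borel_measurableI)
  fix S :: "real set" assume "F \<in> Sd_continuous" "open S"
  then have "openin Sd_top {h \<in> topspace Sd_top. F h \<in> S}"
    unfolding Sd_continuous_def by (intro openin_continuous_map_preimage[of _ euclideanreal]) auto
  moreover have "{h \<in> topspace Sd_top. F h \<in> S} = F -` S \<inter> space Sd_borel"
    by (auto simp: space_Sd_borel topspace_Sd_top)
  ultimately show "F -` S \<inter> space Sd_borel \<in> sets Sd_borel"
    by (metis open_in_Sd_borel)
qed

lemma transl_measurable: "transl v \<in> measurable Sd_borel Sd_borel"
  unfolding Sd_borel_def
proof (rule measurable_measure_of[OF open_subset_Pow_Sd], unfold Sd_borel_def[symmetric])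
  show "transl v \<in> space Sd_borel \<rightarrow> Sd" by (simp add: space_Sd_borel transl_mem_Sd)
  fix U :: "('a \<Rightarrow> real) set" assume "U \<in> {U. openin Sd_top U}"
  then have "openin Sd_top {h \<in> topspace Sd_top. transl v h \<in> U}"
    by (intro openin_continuous_map_preimage[OF continuous_map_transl]) simp
  moreover have "{h \<in> topspace Sd_top. transl v h \<in> U} = transl v -` U \<inter> space Sd_borel"
    by (auto simp: space_Sd_borel topspace_Sd_top)
  ultimately show "transl v -` U \<inter> space Sd_borel \<in> sets Sd_borel" by (metis open_in_Sd_borel)
qed

lemma closedin_orbit_closure: "closedin Sd_top (orbit_closure f)"
  by (simp add: orbit_closure_def)

lemma le_on_orbit_closure:
  fixes F :: "('a::euclidean_space \<Rightarrow> real) \<Rightarrow> real"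
  assumes F: "F \<in> Sd_continuous" and f: "f \<in> Sd" and le: "\<And>w. F (transl w f) \<le> c" and h: "h \<in> orbit_closure f"
  shows "F h \<le> c"
proof -
  have "closedin Sd_top {h \<in> topspace Sd_top. F h \<in> {..c}}"
    using F unfolding Sd_continuous_def by (intro closedin_continuous_map_preimage[of _ euclideanreal]) auto
  then have "orbit_closure f \<subseteq> {h \<in> topspace Sd_top. F h \<in> {..c}}"
    unfolding orbit_closure_def using le f
    by (intro closure_of_minimal) (auto simp: topspace_Sd_top transl_mem_Sd)
  then show ?thesis using h by auto
qed

section \<open>Finite averages over translations\<close>

definition orbit_avg :: "'a::euclidean_space list \<Rightarrow> (('a \<Rightarrow> real) \<Rightarrow> real) \<Rightarrow> ('a \<Rightarrow> real) \<Rightarrow> real" where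
  "orbit_avg vs F h = (\<Sum>v\<leftarrow>vs. F (transl v h)) / real (length vs)"

lemma sum_list_mem:
  assumes "\<And>v. v \<in> set vs \<Longrightarrow> Fs v \<in> Sd_continuous"
  shows "(\<lambda>h. \<Sum>v\<leftarrow>vs. Fs v h) \<in> Sd_continuous"
  using assms by (induction vs) (auto intro: Sd_continuous_const Sd_continuous.add_mem)

lemma orbit_avg_mem: "F \<in> Sd_continuous \<Longrightarrow> orbit_avg vs F \<in> Sd_continuous"
  using Sd_continuous.scale_mem[OF sum_list_mem[of vs "\<lambda>v h. F (transl v h)"], of "1 / real (length vs)"]
  by (simp add: orbit_avg_def[abs_def] Sd_continuous_transl)

lemma orbit_avg_add: "orbit_avg vs (\<lambda>h. F h + G h) h = orbit_avg vs F h + orbit_avg vs G h"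
  by (simp add: orbit_avg_def sum_list_addf add_divide_distrib)

lemma orbit_avg_scale: "orbit_avg vs (\<lambda>h. c * F h) h = c * orbit_avg vs F h"
  by (simp add: orbit_avg_def sum_list_const_mult)

lemma sum_list_le_const:
  fixes g :: "'b \<Rightarrow> real"
  shows "(\<And>v. v \<in> set vs \<Longrightarrow> g v \<le> c) \<Longrightarrow> (\<Sum>v\<leftarrow>vs. g v) \<le> real (length vs) * c"
  by (induction vs) (auto simp: distrib_right intro: add_mono)

lemma orbit_avg_le: "vs \<noteq> [] \<Longrightarrow> (\<And>v. v \<in> set vs \<Longrightarrow> F (transl v h) \<le> c) \<Longrightarrow> orbit_avg vs F h \<le> c"
  using sum_list_le_const[of vs "\<lambda>v. F (transl v h)" c]
  by (simp add: orbit_avg_def divide_le_eq mult.commute)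

lemma orbit_avg_ge: "vs \<noteq> [] \<Longrightarrow> (\<And>v. v \<in> set vs \<Longrightarrow> c \<le> F (transl v h)) \<Longrightarrow> c \<le> orbit_avg vs F h"
  using orbit_avg_le[of vs "\<lambda>h. (-1) * F h" h "- c"] unfolding orbit_avg_scale by simp

text \<open>A list keeps multiplicities where v + w coincide for different pairs, so averages
  compose exactly in \<open>orbit_avg_minkowski\<close>.\<close>

definition minkowski_list :: "'a::plus list \<Rightarrow> 'a list \<Rightarrow> 'a list" where
  "minkowski_list vs ws = concat (map (\<lambda>v. map (\<lambda>w. v + w) ws) vs)"

lemma minkowski_list_sum: "(\<Sum>u\<leftarrow>minkowski_list vs ws. g u) = (\<Sum>v\<leftarrow>vs. \<Sum>w\<leftarrow>ws. g (v + w))"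
  by (induction vs) (simp_all add: minkowski_list_def o_def)

lemma minkowski_list_length: "length (minkowski_list vs ws) = length vs * length ws"
  by (induction vs) (simp_all add: minkowski_list_def)

lemma minkowski_list_ne: "vs \<noteq> [] \<Longrightarrow> ws \<noteq> [] \<Longrightarrow> minkowski_list vs ws \<noteq> []"
  using minkowski_list_length[of vs ws] by auto

lemma sum_list_divide:
  fixes g :: "'b \<Rightarrow> real"
  shows "(\<Sum>v\<leftarrow>vs. g v / c) = (\<Sum>v\<leftarrow>vs. g v) / c"
  by (induction vs) (simp_all add: add_divide_distrib)

lemma sum_list_swap:
  fixes g :: "'b \<Rightarrow> 'c \<Rightarrow> real"
  shows "(\<Sum>v\<leftarrow>vs. \<Sum>w\<leftarrow>ws. g v w) = (\<Sum>w\<leftarrow>ws. \<Sum>v\<leftarrow>vs. g v w)"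
  by (induction vs) (simp_all add: sum_list_addf)

lemma orbit_avg_minkowski: "orbit_avg (minkowski_list vs ws) F h = orbit_avg vs (orbit_avg ws F) h"
  by (simp add: orbit_avg_def minkowski_list_sum minkowski_list_length transl_transl add.commute
      sum_list_divide divide_divide_eq_left mult.commute cong: map_cong)

lemma orbit_avg_commute: "orbit_avg vs (orbit_avg ws F) h = orbit_avg ws (orbit_avg vs F) h"
proof -
  have "(\<Sum>v\<leftarrow>vs. \<Sum>w\<leftarrow>ws. F (transl (v + w) h)) = (\<Sum>w\<leftarrow>ws. \<Sum>v\<leftarrow>vs. F (transl (w + v) h))"
    by (subst sum_list_swap) (simp add: add.commute)
  then show ?thesis
    by (simp add: orbit_avg_minkowski[symmetric]) (simp add: orbit_avg_def minkowski_list_sum minkowski_list_length mult.commute)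
qed

section \<open>The upper mean of an orbit\<close>

locale orbit =
  fixes f :: "'a::euclidean_space \<Rightarrow> real"
  assumes f_mem: "f \<in> Sd"
begin

text \<open>Since translations commute, averages over two lists can be combined (\<open>orbit_avg_commute\<close>);
  this is what makes the infimum subadditive.\<close>

definition upper_mean :: "(('a \<Rightarrow> real) \<Rightarrow> real) \<Rightarrow> real" where
  "upper_mean F = (INF vs\<in>{vs. vs \<noteq> []}. SUP w. orbit_avg vs F (transl w f))"

lemma transl_f_mem: "transl w f \<in> Sd"
  by (rule transl_mem_Sd[OF f_mem])

lemma orbit_avg_bounds:
  fixes F :: "('a \<Rightarrow> real) \<Rightarrow> real"
  assumes F: "F \<in> Sd_continuous"
  obtains B where "0 \<le> B" "\<And>vs h. vs \<noteq> [] \<Longrightarrow> h \<in> Sd \<Longrightarrow> \<bar>orbit_avg vs F h\<bar> \<le> B"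
proof -
  obtain B where B: "\<And>h. h \<in> Sd \<Longrightarrow> \<bar>F h\<bar> \<le> B" using Sd_continuous_bounded[OF F] by blast
  have "\<bar>orbit_avg vs F h\<bar> \<le> B" if "vs \<noteq> []" "h \<in> Sd" for vs h
  proof -
    have "\<bar>F (transl v h)\<bar> \<le> B" for v using B transl_mem_Sd[OF that(2)] by blast
    then have "orbit_avg vs F h \<le> B" "- B \<le> orbit_avg vs F h"
      using that(1) by (auto intro!: orbit_avg_le orbit_avg_ge simp: abs_le_iff minus_le_iff)
    then show ?thesis by simp
  qed
  moreover have "0 \<le> B" using B[OF f_mem] by simp
  ultimately show ?thesis using that by blast
qed

lemma bdd_above_orbit: "F \<in> Sd_continuous \<Longrightarrow> vs \<noteq> [] \<Longrightarrow> bdd_above (range (\<lambda>w. orbit_avg vs F (transl w f)))"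
  by (elim orbit_avg_bounds) (force intro!: bdd_aboveI2 transl_f_mem dest!: abs_le_D1)

lemma upper_mean_le:
  assumes F: "F \<in> Sd_continuous" and vs: "vs \<noteq> []" and le: "\<And>w. orbit_avg vs F (transl w f) \<le> c"
  shows "upper_mean F \<le> c"
proof -
  obtain B where B: "\<And>vs h. vs \<noteq> [] \<Longrightarrow> h \<in> Sd \<Longrightarrow> \<bar>orbit_avg vs F h\<bar> \<le> B"
    using orbit_avg_bounds[OF F] by metis
  have "bdd_below ((\<lambda>vs. SUP w. orbit_avg vs F (transl w f)) ` {vs. vs \<noteq> []})"
  proof (rule bdd_belowI2)
    fix vs :: "'a list" assume "vs \<in> {vs. vs \<noteq> []}"
    then have vs: "vs \<noteq> []" by simp
    have "- B \<le> orbit_avg vs F (transl 0 f)" using B[OF vs transl_f_mem, of 0] by simp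
    also have "\<dots> \<le> (SUP w. orbit_avg vs F (transl w f))"
      by (rule cSUP_upper[OF UNIV_I bdd_above_orbit[OF F vs]])
    finally show "- B \<le> (SUP w. orbit_avg vs F (transl w f))" .
  qed
  then have "upper_mean F \<le> (SUP w. orbit_avg vs F (transl w f))"
    unfolding upper_mean_def using vs by (intro cINF_lower) auto
  also have "\<dots> \<le> c" using le by (intro cSUP_least) auto
  finally show ?thesis .
qed

lemma upper_mean_less:
  assumes F: "F \<in> Sd_continuous" and c: "upper_mean F < c"
  obtains vs where "vs \<noteq> []" "\<And>w. orbit_avg vs F (transl w f) \<le> c"
proof -
  have "\<exists>vs\<in>{vs. vs \<noteq> []}. (SUP w. orbit_avg vs F (transl w f)) < c"
  proof (rule ccontr)
    assume "\<not> ?thesis"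
    then have "c \<le> upper_mean F"
      unfolding upper_mean_def by (intro cINF_greatest) (auto simp: not_less intro: exI[of _ "[0]"])
    then show False using c by simp
  qed
  then obtain vs where vs: "vs \<noteq> []" "(SUP w. orbit_avg vs F (transl w f)) < c" by blast
  have "orbit_avg vs F (transl w f) \<le> c" for w
    using cSUP_upper[OF UNIV_I bdd_above_orbit[OF F vs(1)], of w] vs(2) by simp
  then show ?thesis using that vs(1) by blast
qed

lemma upper_mean_le_sup:
  assumes "F \<in> Sd_continuous" "\<And>w. F (transl w f) \<le> c"
  shows "upper_mean F \<le> c"
  using upper_mean_le[OF assms(1), of "[0]" c] assms(2) by (simp add: orbit_avg_def transl_0)

lemma sublinear_upper_mean: "sublinear_on Sd_continuous upper_mean"
  unfolding sublinear_on_def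
proof (intro conjI ballI allI impI)
  fix F G :: "('a \<Rightarrow> real) \<Rightarrow> real" assume FG: "F \<in> Sd_continuous" "G \<in> Sd_continuous"
  show "upper_mean (\<lambda>h. F h + G h) \<le> upper_mean F + upper_mean G"
  proof (rule field_le_epsilon)
    fix \<epsilon> :: real assume \<epsilon>: "0 < \<epsilon>"
    obtain vs where vs: "vs \<noteq> []" "\<And>w. orbit_avg vs F (transl w f) \<le> upper_mean F + \<epsilon> / 2"
      using upper_mean_less[OF FG(1), of "upper_mean F + \<epsilon> / 2"] \<epsilon> by (metis half_gt_zero less_add_same_cancel1)
    obtain ws where ws: "ws \<noteq> []" "\<And>w. orbit_avg ws G (transl w f) \<le> upper_mean G + \<epsilon> / 2"
      using upper_mean_less[OF FG(2), of "upper_mean G + \<epsilon> / 2"] \<epsilon> by (metis half_gt_zero less_add_same_cancel1)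
    have "upper_mean (\<lambda>h. F h + G h) \<le> (upper_mean F + \<epsilon> / 2) + (upper_mean G + \<epsilon> / 2)"
    proof (rule upper_mean_le)
      fix w
      \<comment> \<open>A bound valid at every point of the orbit survives further averaging; for F
        the averages are first interchanged so that the one over vs is the inner one.\<close>
      have "orbit_avg (minkowski_list vs ws) F (transl w f) \<le> upper_mean F + \<epsilon> / 2"
        unfolding orbit_avg_minkowski orbit_avg_commute[of vs]
        by (rule orbit_avg_le[OF ws(1)]) (simp add: transl_transl vs(2))
      moreover have "orbit_avg (minkowski_list vs ws) G (transl w f) \<le> upper_mean G + \<epsilon> / 2"
        unfolding orbit_avg_minkowski
        by (rule orbit_avg_le[OF vs(1)]) (simp add: transl_transl ws(2))
      ultimately show "orbit_avg (minkowski_list vs ws) (\<lambda>h. F h + G h) (transl w f)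
          \<le> (upper_mean F + \<epsilon> / 2) + (upper_mean G + \<epsilon> / 2)"
        by (simp add: orbit_avg_add)
    qed (use FG Sd_continuous.add_mem minkowski_list_ne vs(1) ws(1) in auto)
    then show "upper_mean (\<lambda>h. F h + G h) \<le> upper_mean F + upper_mean G + \<epsilon>" by simp
  qed
next
  fix F :: "('a \<Rightarrow> real) \<Rightarrow> real" and c :: real assume F: "F \<in> Sd_continuous" and c: "0 < c"
  have "upper_mean (\<lambda>h. c * F h) / c \<le> upper_mean F"
  proof (rule field_le_epsilon)
    fix \<epsilon> :: real assume \<epsilon>: "0 < \<epsilon>"
    obtain vs where vs: "vs \<noteq> []" "\<And>w. orbit_avg vs F (transl w f) \<le> upper_mean F + \<epsilon>"
      using upper_mean_less[OF F, of "upper_mean F + \<epsilon>"] \<epsilon> by (metis less_add_same_cancel1)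
    have "upper_mean (\<lambda>h. c * F h) \<le> c * (upper_mean F + \<epsilon>)"
      using vs c by (intro upper_mean_le[OF Sd_continuous.scale_mem[OF F] vs(1)])
        (simp add: orbit_avg_scale)
    then show "upper_mean (\<lambda>h. c * F h) / c \<le> upper_mean F + \<epsilon>" using c by (simp add: field_simps)
  qed
  then show "upper_mean (\<lambda>h. c * F h) \<le> c * upper_mean F" using c by (simp add: field_simps)
qed

text \<open>Averaging over 0, v, ..., (m - 1) v telescopes and leaves at most 2 B / m. Applied to F
  and to - F, this makes dominated linear functionals invariant.\<close>

lemma upper_mean_coboundary:
  assumes F: "F \<in> Sd_continuous"
  shows "upper_mean (\<lambda>h. F h - F (transl v h)) \<le> 0"
proof (rule field_le_epsilon)
  fix \<epsilon> :: real assume \<epsilon>: "0 < \<epsilon>"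
  obtain B where B: "\<And>h. h \<in> Sd \<Longrightarrow> \<bar>F h\<bar> \<le> B" using Sd_continuous_bounded[OF F] by blast
  obtain n where n: "2 * B / \<epsilon> < real n" using reals_Archimedean2 by blast
  define m where "m = Suc n"
  have m: "0 < m" "2 * B \<le> \<epsilon> * real m" using n \<epsilon> by (auto simp: m_def field_simps)
  have "upper_mean (\<lambda>h. F h - F (transl v h)) \<le> \<epsilon>"
  proof (rule upper_mean_le)
    show "(\<lambda>h. F h - F (transl v h)) \<in> Sd_continuous"
      by (intro Sd_continuous.diff_mem F Sd_continuous_transl)
    show "map (\<lambda>i. real i *\<^sub>R v) [0..<m] \<noteq> []" using m by simp
    fix w
    let ?h = "\<lambda>i. F (transl (real i *\<^sub>R v) (transl w f))"
    have "transl v (transl (real i *\<^sub>R v) h) = transl (real (Suc i) *\<^sub>R v) h" for i and h :: "'a \<Rightarrow> real"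
      by (simp add: transl_transl scaleR_add_left)
    then have "orbit_avg (map (\<lambda>i. real i *\<^sub>R v) [0..<m]) (\<lambda>h. F h - F (transl v h)) (transl w f)
        = (\<Sum>i<m. ?h i - ?h (Suc i)) / real m"
      unfolding orbit_avg_def by (simp add: o_def interv_sum_list_conv_sum_set_nat atLeast0LessThan)
    also have "\<dots> = (?h 0 - ?h m) / real m"
      by (rule arg_cong[OF sum_lessThan_telescope'[of ?h m]])
    also have "\<dots> \<le> (2 * B) / real m"
      using B[OF transl_mem_Sd[OF transl_f_mem], of "real 0 *\<^sub>R v" w]
        B[OF transl_mem_Sd[OF transl_f_mem], of "real m *\<^sub>R v" w]
      by (intro divide_right_mono) (auto simp: abs_le_iff)
    also have "\<dots> \<le> \<epsilon>" using m by (simp add: field_simps)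
    finally show "orbit_avg (map (\<lambda>i. real i *\<^sub>R v) [0..<m]) (\<lambda>h. F h - F (transl v h)) (transl w f) \<le> \<epsilon>" .
  qed
  then show "upper_mean (\<lambda>h. F h - F (transl v h)) \<le> 0 + \<epsilon>" by simp
qed

end

section \<open>Invariant probability measures\<close>

lemma M_T_space: "\<mu> \<in> M_T \<Longrightarrow> space \<mu> = Sd"
  unfolding M_T_def using sets_eq_imp_space_eq[of \<mu> Sd_borel] by (simp add: space_Sd_borel)

lemma M_T_sets: "\<mu> \<in> M_T \<Longrightarrow> sets \<mu> = sets Sd_borel"
  and M_T_prob_space: "\<mu> \<in> M_T \<Longrightarrow> prob_space \<mu>"
  by (simp_all add: M_T_def)

lemma integrable_Sd_continuous:
  assumes "finite_measure \<mu>" "sets \<mu> = sets Sd_borel" and F: "F \<in> Sd_continuous"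
  shows "integrable \<mu> F"
proof -
  interpret finite_measure \<mu> by fact
  obtain B where B: "\<And>h. h \<in> Sd \<Longrightarrow> \<bar>F h\<bar> \<le> B" using Sd_continuous_bounded[OF F] by blast
  have "space \<mu> = Sd" using sets_eq_imp_space_eq[OF assms(2)] by (simp add: space_Sd_borel)
  moreover have "F \<in> borel_measurable \<mu>"
    using Sd_continuous_measurable[OF F] measurable_cong_sets[OF assms(2) refl] by auto
  ultimately show ?thesis using B by (intro integrable_const_bound[of _ B]) auto
qed

text \<open>Open sets form a generating \<pi>-system, and the indicator of an open set is the
  bounded limit of min 1 (n F), with F positive exactly on that set.\<close>

lemma Sd_borel_measure_eqI:
  fixes \<mu> \<nu> :: "('a::euclidean_space \<Rightarrow> real) measure"
  assumes \<mu>: "prob_space \<mu>" "sets \<mu> = sets Sd_borel" and \<nu>: "prob_space \<nu>" "sets \<nu> = sets Sd_borel"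
    and eq: "\<And>F. F \<in> Sd_continuous \<Longrightarrow> (\<integral>h. F h \<partial>\<mu>) = (\<integral>h. F h \<partial>\<nu>)"
  shows "\<mu> = \<nu>"
proof -
  interpret M: prob_space \<mu> by fact
  interpret N: prob_space \<nu> by fact
  show ?thesis
  proof (rule measure_eqI_generator_eq[where \<Omega>=Sd and E="{U. openin Sd_top U}" and A="\<lambda>_. Sd"])
    show "Int_stable {U. openin Sd_top U}" by (auto simp: Int_stable_def)
    show "{U. openin Sd_top U} \<subseteq> Pow Sd" by (rule open_subset_Pow_Sd)
    show "sets \<mu> = sigma_sets Sd {U. openin Sd_top U}" "sets \<nu> = sigma_sets Sd {U. openin Sd_top U}"
      using \<mu> \<nu> by (simp_all add: sets_Sd_borel)
    show "range (\<lambda>_::nat. Sd) \<subseteq> {U. openin Sd_top U}"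
      using openin_topspace[of Sd_top] by (auto simp: topspace_Sd_top)
    show "emeasure \<mu> Sd \<noteq> \<infinity>" for i :: nat
      by (simp add: M.emeasure_finite)
    fix U :: "('a \<Rightarrow> real) set" assume "U \<in> {U. openin Sd_top U}"
    then have U: "openin Sd_top U" by simp
    obtain F where F: "continuous_map Sd_top euclideanreal F" "\<And>h. 0 \<le> F h" "\<And>h. h \<in> Sd \<Longrightarrow> 0 < F h \<longleftrightarrow> h \<in> U"
      using open_as_positive_set[OF U] by metis
    let ?G = "\<lambda>n h. min 1 (real n * F h)"
    have G: "?G n \<in> Sd_continuous" for n
      using F(1) by (intro Sd_continuous_min Sd_continuous_const Sd_continuous.scale_mem) (simp add: Sd_continuous_def)
    have lim: "(\<lambda>n. \<integral>h. ?G n h \<partial>\<rho>) \<longlonglongrightarrow> measure \<rho> U" if \<rho>: "prob_space \<rho>" "sets \<rho> = sets Sd_borel" for \<rho> :: "('a \<Rightarrow> real) measure"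
    proof -
      interpret prob_space \<rho> by fact
      have sp: "space \<rho> = Sd" using sets_eq_imp_space_eq[OF \<rho>(2)] by (simp add: space_Sd_borel)
      have U\<rho>: "U \<in> sets \<rho>" using open_in_Sd_borel[OF U] \<rho>(2) by simp
      have "(\<lambda>n. \<integral>h. ?G n h \<partial>\<rho>) \<longlonglongrightarrow> (\<integral>h. indicator U h \<partial>\<rho>)"
      proof (rule integral_dominated_convergence[where w="\<lambda>_. 1"])
        show "indicator U \<in> borel_measurable \<rho>" using U\<rho> by simp
        show "?G n \<in> borel_measurable \<rho>" for n
          using integrable_Sd_continuous[OF finite_measure_axioms \<rho>(2) G[of n]] by auto
        show "AE h in \<rho>. norm (?G n h) \<le> 1" for n
        proof (rule AE_I2)
          fix h
          have "0 \<le> real n * F h" using F(2) by simp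
          then show "norm (?G n h) \<le> 1" by auto
        qed
        show "AE h in \<rho>. (\<lambda>n. ?G n h) \<longlonglongrightarrow> indicator U h"
        proof (rule AE_I2)
          fix h assume "h \<in> space \<rho>"
          then have h: "h \<in> Sd" by (simp add: sp)
          show "(\<lambda>n. ?G n h) \<longlonglongrightarrow> indicator U h"
          proof (cases "h \<in> U")
            case True
            then have pos: "0 < F h" using F(3)[OF h] by simp
            obtain N where N: "1 / F h < real N" using reals_Archimedean2 by blast
            have "?G n h = indicator U h" if "N \<le> n" for n
            proof -
              have "1 / F h \<le> real n" using N that by linarith
              then show ?thesis using pos True by (simp add: field_simps)
            qed
            then show ?thesis by (intro tendsto_eventually) (auto simp: eventually_sequentially)
          next
            case False
            then have "F h = 0" using F(2)[of h] F(3)[OF h] by simp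
            then show ?thesis using False by simp
          qed
        qed
      qed simp
      then show ?thesis using U\<rho> by simp
    qed
    have "measure \<mu> U = measure \<nu> U"
      using LIMSEQ_unique[OF lim[OF \<mu>]] lim[OF \<nu>] eq[OF G] by simp
    then show "emeasure \<mu> U = emeasure \<nu> U"
      by (simp add: M.emeasure_eq_measure N.emeasure_eq_measure)
  qed (use openin_topspace[of Sd_top] in \<open>auto simp: topspace_Sd_top\<close>)
qed

lemma M_T_iff_distr:
  assumes "prob_space \<mu>" and sets: "sets \<mu> = sets Sd_borel"
  shows "\<mu> \<in> M_T \<longleftrightarrow> (\<forall>v. distr \<mu> Sd_borel (transl v) = \<mu>)"
proof -
  have meas: "transl v \<in> measurable \<mu> Sd_borel" for v
    using transl_measurable measurable_cong_sets[OF sets refl] by auto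
  have "distr \<mu> Sd_borel (transl v) = \<mu> \<longleftrightarrow>
      (\<forall>A\<in>sets \<mu>. emeasure \<mu> (transl v -` A \<inter> space \<mu>) = emeasure \<mu> A)" for v
  proof
    assume "distr \<mu> Sd_borel (transl v) = \<mu>"
    then show "\<forall>A\<in>sets \<mu>. emeasure \<mu> (transl v -` A \<inter> space \<mu>) = emeasure \<mu> A"
      using emeasure_distr[OF meas[of v]] sets by metis
  next
    assume "\<forall>A\<in>sets \<mu>. emeasure \<mu> (transl v -` A \<inter> space \<mu>) = emeasure \<mu> A"
    then show "distr \<mu> Sd_borel (transl v) = \<mu>"
      by (intro measure_eqI) (simp_all add: sets emeasure_distr[OF meas])
  qed
  then show ?thesis using assms unfolding M_T_def by simp
qed

lemma M_T_integral_transl: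
  assumes \<mu>: "\<mu> \<in> M_T" and F: "F \<in> Sd_continuous"
  shows "(\<integral>h. F (transl v h) \<partial>\<mu>) = (\<integral>h. F h \<partial>\<mu>)"
proof -
  have "transl v \<in> measurable \<mu> Sd_borel"
    using transl_measurable measurable_cong_sets[OF M_T_sets[OF \<mu>] refl] by auto
  from integral_distr[OF this Sd_continuous_measurable[OF F]]
  show ?thesis
    using \<mu> M_T_iff_distr[OF M_T_prob_space[OF \<mu>] M_T_sets[OF \<mu>]] by simp
qed

lemma M_T_integral_orbit_avg:
  assumes \<mu>: "\<mu> \<in> M_T" and F: "F \<in> Sd_continuous" and vs: "vs \<noteq> []"
  shows "(\<integral>h. orbit_avg vs F h \<partial>\<mu>) = (\<integral>h. F h \<partial>\<mu>)"
proof -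
  interpret prob_space \<mu> by (rule M_T_prob_space[OF \<mu>])
  note int = integrable_Sd_continuous[OF finite_measure_axioms M_T_sets[OF \<mu>]]
  have "(\<integral>h. (\<Sum>v\<leftarrow>vs. F (transl v h)) \<partial>\<mu>) = real (length vs) * (\<integral>h. F h \<partial>\<mu>)" for vs
  proof (induction vs)
    case (Cons v vs)
    have "(\<integral>h. F (transl v h) + (\<Sum>v\<leftarrow>vs. F (transl v h)) \<partial>\<mu>)
        = (\<integral>h. F (transl v h) \<partial>\<mu>) + (\<integral>h. (\<Sum>v\<leftarrow>vs. F (transl v h)) \<partial>\<mu>)"
      by (intro Bochner_Integration.integral_add int Sd_continuous_transl F sum_list_mem)
    then show ?case using Cons M_T_integral_transl[OF \<mu> F] by (simp add: distrib_right)
  qed simp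
  then show ?thesis using vs by (simp add: orbit_avg_def)
qed

text \<open>Invariance leaves the integral unchanged when F is averaged over vs, and by continuity a
  bound for the average on the orbit extends to its closure, which has full measure.\<close>

lemma (in orbit) integral_le_upper_mean:
  assumes \<mu>: "\<mu> \<in> M_T" "emeasure \<mu> (orbit_closure f) = 1" and F: "F \<in> Sd_continuous"
  shows "(\<integral>h. F h \<partial>\<mu>) \<le> upper_mean F"
proof (rule field_le_epsilon)
  fix \<epsilon> :: real assume \<epsilon>: "0 < \<epsilon>"
  interpret prob_space \<mu> by (rule M_T_prob_space[OF \<mu>(1)])
  obtain vs where vs: "vs \<noteq> []" "\<And>w. orbit_avg vs F (transl w f) \<le> upper_mean F + \<epsilon>"
    using upper_mean_less[OF F, of "upper_mean F + \<epsilon>"] \<epsilon> by (metis less_add_same_cancel1)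
  have X: "orbit_closure f \<in> sets \<mu>"
    using closed_in_Sd_borel[OF closedin_orbit_closure] M_T_sets[OF \<mu>(1)] by simp
  have "AE h in \<mu>. h \<in> orbit_closure f"
    using \<mu>(2) X by (intro AE_prob_1) (simp add: measure_def)
  then have "AE h in \<mu>. orbit_avg vs F h \<le> upper_mean F + \<epsilon>"
    by eventually_elim (rule le_on_orbit_closure[OF orbit_avg_mem[OF F] f_mem vs(2)])
  then have "(\<integral>h. orbit_avg vs F h \<partial>\<mu>) \<le> (\<integral>h. upper_mean F + \<epsilon> \<partial>\<mu>)"
    by (intro integral_mono_AE integrable_Sd_continuous[OF finite_measure_axioms M_T_sets[OF \<mu>(1)]]
        orbit_avg_mem Sd_continuous_const F)
  then show "(\<integral>h. F h \<partial>\<mu>) \<le> upper_mean F + \<epsilon>"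
    using M_T_integral_orbit_avg[OF \<mu>(1) F vs(1)] by (simp add: prob_space)
qed

section \<open>The upper density as an upper mean\<close>

lemma integrable_indicator_cbox:
  fixes a b :: "'a::euclidean_space"
  shows "integrable lebesgue (indicator (cbox a b) :: 'a \<Rightarrow> real)"
  by (intro integrable_real_indicator lmeasurable_cbox[unfolded fmeasurable_def, THEN CollectD, THEN conjunct1]
      lmeasurable_cbox[unfolded fmeasurable_def, THEN CollectD, THEN conjunct2])

lemma set_integral_eq_pairing: "(\<integral>x\<in>A. h x \<partial>lebesgue) = pairing h (indicator A)"
  by (simp add: set_lebesgue_integral_def mult.commute)

lemma unit_mass_eq_pairing: "unit_mass h = pairing h (indicator (cbox 0 One))"
  by (simp add: unit_mass_def set_integral_eq_pairing)

lemma unit_mass_mem: "unit_mass \<in> Sd_continuous"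
  unfolding Sd_continuous_def unit_mass_eq_pairing[abs_def]
  by (simp add: continuous_map_pairing integrable_indicator_cbox)

lemma pairing_cbox_nonneg: "h \<in> Sd \<Longrightarrow> 0 \<le> pairing h (indicator (cbox a b))"
  by (intro integral_nonneg_AE AE_I2) (simp add: Sd_nonneg)

lemma pairing_cbox_mono:
  assumes "h \<in> Sd" "cbox a b \<subseteq> cbox c d"
  shows "pairing h (indicator (cbox a b)) \<le> pairing h (indicator (cbox c d))"
  using assms Sd_nonneg[OF assms(1)]
  by (intro integral_mono Sd_mult_integrable integrable_indicator_cbox mult_left_mono)
     (auto simp: indicator_def)

lemma pairing_transl_cbox:
  assumes "h \<in> Sd"
  shows "pairing (transl u h) (indicator (cbox a b)) = pairing h (indicator (cbox (a + u) (b + u)))"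
proof -
  have "indicator (cbox a b) (x + - u) = (indicator (cbox (a + u) (b + u)) x :: real)" for x
    by (auto simp: indicator_def mem_box inner_simps algebra_simps)
  then show ?thesis
    using pairing_transl[OF assms integrable_indicator_cbox] by simp
qed

section \<open>Tiling integer cubes by unit cubes\<close>

lemma indicator_cbox_prod:
  fixes x :: "'a::euclidean_space"
  shows "indicator (cbox a b) x = (\<Prod>i\<in>Basis. of_bool (a \<bullet> i \<le> x \<bullet> i \<and> x \<bullet> i \<le> b \<bullet> i) :: real)"
proof (cases "x \<in> cbox a b")
  case True
  then show ?thesis by (simp add: mem_box)
next
  case False
  then obtain i where "i \<in> Basis" "\<not> (a \<bullet> i \<le> x \<bullet> i \<and> x \<bullet> i \<le> b \<bullet> i)" by (auto simp: mem_box)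
  then have "(\<Prod>i\<in>Basis. of_bool (a \<bullet> i \<le> x \<bullet> i \<and> x \<bullet> i \<le> b \<bullet> i) :: real) = 0"
    by (intro prod_zero) auto
  with False show ?thesis by simp
qed

text \<open>Neighbouring closed intervals share an integer end point, which would be counted twice;
  \<open>AE_noninteger_coordinates\<close> discards these points.\<close>

lemma sum_unit_intervals:
  fixes y :: real
  assumes "\<And>j::nat. y \<noteq> real j"
  shows "(\<Sum>j<N. of_bool (real j \<le> y \<and> y \<le> real j + 1)) = (of_bool (0 \<le> y \<and> y \<le> real N) :: real)"
proof (induction N)
  case 0
  show ?case using assms[of 0] by auto
next
  case (Suc N)
  show ?case using assms[of N] unfolding sum.lessThan_Suc Suc by auto
qed

definition lattice_point :: "('a::euclidean_space \<Rightarrow> nat) \<Rightarrow> 'a" where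
  "lattice_point k = (\<Sum>b\<in>Basis. real (k b) *\<^sub>R b)"

lemma AE_noninteger_coordinates:
  "AE x in (lebesgue :: 'a::euclidean_space measure). \<forall>b\<in>Basis. \<forall>j::nat. x \<bullet> b \<noteq> real j"
proof -
  have "AE x in (lebesgue :: 'a measure). x \<bullet> b \<noteq> c" if "b \<in> Basis" for b :: 'a and c :: real
    using negligible_standard_hyperplane[OF that, of c]
    by (intro AE_I'[of "{x. x \<bullet> b = c}"]) (auto simp: negligible_iff_null_sets)
  then have "\<forall>b\<in>Basis. AE x in (lebesgue :: 'a measure). \<forall>j::nat. x \<bullet> b \<noteq> real j"
    by (simp add: AE_all_countable)
  then show ?thesis by (subst AE_ball_countable) (auto simp: countable_finite)
qed

text \<open>Box indicators are products over the coordinates; expanding the product of the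
  one-dimensional sums gives the sum over lattice points.\<close>

lemma tiling_indicator:
  fixes x :: "'a::euclidean_space"
  assumes "\<forall>b\<in>Basis. \<forall>j::nat. x \<bullet> b \<noteq> real j"
  shows "(\<Sum>k\<in>PiE Basis (\<lambda>_. {..<N}). indicator (cbox 0 One) (x + - lattice_point k))
    = (indicator (cbox 0 (real N *\<^sub>R One)) x :: real)"
proof -
  have "indicator (cbox 0 One) (x + - lattice_point k)
      = (\<Prod>b\<in>Basis. of_bool (real (k b) \<le> x \<bullet> b \<and> x \<bullet> b \<le> real (k b) + 1) :: real)" for k
    unfolding indicator_cbox_prod
    by (intro prod.cong refl) (auto simp: lattice_point_def inner_simps algebra_simps)
  then have "(\<Sum>k\<in>PiE Basis (\<lambda>_. {..<N}). indicator (cbox 0 One) (x + - lattice_point k))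
     = (\<Sum>k\<in>PiE Basis (\<lambda>_. {..<N}). \<Prod>b\<in>Basis. of_bool (real (k b) \<le> x \<bullet> b \<and> x \<bullet> b \<le> real (k b) + 1) :: real)"
    by simp
  also have "\<dots> = (\<Prod>b\<in>Basis. \<Sum>j<N. of_bool (real j \<le> x \<bullet> b \<and> x \<bullet> b \<le> real j + 1))"
    by (rule prod_sum_PiE[symmetric]) auto
  also have "\<dots> = (\<Prod>b\<in>Basis. of_bool (0 \<le> x \<bullet> b \<and> x \<bullet> b \<le> real N))"
    using assms by (intro prod.cong refl sum_unit_intervals) auto
  also have "\<dots> = indicator (cbox 0 (real N *\<^sub>R One)) x"
    unfolding indicator_cbox_prod by (intro prod.cong refl) (simp add: inner_simps)
  finally show ?thesis .
qed

lemma sum_unit_mass_lattice: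
  fixes h :: "'a::euclidean_space \<Rightarrow> real"
  assumes h: "h \<in> Sd"
  shows "(\<Sum>k\<in>PiE Basis (\<lambda>_. {..<N}). unit_mass (transl (lattice_point k) h))
    = pairing h (indicator (cbox 0 (real N *\<^sub>R One)))"
proof -
  let ?K = "PiE (Basis :: 'a set) (\<lambda>_. {..<N})"
  let ?g = "\<lambda>k x. indicator (cbox 0 One) (x + - lattice_point k) :: real"
  have g: "integrable lebesgue (?g k)" for k
    by (rule integrable_translation_lebesgue[OF integrable_indicator_cbox])
  have "(\<Sum>k\<in>?K. unit_mass (transl (lattice_point k) h)) = (\<Sum>k\<in>?K. pairing h (?g k))"
    unfolding unit_mass_eq_pairing by (intro sum.cong refl pairing_transl h integrable_indicator_cbox)
  also have "\<dots> = (\<integral>x. (\<Sum>k\<in>?K. h x * ?g k x) \<partial>lebesgue)"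
    by (intro Bochner_Integration.integral_sum[symmetric] Sd_mult_integrable h g)
  also have "\<dots> = pairing h (indicator (cbox 0 (real N *\<^sub>R One)))"
  proof (rule integral_cong_AE)
    show "(\<lambda>x. \<Sum>k\<in>?K. h x * ?g k x) \<in> borel_measurable lebesgue"
      by (intro borel_measurable_integrable Bochner_Integration.integrable_sum Sd_mult_integrable h g)
    show "(\<lambda>x. h x * indicator (cbox 0 (real N *\<^sub>R One)) x) \<in> borel_measurable lebesgue"
      by (intro borel_measurable_integrable Sd_mult_integrable h integrable_indicator_cbox)
    show "AE x in lebesgue. (\<Sum>k\<in>?K. h x * ?g k x) = h x * indicator (cbox 0 (real N *\<^sub>R One)) x"
      using AE_noninteger_coordinates
      by eventually_elim (simp only: sum_distrib_left[symmetric] tiling_indicator)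
  qed
  finally show ?thesis .
qed

text \<open>The list runs through the lattice points of a cube of integer side. It is the bridge
  between list averages and averages over cubes.\<close>

lemma ex_cube_averaging_list:
  assumes "0 < N"
  obtains vs :: "'a::euclidean_space list" where "vs \<noteq> []"
    "\<And>h. h \<in> Sd \<Longrightarrow> orbit_avg vs unit_mass h
       = pairing h (indicator (cbox 0 (real N *\<^sub>R One))) / real N ^ DIM('a)"
proof -
  let ?K = "PiE (Basis :: 'a set) (\<lambda>_. {..<N})"
  have fin: "finite ?K" by (intro finite_PiE) auto
  obtain ks where ks: "set ks = ?K" "distinct ks"
    using finite_distinct_list[OF fin] by (elim exE conjE) (rule that)
  have card: "card ?K = N ^ DIM('a)" by (simp add: card_PiE)
  have len: "length ks = N ^ DIM('a)" using distinct_card[OF ks(2)] ks(1) card by simp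
  have "orbit_avg (map lattice_point ks) unit_mass h
      = pairing h (indicator (cbox 0 (real N *\<^sub>R One))) / real N ^ DIM('a)" if "h \<in> Sd" for h
    unfolding orbit_avg_def sum_unit_mass_lattice[OF that, symmetric]
    using sum_list_distinct_conv_sum_set[OF ks(2), of "\<lambda>k. unit_mass (transl (lattice_point k) h)"]
    by (simp add: ks(1) len o_def)
  moreover have "map lattice_point ks \<noteq> []" using len assms by auto
  ultimately show ?thesis using that by blast
qed

lemma measure_cube: "0 \<le> t \<Longrightarrow> measure lebesgue (cube (v::'a::euclidean_space) t) = t ^ DIM('a)"
  unfolding cube_def by (subst measure_completion) (auto simp: content_cbox_if inner_simps box_eq_empty)

section \<open>List averages against cube averages\<close>

context orbit
begin

definition cube_avg :: "'a \<Rightarrow> real \<Rightarrow> real" where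
  "cube_avg v t = (\<integral>x\<in>cube v t. f x \<partial>lebesgue) / measure lebesgue (cube v t)"

lemma dstar_eq: "dstar f = Limsup at_top (\<lambda>t. SUP v. ereal (cube_avg v t))"
  by (simp add: dstar_def cube_avg_def)

lemma cube_avg_eq: "0 < t \<Longrightarrow> cube_avg v t = pairing f (indicator (cube v t)) / t ^ DIM('a)"
  by (simp add: cube_avg_def set_integral_eq_pairing measure_cube)

lemma cube_avg_nonneg: "0 < t \<Longrightarrow> 0 \<le> cube_avg v t"
  by (simp add: cube_avg_eq cube_def pairing_cbox_nonneg f_mem)

lemma cube_avg_le_1: assumes t: "0 < t" shows "cube_avg v t \<le> 1"
proof -
  have "pairing f (indicator (cube v t)) \<le> (\<integral>x. \<bar>indicator (cube v t) x\<bar> \<partial>lebesgue)"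
    unfolding cube_def using pairing_abs_le[OF f_mem integrable_indicator_cbox] abs_le_D1 by blast
  also have "\<dots> = measure lebesgue (cube v t)" by (simp add: cube_def)
  finally show ?thesis using t by (simp add: cube_avg_eq measure_cube)
qed

lemma pairing_transl_unit_cbox:
  "pairing (transl u f) (indicator (cbox 0 (t *\<^sub>R One))) = pairing f (indicator (cube (u + (t/2) *\<^sub>R One) t))"
proof -
  have "t *\<^sub>R One = (t/2) *\<^sub>R One + (t/2) *\<^sub>R (One :: 'a)"
    by (simp flip: scaleR_add_left)
  then have "t *\<^sub>R One + u = u + (t/2) *\<^sub>R One + (t/2) *\<^sub>R (One :: 'a)"
    by (simp only: ac_simps)
  moreover have "0 + u = u + (t/2) *\<^sub>R One - (t/2) *\<^sub>R (One :: 'a)" by simp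
  ultimately show ?thesis by (simp only: pairing_transl_cbox[OF f_mem] cube_def)
qed

lemma upper_mean_le_SUP_cube_avg:
  assumes N: "0 < N"
  shows "ereal (upper_mean unit_mass) \<le> (SUP v. ereal (cube_avg v (real N)))"
proof -
  define s where "s = (SUP v. ereal (cube_avg v (real N)))"
  have "s \<le> 1" unfolding s_def using N by (intro SUP_least) (simp add: cube_avg_le_1)
  moreover have "0 \<le> s" unfolding s_def using N by (intro SUP_upper2[of 0]) (simp_all add: cube_avg_nonneg)
  ultimately obtain c where c: "s = ereal c" by (cases s) auto
  have le: "cube_avg v (real N) \<le> c" for v
  proof -
    have "ereal (cube_avg v (real N)) \<le> s" unfolding s_def by (rule SUP_upper) simp
    then show ?thesis by (simp add: c)
  qed
  obtain vs :: "'a list" where vs: "vs \<noteq> []" "\<And>h. h \<in> Sd \<Longrightarrow> orbit_avg vs unit_mass h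
       = pairing h (indicator (cbox 0 (real N *\<^sub>R One))) / real N ^ DIM('a)"
    using ex_cube_averaging_list[OF N] by metis
  have "orbit_avg vs unit_mass (transl w f) \<le> c" for w
    \<comment> \<open>\<open>cube\<close> is given by its centre, while the tiled box starts at its
      corner w; hence the shift by half the side.\<close>
    using le[of "w + (real N / 2) *\<^sub>R One"] N
    by (simp add: vs(2)[OF transl_f_mem] pairing_transl_unit_cbox cube_avg_eq)
  then have "upper_mean unit_mass \<le> c" by (rule upper_mean_le[OF unit_mass_mem vs(1)])
  then show ?thesis using c by (simp add: s_def)
qed

lemma upper_mean_le_dstar: "ereal (upper_mean unit_mass) \<le> dstar f"
  unfolding dstar_eq Limsup_def
proof (rule INF_greatest)
  fix P assume "P \<in> {P. eventually P (at_top :: real filter)}"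
  then obtain t0 where t0: "\<And>t. t0 \<le> t \<Longrightarrow> P t" by (auto simp: eventually_at_top_linorder)
  obtain n where n: "t0 < real n" using reals_Archimedean2 by blast
  have "P (real (Suc n))" using n by (intro t0) simp
  then show "ereal (upper_mean unit_mass) \<le> (SUP t\<in>Collect P. SUP v. ereal (cube_avg v t))"
    using upper_mean_le_SUP_cube_avg[of "Suc n"] by (intro SUP_upper2[of "real (Suc n)"]) auto
qed

text \<open>A cube widened by r on every side still covers \<open>cube v t\<close> after each shift
  from vs. So the mass of \<open>cube v t\<close> is at most the average over vs of the masses of
  the shifted wide cubes; interchanging this average with the one that tiles the wide cube bounds it
  by c times the larger volume.\<close>

lemma cube_avg_bound:
  assumes c: "\<And>w. orbit_avg vs unit_mass (transl w f) \<le> c" and vs: "vs \<noteq> []"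
    and r: "\<And>u b. u \<in> set vs \<Longrightarrow> b \<in> Basis \<Longrightarrow> \<bar>u \<bullet> b\<bar> \<le> r" and r0: "0 \<le> r" and t: "0 < t"
  shows "cube_avg v t \<le> c * ((t + (2 * r + 1)) / t) ^ DIM('a)" and "0 \<le> c"
proof -
  \<comment> \<open>Tiling requires an integer side; rounding up costs at most 1, whence 2 * r + 1
    in the bound.\<close>
  define N where "N = nat \<lceil>t + 2 * r\<rceil>"
  have N: "t + 2 * r \<le> real N" "real N \<le> t + (2 * r + 1)" "0 < N"
    using t r0 unfolding N_def by linarith+
  \<comment> \<open>The corner of the cube of side t + 2 r centred at v.\<close>
  define w where "w = v - (t / 2 + r) *\<^sub>R One"
  obtain ns :: "'a list" where ns: "ns \<noteq> []" "\<And>h. h \<in> Sd \<Longrightarrow> orbit_avg ns unit_mass h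
       = pairing h (indicator (cbox 0 (real N *\<^sub>R One))) / real N ^ DIM('a)"
    using ex_cube_averaging_list[OF N(3)] by metis
  have "pairing f (indicator (cube v t)) / real N ^ DIM('a) \<le> orbit_avg vs (orbit_avg ns unit_mass) (transl w f)"
  proof (rule orbit_avg_ge[OF vs])
    fix u assume u: "u \<in> set vs"
    have sub: "cube v t \<subseteq> cbox (0 + (u + w)) (real N *\<^sub>R One + (u + w))"
      unfolding cube_def
    proof (rule subset_box_imp(1)[of _ _ _ _], intro ballI conjI)
      fix b :: 'a assume b: "b \<in> Basis"
      show "(0 + (u + w)) \<bullet> b \<le> (v - (t/2) *\<^sub>R One) \<bullet> b"
        using r[OF u b] b by (simp add: w_def inner_simps)
      show "(v + (t/2) *\<^sub>R One) \<bullet> b \<le> (real N *\<^sub>R One + (u + w)) \<bullet> b"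
        using r[OF u b] b N(1) by (simp add: w_def inner_simps)
    qed
    have "pairing f (indicator (cube v t)) \<le> pairing (transl (u + w) f) (indicator (cbox 0 (real N *\<^sub>R One)))"
      unfolding pairing_transl_cbox[OF f_mem] using sub unfolding cube_def by (rule pairing_cbox_mono[OF f_mem])
    then show "pairing f (indicator (cube v t)) / real N ^ DIM('a) \<le> orbit_avg ns unit_mass (transl u (transl w f))"
      unfolding transl_transl ns(2)[OF transl_f_mem] by (rule divide_right_mono) simp
  qed
  also have "\<dots> = orbit_avg ns (orbit_avg vs unit_mass) (transl w f)" by (rule orbit_avg_commute)
  also have "\<dots> \<le> c" by (rule orbit_avg_le[OF ns(1)]) (simp add: transl_transl c)
  finally have le: "pairing f (indicator (cube v t)) / real N ^ DIM('a) \<le> c" .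
  have "0 \<le> pairing f (indicator (cube v t))" unfolding cube_def by (rule pairing_cbox_nonneg[OF f_mem])
  then have "0 \<le> pairing f (indicator (cube v t)) / real N ^ DIM('a)" by simp
  with le show c0: "0 \<le> c" by linarith
  have "pairing f (indicator (cube v t)) \<le> c * real N ^ DIM('a)"
    using le N(3) by (simp add: divide_le_eq)
  also have "\<dots> \<le> c * (t + (2 * r + 1)) ^ DIM('a)"
    using N(2) c0 by (intro mult_left_mono power_mono) auto
  finally show "cube_avg v t \<le> c * ((t + (2 * r + 1)) / t) ^ DIM('a)"
    using t by (simp add: cube_avg_eq power_divide divide_right_mono)
qed

text \<open>The list vs, and with it r, is fixed before t grows, so the volume ratio in
  \<open>cube_avg_bound\<close> tends to 1. Half of \<epsilon> pays for the choice of vs, half for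
  this limit.\<close>

lemma dstar_le_upper_mean: "dstar f \<le> ereal (upper_mean unit_mass)"
proof (rule ereal_le_epsilon2)
  fix \<epsilon> :: real assume \<epsilon>: "0 < \<epsilon>"
  define c where "c = upper_mean unit_mass + \<epsilon> / 2"
  obtain vs where vs: "vs \<noteq> []" "\<And>w. orbit_avg vs unit_mass (transl w f) \<le> c"
    using upper_mean_less[OF unit_mass_mem, of c] \<epsilon> unfolding c_def by (metis half_gt_zero less_add_same_cancel1)
  define r where "r = (\<Sum>u\<leftarrow>vs. norm u)"
  have r: "\<bar>u \<bullet> b\<bar> \<le> r" if "u \<in> set vs" "b \<in> Basis" for u b
  proof -
    have "\<bar>u \<bullet> b\<bar> \<le> norm u" using that(2) by (rule Basis_le_norm)
    also have "\<dots> \<le> r" unfolding r_def using that(1)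
      by (intro member_le_sum_list) auto
    finally show ?thesis .
  qed
  have r0: "0 \<le> r" unfolding r_def by (intro sum_list_nonneg) auto
  have "((\<lambda>t. 1 + (2 * r + 1) / t) \<longlongrightarrow> 1 + 0) at_top"
    by (intro tendsto_add tendsto_const tendsto_divide_0[OF tendsto_const] filterlim_at_top_imp_at_infinity filterlim_ident)
  then have "((\<lambda>t. c * (1 + (2 * r + 1) / t) ^ DIM('a)) \<longlongrightarrow> c * (1 + 0) ^ DIM('a)) at_top"
    by (intro tendsto_mult tendsto_const tendsto_power)
  then have "eventually (\<lambda>t. c * (1 + (2 * r + 1) / t) ^ DIM('a) < c + \<epsilon> / 2) at_top"
    using \<epsilon> by (intro order_tendstoD(2)) auto
  then have "eventually (\<lambda>t. (SUP v. ereal (cube_avg v t)) \<le> ereal (c + \<epsilon> / 2)) at_top"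
    using eventually_gt_at_top[of 0]
  proof eventually_elim
    case (elim t)
    have eq: "(t + (2 * r + 1)) / t = 1 + (2 * r + 1) / t" using elim(2) by (simp add: field_simps)
    have "cube_avg v t \<le> c + \<epsilon> / 2" for v
      using cube_avg_bound(1)[OF vs(2) vs(1) r r0 elim(2), of v] elim(1) unfolding eq by linarith
    then show ?case by (intro SUP_least) simp
  qed
  then have "dstar f \<le> ereal (c + \<epsilon> / 2)" unfolding dstar_eq by (rule Limsup_bounded)
  then show "dstar f \<le> ereal (upper_mean unit_mass) + ereal \<epsilon>" by (simp add: c_def add.commute)
qed

lemma dstar_eq_upper_mean: "dstar f = ereal (upper_mean unit_mass)"
  using upper_mean_le_dstar dstar_le_upper_mean by (rule antisym[rotated])

end

section \<open>Representing measures and ergodicity\<close>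

context orbit
begin

context
  fixes \<Lambda> :: "(('a \<Rightarrow> real) \<Rightarrow> real) \<Rightarrow> real"
  assumes lin: "linear_on_space Sd_continuous \<Lambda>"
    and dom: "\<And>F. F \<in> Sd_continuous \<Longrightarrow> \<Lambda> F \<le> upper_mean F"
begin

lemma dominated_uminus: "F \<in> Sd_continuous \<Longrightarrow> \<Lambda> (\<lambda>h. - F h) = - \<Lambda> F"
proof -
  assume "F \<in> Sd_continuous"
  then have "\<Lambda> (\<lambda>h. (-1) * F h) = (-1) * \<Lambda> F" using lin unfolding linear_on_space_def by blast
  then show ?thesis by simp
qed

lemma dominated_le: "F \<in> Sd_continuous \<Longrightarrow> (\<And>w. F (transl w f) \<le> c) \<Longrightarrow> \<Lambda> F \<le> c"
  using dom upper_mean_le_sup order_trans by blast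

lemma dominated_ge: "F \<in> Sd_continuous \<Longrightarrow> (\<And>w. c \<le> F (transl w f)) \<Longrightarrow> c \<le> \<Lambda> F"
  using dominated_le[OF Sd_continuous.uminus_mem, of F "- c"] dominated_uminus[of F] by simp

text \<open>Since \<open>upper_mean\<close> only looks at the orbit of f, bounds on the orbit bound
  \<Lambda>. This gives positivity and normalisation, and with the uniform convergence of
  \<open>Sd_continuous_Dini\<close> also downward continuity.\<close>

lemma daniell_dominated: "daniell_functional Sd_continuous Sd \<Lambda>"
proof
  show "(\<lambda>_. 1) \<in> Sd_continuous" by (rule Sd_continuous_const)
  show "(\<lambda>x. max (F x) (G x)) \<in> Sd_continuous"
    if "F \<in> Sd_continuous" "G \<in> Sd_continuous" for F G :: "('a \<Rightarrow> real) \<Rightarrow> real"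
    using that by (rule Sd_continuous_max)
  show "\<exists>B. \<forall>x\<in>Sd. \<bar>F x\<bar> \<le> B" if "F \<in> Sd_continuous" for F :: "('a \<Rightarrow> real) \<Rightarrow> real"
    using that by (rule Sd_continuous_bounded)
  show "linear_on_space Sd_continuous \<Lambda>" by (rule lin)
  show "0 \<le> \<Lambda> F" if "F \<in> Sd_continuous" "\<And>x. x \<in> Sd \<Longrightarrow> 0 \<le> F x" for F
    using that transl_f_mem by (intro dominated_ge) auto
  show "\<Lambda> (\<lambda>_. 1) = 1"
    by (intro antisym dominated_le dominated_ge Sd_continuous_const) auto
  fix Fs :: "nat \<Rightarrow> ('a \<Rightarrow> real) \<Rightarrow> real"
  assume Fs: "\<And>n. Fs n \<in> Sd_continuous" "\<And>n x. x \<in> Sd \<Longrightarrow> Fs (Suc n) x \<le> Fs n x"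
    "\<And>x. x \<in> Sd \<Longrightarrow> (\<lambda>n. Fs n x) \<longlonglongrightarrow> 0"
  have pos: "0 \<le> Fs n x" if "x \<in> Sd" for n x
    by (rule decseq_ge[OF decseq_SucI[of "\<lambda>n. Fs n x", OF Fs(2)[OF that]] Fs(3)[OF that]])
  show "(\<lambda>n. \<Lambda> (Fs n)) \<longlonglongrightarrow> 0"
  proof (rule LIMSEQ_I)
    fix \<epsilon> :: real assume "0 < \<epsilon>"
    then have "0 < \<epsilon> / 2" by simp
    from Sd_continuous_Dini[of Fs, OF Fs this]
    obtain N where N: "\<And>n h. N \<le> n \<Longrightarrow> h \<in> Sd \<Longrightarrow> Fs n h < \<epsilon> / 2" by blast
    have "norm (\<Lambda> (Fs n) - 0) < \<epsilon>" if n: "N \<le> n" for n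
    proof -
      have "\<Lambda> (Fs n) \<le> \<epsilon> / 2" using N[OF n transl_f_mem] by (intro dominated_le Fs(1)) (simp add: less_imp_le)
      moreover have "0 \<le> \<Lambda> (Fs n)" using pos[OF transl_f_mem] by (intro dominated_ge Fs(1))
      ultimately show ?thesis using \<open>0 < \<epsilon>\<close> by simp
    qed
    then show "\<exists>no. \<forall>n\<ge>no. norm (\<Lambda> (Fs n) - 0) < \<epsilon>" by blast
  qed
qed

lemma ex_representing_measure:
  obtains \<mu> where "\<mu> \<in> M_T" "emeasure \<mu> (orbit_closure f) = 1"
    "\<And>F. F \<in> Sd_continuous \<Longrightarrow> (\<integral>h. F h \<partial>\<mu>) = \<Lambda> F"
proof -
  interpret D: daniell_functional Sd_continuous Sd \<Lambda> by (rule daniell_dominated)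
  define \<mu> where "\<mu> = D.base_measure"
  interpret P: prob_space \<mu> unfolding \<mu>_def by (rule D.prob_space_base_measure)
  have sets: "sets \<mu> = sets Sd_borel"
    unfolding \<mu>_def D.sets_base_measure sets_Sd_borel positive_sets_eq_open_sets ..
  have space: "space \<mu> = Sd" unfolding \<mu>_def by (rule D.space_base_measure)
  have int: "(\<integral>h. F h \<partial>\<mu>) = \<Lambda> F" if "F \<in> Sd_continuous" for F
    unfolding \<mu>_def by (rule D.integral_base_measure[OF that])
  \<comment> \<open>Coboundaries have upper mean at most 0, so \<Lambda> F \<le> \<Lambda> (F o
    transl v); the same inequality for - F is the converse.\<close>
  have inv: "\<Lambda> (\<lambda>h. F (transl v h)) = \<Lambda> F" if F: "F \<in> Sd_continuous" for F v
  proof -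
    have cob: "\<Lambda> (\<lambda>h. G h - G (transl v h)) \<le> 0" if "G \<in> Sd_continuous" for G
      using dom[OF Sd_continuous.diff_mem[OF that Sd_continuous_transl[OF that, of v]]]
        upper_mean_coboundary[OF that, of v] by linarith
    have "\<Lambda> G - \<Lambda> (\<lambda>h. G (transl v h)) \<le> 0" if "G \<in> Sd_continuous" for G
      using cob[OF that] D.\<Lambda>_diff[OF that Sd_continuous_transl[OF that, of v]] by simp
    from this[OF F] this[OF Sd_continuous.uminus_mem[OF F]] show ?thesis
      using dominated_uminus[OF F] dominated_uminus[OF Sd_continuous_transl[OF F, of v]] by simp
  qed
  have meas: "transl v \<in> measurable \<mu> Sd_borel" for v
    using transl_measurable measurable_cong_sets[OF sets refl] by auto
  have "distr \<mu> Sd_borel (transl v) = \<mu>" for v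
  proof (rule Sd_borel_measure_eqI[OF P.prob_space_distr[OF meas] _ P.prob_space_axioms sets])
    fix F :: "('a \<Rightarrow> real) \<Rightarrow> real" assume F: "F \<in> Sd_continuous"
    show "(\<integral>h. F h \<partial>distr \<mu> Sd_borel (transl v)) = (\<integral>h. F h \<partial>\<mu>)"
      using integral_distr[OF meas[of v] Sd_continuous_measurable[OF F]] inv[OF F, of v]
        int[OF Sd_continuous_transl[OF F, of v]] int[OF F] by simp
  qed simp
  then have MT: "\<mu> \<in> M_T" using M_T_iff_distr[OF P.prob_space_axioms sets] by blast
  have W: "openin Sd_top (Sd - orbit_closure f)"
    using closedin_orbit_closure[of f] by (simp add: closedin_def topspace_Sd_top)
  \<comment> \<open>A continuous function that is positive exactly off the orbit closure vanishes on
    the orbit, so \<Lambda> F \<le> 0 and the measure cannot charge the complement.\<close>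
  obtain F where F: "continuous_map Sd_top euclideanreal F" "\<And>h. 0 \<le> F h"
    "\<And>h. h \<in> Sd \<Longrightarrow> 0 < F h \<longleftrightarrow> h \<in> Sd - orbit_closure f"
    using open_as_positive_set[OF W] by metis
  have FC: "F \<in> Sd_continuous" using F(1) by (simp add: Sd_continuous_def)
  have sub: "range (\<lambda>v. transl v f) \<subseteq> orbit_closure f"
    unfolding orbit_closure_def using transl_f_mem by (intro closure_of_subset) (auto simp: topspace_Sd_top)
  have "F (transl w f) \<le> 0" for w
  proof (rule ccontr)
    assume "\<not> F (transl w f) \<le> 0"
    then have "transl w f \<notin> orbit_closure f" using F(3)[OF transl_f_mem, of w] by simp
    then show False using sub by blast
  qed
  then have "\<Lambda> F \<le> 0" by (intro dominated_le FC)
  then have "(\<integral>h. F h \<partial>\<mu>) = 0" using int[OF FC] F(2) by (intro antisym integral_nonneg_AE) auto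
  then have "AE h in \<mu>. F h = 0"
    using integral_nonneg_eq_0_iff_AE[OF integrable_Sd_continuous[OF P.finite_measure_axioms sets FC]] F(2) by simp
  then have "AE h in \<mu>. h \<in> orbit_closure f"
    using AE_space
  proof eventually_elim
    case (elim h)
    then show ?case using F(3)[of h] by (auto simp: space)
  qed
  then have "emeasure \<mu> (orbit_closure f) = 1"
    using closed_in_Sd_borel[OF closedin_orbit_closure] sets by (intro P.emeasure_eq_1_AE) auto
  then show ?thesis using that MT int by blast
qed

end

end

text \<open>The null set on which A fails to be invariant may depend on v. This is harmless, because
  invariance of the conditioned measure is tested for one v at a time.\<close>

lemma M_T_restrict:
  assumes \<mu>: "\<mu> \<in> M_T" and A: "A \<in> sets \<mu>" "0 < measure \<mu> A"
    and inv: "\<And>v. AE h in \<mu>. transl v h \<in> A \<longleftrightarrow> h \<in> A"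
  shows "uniform_measure \<mu> A \<in> M_T"
    and "C \<in> sets \<mu> \<Longrightarrow> emeasure \<mu> C = 1 \<Longrightarrow> emeasure (uniform_measure \<mu> A) C = 1"
    and "F \<in> Sd_continuous \<Longrightarrow> (\<integral>h. F h \<partial>uniform_measure \<mu> A) = (\<integral>h. indicator A h * F h \<partial>\<mu>) / measure \<mu> A"
proof -
  interpret prob_space \<mu> by (rule M_T_prob_space[OF \<mu>])
  have A0: "emeasure \<mu> A \<noteq> 0" using A(2) by (simp add: emeasure_eq_measure)
  show "uniform_measure \<mu> A \<in> M_T"
    unfolding M_T_def
  proof (intro CollectI conjI allI ballI)
    show "prob_space (uniform_measure \<mu> A)"
      using A0 by (intro prob_space_uniform_measure) (auto simp: emeasure_eq_measure)
    show "sets (uniform_measure \<mu> A) = sets Sd_borel" using M_T_sets[OF \<mu>] by simp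
    fix v B assume "B \<in> sets (uniform_measure \<mu> A)"
    then have B: "B \<in> sets \<mu>" by simp
    have meas: "transl v \<in> measurable \<mu> \<mu>"
      using transl_measurable measurable_cong_sets[OF M_T_sets[OF \<mu>] M_T_sets[OF \<mu>]] by auto
    have pre: "transl v -` D \<inter> space \<mu> \<in> sets \<mu>" if "D \<in> sets \<mu>" for D
      using measurable_sets[OF meas that] .
    have "emeasure \<mu> (A \<inter> (transl v -` B \<inter> space \<mu>)) = emeasure \<mu> (transl v -` (A \<inter> B) \<inter> space \<mu>)"
      using inv[of v] A(1) B by (intro emeasure_eq_AE sets.Int pre) auto
    also have "\<dots> = emeasure \<mu> (A \<inter> B)"
      using \<mu> A(1) B unfolding M_T_def by blast
    finally show "emeasure (uniform_measure \<mu> A) (transl v -` B \<inter> space (uniform_measure \<mu> A))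
        = emeasure (uniform_measure \<mu> A) B"
      using A(1) B pre[OF B] by simp
  qed
  show "emeasure (uniform_measure \<mu> A) C = 1" if C: "C \<in> sets \<mu>" "emeasure \<mu> C = 1"
  proof -
    have "AE h in \<mu>. h \<in> C" using C by (intro AE_prob_1) (simp add: measure_def)
    then have "emeasure \<mu> (A \<inter> C) = emeasure \<mu> A" using A(1) C(1) by (intro emeasure_eq_AE) auto
    then show ?thesis using A(1) C(1) A0 by (simp add: emeasure_eq_measure ennreal_divide_self)
  qed
  show "(\<integral>h. F h \<partial>uniform_measure \<mu> A) = (\<integral>h. indicator A h * F h \<partial>\<mu>) / measure \<mu> A"
    if F: "F \<in> Sd_continuous" for F
  proof -
    have "F \<in> borel_measurable \<mu>"
      using integrable_Sd_continuous[OF finite_measure_axioms M_T_sets[OF \<mu>] F] by auto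
    moreover have "uniform_measure \<mu> A = density \<mu> (\<lambda>h. ennreal (indicator A h / measure \<mu> A))"
      unfolding uniform_measure_def
    proof (intro density_cong AE_I2)
      show "indicator A h / emeasure \<mu> A = ennreal (indicator A h / measure \<mu> A)" for h
        using A(2) by (auto simp: emeasure_eq_measure divide_ennreal split: split_indicator
            simp flip: ennreal_1)
    qed (use A(1) in measurable)
    ultimately show ?thesis
      using A by (simp add: integral_density)
  qed
qed

text \<open>The two conditioned measures, with weights \<mu> A and 1 - \<mu> A, recombine to
  \<Lambda>. Both are dominated by \<open>upper_mean\<close>, so \<open>facial\<close> makes the
  measure conditioned on A equal to \<mu>, although it does not charge the complement of A.\<close>

lemma (in orbit) ergodic_if_facial:
  assumes fac: "facial Sd_continuous upper_mean \<Lambda>"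
    and \<mu>: "\<mu> \<in> M_T" "emeasure \<mu> (orbit_closure f) = 1"
    and int: "\<And>F. F \<in> Sd_continuous \<Longrightarrow> (\<integral>h. F h \<partial>\<mu>) = \<Lambda> F"
  shows "ergodic \<mu>"
  unfolding ergodic_def
proof (intro ballI impI)
  fix A assume A: "A \<in> sets \<mu>" and "\<forall>v. transl v ` A \<in> sets \<mu> \<and>
     emeasure \<mu> ((transl v ` A - A) \<union> (A - transl v ` A)) = 0"
  then have tA: "transl v ` A \<in> sets \<mu>"
    and null: "emeasure \<mu> ((transl v ` A - A) \<union> (A - transl v ` A)) = 0" for v by auto
  interpret prob_space \<mu> by (rule M_T_prob_space[OF \<mu>(1)])
  note int_F = integrable_Sd_continuous[OF finite_measure_axioms M_T_sets[OF \<mu>(1)]]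
  have inv: "AE h in \<mu>. transl v h \<in> A \<longleftrightarrow> h \<in> A" for v
  proof -
    \<comment> \<open>The image under - v is the preimage under v, which turns the image form of
      invariance in \<open>ergodic\<close> into the pointwise form.\<close>
    have "(transl (- v) ` A - A) \<union> (A - transl (- v) ` A) \<in> null_sets \<mu>"
      using tA[of "- v"] A null[of "- v"] by (auto intro!: null_setsI)
    then have ae: "AE h in \<mu>. h \<notin> (transl (- v) ` A - A) \<union> (A - transl (- v) ` A)" by (rule AE_not_in)
    have eqv: "h \<in> transl (- v) ` A \<longleftrightarrow> transl v h \<in> A" for h
    proof
      assume "transl v h \<in> A"
      then have "transl (- v) (transl v h) \<in> transl (- v) ` A" by blast
      then show "h \<in> transl (- v) ` A" by (simp add: transl_transl transl_0)
    qed (auto simp: transl_transl transl_0)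
    from ae show ?thesis by eventually_elim (use eqv in auto)
  qed
  show "emeasure \<mu> A = 0 \<or> emeasure \<mu> A = 1"
  proof (rule ccontr)
    assume "\<not> ?thesis"
    then have m01: "0 < measure \<mu> A" "measure \<mu> A < 1"
      using measure_nonneg[of \<mu> A] prob_le_1[of A] by (auto simp: emeasure_eq_measure less_le)
    let ?B = "space \<mu> - A"
    have B: "?B \<in> sets \<mu>" "0 < measure \<mu> ?B" using A m01 by (auto simp: prob_compl)
    have invB: "AE h in \<mu>. transl v h \<in> ?B \<longleftrightarrow> h \<in> ?B" for v
      using inv[of v] AE_space
      by eventually_elim (auto simp: M_T_space[OF \<mu>(1)] transl_mem_Sd)
    have X: "orbit_closure f \<in> sets \<mu>"
      using closed_in_Sd_borel[OF closedin_orbit_closure] M_T_sets[OF \<mu>(1)] by simp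
    let ?\<mu>A = "uniform_measure \<mu> A" and ?\<mu>B = "uniform_measure \<mu> ?B"
    note rA = M_T_restrict[OF \<mu>(1) A m01(1) inv] and rB = M_T_restrict[OF \<mu>(1) B invB]
    have lin: "linear_on_space Sd_continuous (\<lambda>F. \<integral>h. F h \<partial>\<nu>)" if "\<nu> \<in> M_T" for \<nu> :: "('a \<Rightarrow> real) measure"
      using integrable_Sd_continuous[OF prob_space.finite_measure[OF M_T_prob_space[OF that]] M_T_sets[OF that]]
      by (simp add: linear_on_space_def)
    have comb: "measure \<mu> A * (\<integral>h. F h \<partial>?\<mu>A) + (1 - measure \<mu> A) * (\<integral>h. F h \<partial>?\<mu>B) = \<Lambda> F"
      if F: "F \<in> Sd_continuous" for F
    proof -
      have pB: "measure \<mu> ?B = 1 - measure \<mu> A" using A by (simp add: prob_compl)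
      have "(\<integral>h. indicator A h * F h \<partial>\<mu>) + (\<integral>h. indicator ?B h * F h \<partial>\<mu>)
          = (\<integral>h. indicator A h * F h + indicator ?B h * F h \<partial>\<mu>)"
        using A B(1) int_F[OF F]
        by (intro Bochner_Integration.integral_add[symmetric] integrable_mult_indicator[where 'b=real, simplified])
      also have "\<dots> = (\<integral>h. F h \<partial>\<mu>)"
        by (intro Bochner_Integration.integral_cong) (auto simp: indicator_def)
      finally show ?thesis
        using m01 B(2) rA(3)[OF F] rB(3)[OF F] int[OF F] by (simp add: pB)
    qed
    have domA: "(\<integral>h. F h \<partial>?\<mu>A) \<le> upper_mean F" and domB: "(\<integral>h. F h \<partial>?\<mu>B) \<le> upper_mean F"
      if "F \<in> Sd_continuous" for F
      using integral_le_upper_mean[OF rA(1) rA(2)[OF X \<mu>(2)] that]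
        integral_le_upper_mean[OF rB(1) rB(2)[OF X \<mu>(2)] that] by auto
    have le: "(\<integral>h. F h \<partial>?\<mu>A) \<le> (\<integral>h. F h \<partial>\<mu>)" if F: "F \<in> Sd_continuous" for F
      using fac[unfolded facial_def, rule_format, OF lin[OF rA(1)] lin[OF rB(1)] domA domB m01 _ F]
        comb int[OF F] by simp
    \<comment> \<open>\<open>facial\<close> yields an inequality only; inserting - F gives
      equality.\<close>
    have "(\<integral>h. F h \<partial>?\<mu>A) = (\<integral>h. F h \<partial>\<mu>)" if F: "F \<in> Sd_continuous" for F
      using le[OF F] le[OF Sd_continuous.uminus_mem[OF F]] by simp
    then have "?\<mu>A = \<mu>"
      using rA(1) \<mu>(1) by (intro Sd_borel_measure_eqI M_T_prob_space M_T_sets)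
    moreover have "emeasure ?\<mu>A ?B = 0" using A B by simp
    ultimately show False using B(2) by (simp add: emeasure_eq_measure)
  qed
qed

theorem theorem2p2:
  fixes f :: "'a::euclidean_space \<Rightarrow> real"
  assumes "f \<in> Sd"
  shows "dstar f = Sup {ereal (\<integral>h. unit_mass h \<partial>\<mu>) | \<mu>.
                         \<mu> \<in> M_T \<and> emeasure \<mu> (orbit_closure f) = 1}
    \<and> (\<exists>\<mu>. \<mu> \<in> M_T \<and> ergodic \<mu> \<and> emeasure \<mu> (orbit_closure f) = 1
          \<and> ereal (\<integral>h. unit_mass h \<partial>\<mu>) = dstar f)"
proof -
  interpret orbit f by unfold_locales (rule assms)
  interpret U: sublinear_functional Sd_continuous upper_mean
    by unfold_locales (rule sublinear_upper_mean)
  obtain \<Lambda> where \<Lambda>: "linear_on_space Sd_continuous \<Lambda>" "\<And>F. F \<in> Sd_continuous \<Longrightarrow> \<Lambda> F \<le> upper_mean F"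
    "\<Lambda> unit_mass = upper_mean unit_mass" "facial Sd_continuous upper_mean \<Lambda>"
    by (rule U.ex_extreme_dominated_functional[OF unit_mass_mem]) (rule that)
  obtain \<mu> where \<mu>: "\<mu> \<in> M_T" "emeasure \<mu> (orbit_closure f) = 1"
    "\<And>F. F \<in> Sd_continuous \<Longrightarrow> (\<integral>h. F h \<partial>\<mu>) = \<Lambda> F"
    by (rule ex_representing_measure[OF \<Lambda>(1)], rule \<Lambda>(2), assumption, rule that)
  have erg: "ergodic \<mu>" by (rule ergodic_if_facial[OF \<Lambda>(4) \<mu>])
  have val: "ereal (\<integral>h. unit_mass h \<partial>\<mu>) = dstar f"
    using \<mu>(3)[OF unit_mass_mem] \<Lambda>(3) by (simp add: dstar_eq_upper_mean)
  have "Sup {ereal (\<integral>h. unit_mass h \<partial>\<mu>) | \<mu>. \<mu> \<in> M_T \<and> emeasure \<mu> (orbit_closure f) = 1} = dstar f"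
  proof (rule antisym)
    show "Sup {ereal (\<integral>h. unit_mass h \<partial>\<mu>) | \<mu>. \<mu> \<in> M_T \<and> emeasure \<mu> (orbit_closure f) = 1} \<le> dstar f"
      using integral_le_upper_mean[OF _ _ unit_mass_mem]
      by (intro Sup_least) (auto simp: dstar_eq_upper_mean)
    show "dstar f \<le> Sup {ereal (\<integral>h. unit_mass h \<partial>\<mu>) | \<mu>. \<mu> \<in> M_T \<and> emeasure \<mu> (orbit_closure f) = 1}"
      using \<mu>(1,2) val[symmetric] by (intro Sup_upper CollectI exI[of _ \<mu>] conjI)
  qed
  then show ?thesis using \<mu>(1,2) erg val by (intro conjI exI[of _ \<mu>]) simp_all
qed

end
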